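(* Let $a>0$ and let $(X_t)_{t\ge 0}$ be the Ornstein-Uhlenbeck process $dX_t=dB_t-aX_t\,dt$, $X_0=B_0$. Let $\eta\in(0,1)$ and let $f:\mathbb{R}_+\to\mathbb{R}_+$ be a probability density function which is regularly varying with exponent $-(1+\eta)$. Put $\lambda^*:=a\eta\in(0,a)$. Then for all $A\in\mathcal{B}(\mathbb{R}_+)$ $$\lim_{t\to\infty} P_f\left(X_t\in A\mid T^X_0>t\right)=\nu_{\lambda^*}(A).$$
   Context: A non-negative measurable function $f:\mathbb{R}_+\to\mathbb{R}_+$ is regularly varying with exponent $\beta\in\mathbb{R}$ if for all $c>0$, $\lim_{u\to\infty} f(cu)/f(u)=c^{\beta}$. A density function is a non-negative measurable function with $\int_0^\infty f(x)\,dx=1$. For a probability measure $\mu$ on $\mathbb{R}$, $P_\mu$ denotes the probability measure under which $(B_t)_{t\ge0}$ is a one-dimensional Brownian motion with initial distribution $\mu$ (so $X_0=B_0$ also has distribution $\mu$); $P_f$ denotes $P_\mu$ when $\mu(dx)=f(x)\,dx$. The hitting time of zero is $T_0^X:=\inf\{t\ge0: X_t=0\}$. For $\lambda\in\mathbb{R}$, $\varphi_\lambda$ denotes the unique solution of $$\tfrac12\varphi_\lambda''(x)+(a x\,\varphi_\lambda(x))'=-\lambda\varphi_\lambda(x),\qquad \varphi_\lambda(0)=0,\quad \varphi_\lambda'(0)=1.$$ For $\lambda\in(0,a]$, $\varphi_\lambda$ is non-negative and integrable on $[0,\infty)$, and $\nu_\lambda$ is the probability measure on $\mathbb{R}_+$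 defined by $$\nu_\lambda(A):=\left(\int_0^\infty\varphi_\lambda(x)\,dx\right)^{-1}\int_A\varphi_\lambda(x)\,dx,\qquad A\in\mathcal{B}(\mathbb{R}_+).$$ *)

theory Defs
  imports "HOL-Probability.Probability"
begin

text \<open>Functions on the half-line \<open>[0,\<infinity>)\<close> are represented by total functions on the reals whose
  values at negative arguments are irrelevant.\<close>

definition regularly_varying :: "(real \<Rightarrow> real) \<Rightarrow> real \<Rightarrow> bool" where
  "regularly_varying f \<beta> \<longleftrightarrow>
     f \<in> borel_measurable (restrict_space borel {0..}) \<and> (\<forall>x\<ge>0. 0 \<le> f x) \<and>
     (\<forall>c>0. ((\<lambda>u. f (c * u) / f u) \<longlongrightarrow> c powr \<beta>) at_top)"

definition density_function :: "(real \<Rightarrow> real) \<Rightarrow> bool" where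
  "density_function f \<longleftrightarrow>
     f \<in> borel_measurable (restrict_space borel {0..}) \<and> (\<forall>x\<ge>0. 0 \<le> f x) \<and>
     (\<integral>\<^sup>+x\<in>{0..}. ennreal (f x) \<partial>lborel) = 1"

definition halfline_distribution :: "(real \<Rightarrow> real) \<Rightarrow> real measure" where
  "halfline_distribution f = density lborel (\<lambda>x. ennreal (f x) * indicator {0..} x)"

text \<open>Processes are indexed by real times, and only times \<open>t \<ge> 0\<close> matter. All paths, rather than
  almost all, are continuous, so that events such as \<open>T\<^sub>0 > t\<close> are measurable without
  completing \<open>M\<close>.\<close>

locale brownian_motion = prob_space M
  for M :: "'a measure" and B :: "real \<Rightarrow> 'a \<Rightarrow> real" and \<mu> :: "real measure" +
  assumes random_variable_B: "0 \<le> t \<Longrightarrow> random_variable borel (B t)"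
    and initial_distribution: "distr M borel (B 0) = \<mu>"
    and normal_increments: "0 \<le> s \<Longrightarrow> s < t \<Longrightarrow>
      distributed M lborel (\<lambda>\<omega>. B t \<omega> - B s \<omega>) (normal_density 0 (sqrt (t - s)))"
    and independent_increments: "\<tau> 0 = (0::real) \<Longrightarrow> (\<And>i. i < n \<Longrightarrow> \<tau> i \<le> \<tau> (Suc i)) \<Longrightarrow>
      indep_vars (\<lambda>_. borel)
        (\<lambda>i \<omega>. case i of 0 \<Rightarrow> B 0 \<omega> | Suc j \<Rightarrow> B (\<tau> (Suc j)) \<omega> - B (\<tau> j) \<omega>) {..n}"
    and continuous_paths: "\<omega> \<in> space M \<Longrightarrow> continuous_on {0..} (\<lambda>t. B t \<omega>)"

text \<open>The noise is additive, so \<open>dX\<^sub>t = dB\<^sub>t - a X\<^sub>t dt\<close> is a pathwise integral equation.\<close>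

definition ornstein_uhlenbeck ::
  "'a measure \<Rightarrow> real \<Rightarrow> (real \<Rightarrow> 'a \<Rightarrow> real) \<Rightarrow> (real \<Rightarrow> 'a \<Rightarrow> real) \<Rightarrow> bool" where
  "ornstein_uhlenbeck M a B X \<longleftrightarrow>
     (\<forall>t\<ge>0. X t \<in> borel_measurable M) \<and>
     (\<forall>\<omega>\<in>space M. continuous_on {0..} (\<lambda>t. X t \<omega>) \<and> X 0 \<omega> = B 0 \<omega> \<and>
        (\<forall>t\<ge>0. X t \<omega> - X 0 \<omega> = (B t \<omega> - B 0 \<omega>) - a * integral {0..t} (\<lambda>s. X s \<omega>)))"

definition hitting_time_zero :: "(real \<Rightarrow> 'a \<Rightarrow> real) \<Rightarrow> 'a \<Rightarrow> ereal" where
  "hitting_time_zero X \<omega> = (INF t\<in>{t. 0 \<le> t \<and> X t \<omega> = 0}. ereal t)"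

definition eigen_ode_solution :: "real \<Rightarrow> real \<Rightarrow> (real \<Rightarrow> real) \<Rightarrow> bool" where
  "eigen_ode_solution a l \<phi> \<longleftrightarrow>
     (\<forall>x. \<phi> field_differentiable at x \<and> deriv \<phi> field_differentiable at x \<and>
        1 / 2 * deriv (deriv \<phi>) x + deriv (\<lambda>y. a * y * \<phi> y) x = - l * \<phi> x) \<and>
     \<phi> 0 = 0 \<and> deriv \<phi> 0 = 1"

definition eigenfunction :: "real \<Rightarrow> real \<Rightarrow> real \<Rightarrow> real" where
  "eigenfunction a l = (THE \<phi>. eigen_ode_solution a l \<phi>)"

definition quasi_stationary_distribution :: "real \<Rightarrow> real \<Rightarrow> real measure" where
  "quasi_stationary_distribution a l = density (restrict_space lborel {0..})
     (\<lambda>x. ennreal (eigenfunction a l x / (LINT y:{0..}|lborel. eigenfunction a l y)))"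

end

theory Submission
  imports Defs
begin

text \<open>Put \<open>r = e\<^sup>a\<^sup>t\<close>. The process \<open>e\<^sup>a\<^sup>s X\<^sub>s\<close> is a time-changed Brownian motion with the same zeros as \<open>X\<close>,
  so by reflection \<open>X\<^sub>t\<close> killed at \<open>0\<close> has density \<open>E (g\<^sub>t (y - B\<^sub>0 / r) - g\<^sub>t (y + B\<^sub>0 / r))\<close>, where \<open>g\<^sub>t\<close> is the
  centred Gaussian density of variance \<open>(1 - r\<^sup>-\<^sup>2) / (2 a)\<close>. Reflection is obtained from the martingales
  \<open>exp (\<theta>\<^sup>2 v / 2) sin (\<theta> Y\<^sub>v)\<close>, which vanish at the hitting time of \<open>0\<close>: they determine the sine transform
  of the killed law, and a law on the positive half-line is determined by its sine transform.

  The tail \<open>F\<close> of \<open>f\<close> is regularly varying with exponent \<open>-\<eta>\<close>, and partial integration turns the density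
  into \<open>\<integral> F (r z) \<partial>\<^sub>z (g\<^sub>t (y - z) - g\<^sub>t (y + z)) dz\<close>. Divided by \<open>F r\<close> it converges to \<open>q = - U'\<close>
  with \<open>U y = \<integral> z\<^sup>-\<^sup>\<eta> (g (y - z) + g (y + z)) dz\<close>. Since \<open>U'' + 2 a y U' + 2 a \<eta> U = 0\<close>, the function \<open>q\<close> is
  a multiple of the eigenfunction for \<open>a \<eta>\<close>. The total masses converge too, because both are values at
  \<open>0\<close> of such functions \<open>U\<close>, and Scheffe's lemma finishes the proof.\<close>

section \<open>Tails of regularly varying functions\<close>

text \<open>Only ratios of \<open>f\<close> at infinity are controlled, and \<open>f\<close> may be
  unbounded on bounded sets, so \<open>f (r z) / f r\<close> need not have a usable majorant near
  \<open>z = 0\<close>. The tail \<open>F\<close> is monotone, hence the partial integration: for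
  large \<open>r\<close> the ratio \<open>F (r z) / F r\<close> is at most a constant times
  \<open>1 + z powr (- \<kappa>)\<close> with \<open>\<eta> < \<kappa> < 1\<close>, integrable at
  \<open>0\<close>. The absorbed kernel vanishes at \<open>z = 0\<close>, so no boundary term
  appears.

  The sine identity is obtained without stochastic integrals and without optional stopping in
  continuous time. Path by path, \<open>exp (a * s) * X s\<close> is approximated by weighted sums
  of Brownian increments. These form a random walk with Gaussian steps, which is stopped at a level
  \<open>\<epsilon> > 0\<close>; the grid is refined first, then \<open>\<epsilon>\<close> tends to
  \<open>0\<close>.

  A sine transform sees only the odd part of a law, so the identity concerns differences of laws.
  Rearranged into sums of probability measures, it comes within reach of Levy's uniqueness
  theorem.\<close>

lemma tail_integral_pos:
  fixes f :: "real \<Rightarrow> real"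
  assumes f: "integrable lborel f" and nonneg: "\<And>x. 0 \<le> f x" and pos: "eventually (\<lambda>x. 0 < f x) at_top"
  shows "0 < (LINT u|lborel. f u * indicator {x<..} u)"
proof -
  obtain N where N: "\<And>u. u \<ge> N \<Longrightarrow> 0 < f u"
    using pos by (auto simp: eventually_at_top_linorder)
  have [measurable]: "f \<in> borel_measurable borel" using f by auto
  let ?h = "\<lambda>u. f u * indicator {x<..} u"
  have int: "integrable lborel ?h"
    using integrable_mult_indicator[OF _ f, of "{x<..}"] by (simp add: mult.commute)
  have "(LINT u|lborel. ?h u) \<noteq> 0"
  proof
    assume "(LINT u|lborel. ?h u) = 0"
    then have "AE u in lborel. ?h u = 0"
      using integral_nonneg_eq_0_iff_AE[OF int] nonneg by auto
    then have "AE u in lborel. u \<notin> {max x N<..<max x N + 1}"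
      by eventually_elim (use N in \<open>force simp: indicator_def less_le split: if_splits\<close>)
    then have "{max x N<..<max x N + 1} \<in> null_sets lborel"
      by (subst AE_iff_null_sets) auto
    then have "emeasure lborel {max x N<..<max x N + 1} = 0" by (simp only: null_setsD1)
    moreover have "emeasure lborel {max x N<..<max x N + 1} = 1"
      by (subst emeasure_lborel_Ioo) auto
    ultimately show False by (metis zero_neq_one)
  qed
  moreover have "0 \<le> (LINT u|lborel. ?h u)" using nonneg by (intro integral_nonneg_AE) auto
  ultimately show ?thesis by simp
qed

text \<open>The direct half of Karamata's theorem for a fixed \<open>c\<close>: beyond some
  \<open>N\<close> the functions \<open>f (c * u)\<close> and \<open>c powr \<beta> * f u\<close>
  differ by at most \<open>d * f u\<close>, and this bound survives integration over
  \<open>{x<..}\<close>. Rescaling the integration variable by \<open>c\<close> contributes one more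
  factor \<open>c\<close>, hence the exponent \<open>\<beta> + 1\<close>.\<close>

lemma regularly_varying_tail_integral:
  fixes f :: "real \<Rightarrow> real"
  assumes f: "integrable lborel f" and nonneg: "\<And>x. 0 \<le> f x"
    and rv: "((\<lambda>u. f (c * u) / f u) \<longlongrightarrow> c powr \<beta>) at_top" and c: "0 < c"
  defines "S \<equiv> \<lambda>x. LINT u|lborel. f u * indicator {x<..} u"
  shows "((\<lambda>x. S (c * x) / S x) \<longlongrightarrow> c powr (\<beta> + 1)) at_top"
    and "0 < S x"
proof -
  have [measurable]: "f \<in> borel_measurable borel" using f by auto
  have cpos: "0 < c powr \<beta>" using c by simp
  \<comment> \<open>Division by \<open>0\<close> yields \<open>0\<close>, so a ratio near its
    positive limit excludes zeros of \<open>f\<close>.\<close>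
  have "eventually (\<lambda>u. f (c * u) / f u > 0) at_top"
    using order_tendstoD(1)[OF rv cpos] .
  then have evpos: "eventually (\<lambda>u. 0 < f u) at_top"
    by eventually_elim (use nonneg in \<open>auto simp: less_le\<close>)
  have Spos: "0 < S x" for x
    unfolding S_def by (rule tail_integral_pos[OF f nonneg evpos])
  then show "0 < S x" .
  have int: "integrable lborel (\<lambda>u. f u * indicator {x<..} u)" for x
    using integrable_mult_indicator[OF _ f, of "{x<..}"] by (simp add: mult.commute)
  have intc: "integrable lborel (\<lambda>u. f (c * u) * indicator {x<..} u)" for x
  proof -
    have "integrable lborel (\<lambda>u. f (0 + c * u))"
      using lborel_integrable_real_affine[OF f, of c 0] c by simp
    from integrable_mult_indicator[OF _ this, of "{x<..}"] show ?thesis by (simp add: mult.commute)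
  qed
  have Sc: "S (c * x) = c * (LINT u|lborel. f (c * u) * indicator {x<..} u)" for x
    unfolding S_def
    by (subst lborel_integral_real_affine[of c _ 0]) (use c in \<open>auto simp: indicator_def\<close>)
  show "((\<lambda>x. S (c * x) / S x) \<longlongrightarrow> c powr (\<beta> + 1)) at_top"
  proof (rule tendstoI)
    fix e :: real assume e: "0 < e"
    \<comment> \<open>Rescaling multiplies the error by \<open>c\<close>; the \<open>2\<close> makes
      the final inequality strict.\<close>
    define d where "d = e / (2 * c)"
    have d: "0 < d" using e c by (simp add: d_def)
    have "eventually (\<lambda>u. dist (f (c * u) / f u) (c powr \<beta>) < d) at_top"
      using tendstoD[OF rv d] .
    with evpos have "eventually (\<lambda>u. \<bar>f (c * u) - c powr \<beta> * f u\<bar> \<le> d * f u) at_top"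
    proof eventually_elim
      case (elim u)
      have "\<bar>f (c * u) - c powr \<beta> * f u\<bar> = \<bar>f (c * u) / f u - c powr \<beta>\<bar> * f u"
        using elim(1) by (simp add: abs_mult_pos' field_simps flip: abs_mult_pos)
      also have "\<dots> \<le> d * f u"
        using elim by (intro mult_right_mono) (auto simp: dist_real_def)
      finally show ?case .
    qed
    then obtain N where N: "\<And>u. u \<ge> N \<Longrightarrow> \<bar>f (c * u) - c powr \<beta> * f u\<bar> \<le> d * f u"
      by (auto simp: eventually_at_top_linorder)
    show "eventually (\<lambda>x. dist (S (c * x) / S x) (c powr (\<beta> + 1)) < e) at_top"
      using eventually_ge_at_top[of N]
    proof eventually_elim
      case (elim x)
      let ?I = "LINT u|lborel. f (c * u) * indicator {x<..} u"
      have "?I - c powr \<beta> * S x = (LINT u|lborel. (f (c * u) - c powr \<beta> * f u) * indicator {x<..} u)"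
        using int intc by (simp add: S_def left_diff_distrib mult.assoc)
      also have "\<bar>\<dots>\<bar> \<le> (LINT u|lborel. \<bar>(f (c * u) - c powr \<beta> * f u) * indicator {x<..} u\<bar>)"
        by (rule integral_abs_bound)
      also have "\<dots> \<le> (LINT u|lborel. d * (f u * indicator {x<..} u))"
      proof (rule integral_mono)
        have "integrable lborel (\<lambda>u. f (c * u) * indicator {x<..} u - c powr \<beta> * (f u * indicator {x<..} u))"
          using int intc by (intro Bochner_Integration.integrable_diff) auto
        then show "integrable lborel (\<lambda>u. \<bar>(f (c * u) - c powr \<beta> * f u) * indicator {x<..} u\<bar>)"
          by (intro integrable_abs) (simp add: left_diff_distrib mult.assoc)
        show "integrable lborel (\<lambda>u. d * (f u * indicator {x<..} u))" using int by auto
        show "\<bar>(f (c * u) - c powr \<beta> * f u) * indicator {x<..} u\<bar> \<le> d * (f u * indicator {x<..} u)" for u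
          using N[of u] elim by (auto simp: indicator_def)
      qed
      also have "\<dots> = d * S x" by (simp add: S_def)
      finally have "\<bar>?I - c powr \<beta> * S x\<bar> \<le> d * S x" .
      then have "\<bar>?I - c powr \<beta> * S x\<bar> / S x \<le> d"
        using Spos[of x] by (simp add: field_simps)
      then have "\<bar>?I / S x - c powr \<beta>\<bar> \<le> d"
        using Spos[of x] by (metis abs_div_pos diff_divide_distrib less_numeral_extra(3) nonzero_mult_div_cancel_right)
      then have "c * \<bar>?I / S x - c powr \<beta>\<bar> \<le> c * d" using c by simp
      also have "c * d < e" using c e by (simp add: d_def)
      finally have "c * \<bar>?I / S x - c powr \<beta>\<bar> < e" .
      moreover have "S (c * x) / S x - c powr (\<beta> + 1) = c * (?I / S x - c powr \<beta>)"
        using c by (simp add: Sc powr_add algebra_simps)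
      ultimately show ?case using c by (simp add: dist_real_def abs_mult)
    qed
  qed
qed

text \<open>Monotonicity makes the ratio limit at \<open>c = 1/2\<close> alone suffice, by iterated doubling.\<close>

lemma potter_bound:
  fixes S :: "real \<Rightarrow> real"
  assumes anti: "antimono S" and pos: "\<And>x. 0 < S x" and bd: "\<And>x. S x \<le> S0"
    and lim: "((\<lambda>x. S (1/2 * x) / S x) \<longlongrightarrow> (1/2) powr (- \<eta>)) at_top"
    and \<kappa>: "\<eta> < \<kappa>" "0 \<le> \<kappa>"
  obtains C r0 where "0 < C" "0 < r0" "\<And>r z. r \<ge> r0 \<Longrightarrow> 0 < z \<Longrightarrow> S (r * z) / S r \<le> C * (1 + z powr (- \<kappa>))"
proof -
  have "(1/2) powr (- \<eta>) < (2::real) powr \<kappa>"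
    using \<kappa> by (simp add: powr_minus powr_divide)
  from order_tendstoD(2)[OF lim this] obtain N where N: "\<And>x. x \<ge> N \<Longrightarrow> S (1/2 * x) / S x < 2 powr \<kappa>"
    by (auto simp: eventually_at_top_linorder)
  define x0 where "x0 = max N 1"
  have x0: "0 < x0" by (simp add: x0_def)
  have half: "S y \<le> 2 powr \<kappa> * S (2 * y)" if "x0 \<le> y" for y
    using N[of "2 * y"] that pos[of "2*y"] x0 by (auto simp: x0_def field_simps)
  \<comment> \<open>Induction on the number \<open>n\<close> of doublings that carry
    \<open>y\<close> to \<open>r\<close> or beyond. The factor \<open>2\<close> in
    \<open>2 * r / y\<close> pays for the last, incomplete doubling.\<close>
  have iter: "S y \<le> (2 * r / y) powr \<kappa> * S r" if "x0 \<le> y" "y \<le> r" "r \<le> 2 ^ n * y" for y r n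
    using that
  proof (induction n arbitrary: y)
    case 0
    then have "r = y" by simp
    moreover have "1 \<le> (2::real) powr \<kappa>" using \<kappa> by (simp add: ge_one_powr_ge_zero)
    ultimately show ?case using pos[of y] 0 x0 by simp
  next
    case (Suc n)
    have y: "0 < y" using Suc x0 by simp
    show ?case
    proof (cases "r < 2 * y")
      case True
      have "S y \<le> 2 powr \<kappa> * S (2 * y)" using half Suc by simp
      also have "\<dots> \<le> 2 powr \<kappa> * S r"
        using True antimonoD[OF anti, of r "2 * y"] by simp
      also have "\<dots> \<le> (2 * r / y) powr \<kappa> * S r"
        using Suc y \<kappa> pos[of r] by (intro mult_right_mono powr_mono2) (auto simp: field_simps)
      finally show ?thesis .
    next
      case False
      have "S y \<le> 2 powr \<kappa> * S (2 * y)" using half Suc by simp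
      also have "S (2 * y) \<le> (2 * r / (2 * y)) powr \<kappa> * S r"
        using False Suc x0 by (intro Suc.IH) auto
      also have "2 powr \<kappa> * ((2 * r / (2 * y)) powr \<kappa> * S r) = (2 * r / y) powr \<kappa> * S r"
        using y Suc.prems by (simp add: powr_mult powr_divide)
      finally show ?thesis by simp
    qed
  qed
  have iter': "S y \<le> (2 * r / y) powr \<kappa> * S r" if yr: "x0 \<le> y" "y \<le> r" for y r
  proof -
    obtain n where "r / y < 2 ^ n" using real_arch_pow[of 2 "r / y"] by auto
    then show ?thesis using yr x0 by (intro iter[of y r n]) (auto simp: field_simps)
  qed
  \<comment> \<open>If \<open>r * z\<close> falls below \<open>x0\<close>, only
    \<open>S \<le> S0\<close> is known there. The quotient \<open>S0 / S x0\<close> lifts the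
    argument to \<open>x0\<close>, and the doubling bound from \<open>x0\<close> to \<open>r\<close>
    applies with \<open>r / x0 < 1 / z\<close>.\<close>
  define C where "C = max 1 (S0 / S x0) * 2 powr \<kappa>"
  have S00: "1 \<le> S0 / S x0" using bd pos by simp
  have twok: "1 \<le> (2::real) powr \<kappa>" using \<kappa> by (simp add: ge_one_powr_ge_zero)
  have C1: "1 \<le> C" "0 < C" and C2: "2 powr \<kappa> \<le> C" and C3: "C = S0 / S x0 * 2 powr \<kappa>"
    using S00 twok mult_mono[of 1 "S0 / S x0" 1 "2 powr \<kappa>"]
      mult_right_mono[of 1 "S0 / S x0" "2 powr \<kappa>"] by (auto simp: C_def max_def)
  show thesis
  proof (rule that[of C x0])
    fix r z :: real assume r: "x0 \<le> r" and z: "0 < z"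
    have zp: "0 < z powr - \<kappa>" using z by simp
    show "S (r * z) / S r \<le> C * (1 + z powr - \<kappa>)"
    proof (cases "z \<ge> 1")
      case True
      have "S (r * z) \<le> S r" using True r x0 by (intro antimonoD[OF anti]) auto
      then have "S (r * z) / S r \<le> 1" using pos by simp
      also have "\<dots> \<le> C * (1 + z powr - \<kappa>)"
        using C1 zp mult_mono[of 1 C 1 "1 + z powr - \<kappa>"] by simp
      finally show ?thesis .
    next
      case False
      have "S (r * z) \<le> C * z powr - \<kappa> * S r"
      proof (cases "x0 \<le> r * z")
        case True
        have "S (r * z) \<le> (2 * r / (r * z)) powr \<kappa> * S r"
          using True False r x0 by (intro iter') auto
        also have "(2 * r / (r * z)) powr \<kappa> = 2 powr \<kappa> * z powr - \<kappa>"
        proof -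
          have *: "2 * r / (r * z) = 2 / z" using r x0 by simp
          show ?thesis unfolding * using z by (simp add: powr_divide powr_minus_divide)
        qed
        finally show ?thesis using C2 zp pos[of r]
          by (smt (verit) mult_right_mono)
      next
        case F: False
        have "S (r * z) \<le> S0 / S x0 * S x0" using bd pos[of x0] by simp
        also have "\<dots> \<le> S0 / S x0 * ((2 * r / x0) powr \<kappa> * S r)"
          using iter'[OF order_refl r] S00 by (intro mult_left_mono) auto
        also have "\<dots> \<le> S0 / S x0 * ((2 / z) powr \<kappa> * S r)"
          using S00 F z x0 r \<kappa> pos[of r]
          by (intro mult_left_mono mult_right_mono powr_mono2) (auto simp: field_simps)
        also have "\<dots> = C * z powr - \<kappa> * S r"
          using z by (simp add: C3 powr_divide powr_minus_divide)
        finally show ?thesis .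
      qed
      then have "S (r * z) / S r \<le> C * z powr - \<kappa>" using pos[of r] by (simp add: field_simps)
      also have "\<dots> \<le> C * (1 + z powr - \<kappa>)" using C1 by simp
      finally show ?thesis .
    qed
  qed (use C1 x0 in auto)
qed

section \<open>Gaussian convolutions of weights on the half-line\<close>

text \<open>Dominated convergence along sequences of difference quotients: by the mean value
  inequality the majorant \<open>D\<close> of the derivative also bounds the quotients. Asking for
  \<open>D\<close> only on a unit neighbourhood of \<open>y0\<close> matters because the Gaussian
  majorants below are uniform only for bounded \<open>y\<close>.\<close>

lemma has_real_derivative_integral:
  fixes h h' :: "real \<Rightarrow> 'a \<Rightarrow> real"
  assumes int: "\<And>y. integrable M (h y)"
    and meas: "h' y0 \<in> borel_measurable M"
    and d: "\<And>y z. \<bar>y - y0\<bar> < 1 \<Longrightarrow> z \<in> space M \<Longrightarrow> ((\<lambda>y. h y z) has_real_derivative h' y z) (at y)"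
    and bd: "\<And>y z. \<bar>y - y0\<bar> < 1 \<Longrightarrow> z \<in> space M \<Longrightarrow> \<bar>h' y z\<bar> \<le> D z"
    and D: "integrable M D"
  shows "((\<lambda>y. \<integral>z. h y z \<partial>M) has_real_derivative (\<integral>z. h' y0 z \<partial>M)) (at y0)"
  unfolding has_field_derivative_iff tendsto_at_iff_sequentially
proof (intro allI impI)
  fix X :: "nat \<Rightarrow> real" assume X: "\<forall>i. X i \<in> UNIV - {y0}" "X \<longlonglongrightarrow> y0"
  have [measurable]: "h y \<in> borel_measurable M" for y using int by auto
  obtain N where N: "\<And>n. n \<ge> N \<Longrightarrow> \<bar>X n - y0\<bar> < 1"
    using LIMSEQ_D[OF X(2), of 1] by auto
  let ?Q = "\<lambda>n z. (h (X n) z - h y0 z) / (X n - y0)"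
  have Xne: "X n \<noteq> y0" for n using X(1) by auto
  have "(\<lambda>n. \<integral>z. ?Q (n + N) z \<partial>M) \<longlonglongrightarrow> (\<integral>z. h' y0 z \<partial>M)"
  proof (rule integral_dominated_convergence[where w = D])
    show "AE z in M. (\<lambda>n. ?Q (n + N) z) \<longlonglongrightarrow> h' y0 z"
    proof (rule AE_I2)
      fix z assume z: "z \<in> space M"
      have "((\<lambda>y. (h y z - h y0 z) / (y - y0)) \<longlongrightarrow> h' y0 z) (at y0)"
        using d[OF _ z, of y0] by (simp add: has_field_derivative_iff)
      then have "((\<lambda>y. (h y z - h y0 z) / (y - y0)) \<circ> X) \<longlonglongrightarrow> h' y0 z"
        using X by (auto simp: tendsto_at_iff_sequentially)
      then show "(\<lambda>n. ?Q (n + N) z) \<longlonglongrightarrow> h' y0 z"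
        using LIMSEQ_ignore_initial_segment[of "\<lambda>n. ?Q n z" _ N] by (simp add: comp_def)
    qed
    show "AE z in M. norm (?Q (n + N) z) \<le> D z" for n
    proof (rule AE_I2)
      fix z assume z: "z \<in> space M"
      have "norm (h (X (n + N)) z - h y0 z) \<le> D z * norm (X (n + N) - y0)"
      proof (rule field_differentiable_bound[of "ball y0 1" "\<lambda>y. h y z" "\<lambda>y. h' y z"])
        show "((\<lambda>y. h y z) has_field_derivative h' y z) (at y within ball y0 1)" if "y \<in> ball y0 1" for y
          using that d[OF _ z, of y] by (auto simp: dist_real_def abs_minus_commute intro: has_field_derivative_at_within)
        show "norm (h' y z) \<le> D z" if "y \<in> ball y0 1" for y
          using that bd[OF _ z, of y] by (auto simp: dist_real_def abs_minus_commute)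
      qed (use N[of "n + N"] in \<open>auto simp: dist_real_def abs_minus_commute\<close>)
      then show "norm (?Q (n + N) z) \<le> D z"
        using Xne[of "n + N"] by (simp add: field_simps)
    qed
  qed (use meas D in auto)
  then have "(\<lambda>n. \<integral>z. ?Q n z \<partial>M) \<longlonglongrightarrow> (\<integral>z. h' y0 z \<partial>M)"
    by (rule LIMSEQ_offset)
  then show "((\<lambda>y. ((\<integral>z. h y z \<partial>M) - (\<integral>z. h y0 z \<partial>M)) / (y - y0)) \<circ> X) \<longlonglongrightarrow> (\<integral>z. h' y0 z \<partial>M)"
    using int by (simp add: comp_def)
qed

text \<open>The parameter is half the inverse variance. Thus \<open>gauss a\<close> is the
  stationary density of the Ornstein-Uhlenbeck process, and the kernel at a finite time has a
  parameter above \<open>a\<close> that decreases to \<open>a\<close>.\<close>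

definition gauss :: "real \<Rightarrow> real \<Rightarrow> real" where
  "gauss b v = sqrt (b / pi) * exp (- b * v\<^sup>2)"

text \<open>The envelope that the doubling bound provides for normalised tails; it is locally
  integrable for \<open>\<kappa> < 1\<close>.\<close>

definition powr_weight :: "real \<Rightarrow> real \<Rightarrow> real" where
  "powr_weight \<kappa> z = indicator {0<..} z * (1 + z powr (- \<kappa>))"

lemma gauss_eq_normal_density:
  assumes "0 < \<sigma>" shows "gauss (1 / (2 * \<sigma>\<^sup>2)) v = normal_density 0 \<sigma> v"
proof -
  have "sqrt (1 / (2 * \<sigma>\<^sup>2) / pi) = 1 / sqrt (2 * pi * \<sigma>\<^sup>2)"
  proof -
    have "1 / (2 * \<sigma>\<^sup>2) / pi = 1 / (2 * pi * \<sigma>\<^sup>2)" by simp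
    then show ?thesis by (simp only: real_sqrt_divide real_sqrt_one)
  qed
  then show ?thesis by (simp add: gauss_def normal_density_def)
qed

lemma gauss_measurable[measurable]: "gauss b \<in> borel_measurable borel"
  unfolding gauss_def by measurable

lemma powr_weight_measurable[measurable]: "powr_weight \<kappa> \<in> borel_measurable borel"
  unfolding powr_weight_def by measurable

lemma powr_weight_nonneg: "0 \<le> powr_weight \<kappa> z"
  by (simp add: powr_weight_def)

lemma gauss_nonneg: "0 < b \<Longrightarrow> 0 \<le> gauss b v"
  by (simp add: gauss_def)

lemma gauss_even: "gauss b (- v) = gauss b v"
  by (simp add: gauss_def)

lemma gauss_has_real_derivative:
  "(gauss b has_real_derivative - (2 * b * v * gauss b v)) (at v)"
  unfolding gauss_def by (auto intro!: derivative_eq_intros)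

lemma gauss_second_derivative:
  "((\<lambda>v. - (2 * b * v * gauss b v)) has_real_derivative (4 * b\<^sup>2 * v\<^sup>2 - 2 * b) * gauss b v) (at v)"
  by (rule DERIV_cong[OF DERIV_minus[OF DERIV_mult[OF DERIV_cmult_Id gauss_has_real_derivative]]])
     (simp add: algebra_simps power2_eq_square)

text \<open>Half of the exponent absorbs the polynomial, through \<open>1 + x \<le> exp x\<close> at
  \<open>x = a / 2 * v\<^sup>2\<close>. The bound is uniform in \<open>b\<close>: the prefactor is
  estimated with \<open>b \<le> 2 * a\<close>, the exponent with \<open>a \<le> b\<close>.\<close>

lemma gauss_bound:
  assumes "0 < a" "a \<le> b" "b \<le> 2 * a"
  shows "(1 + \<bar>v\<bar> + v\<^sup>2) * gauss b v \<le> 2 * (1 + 2 / a) * sqrt (2 * a / pi) * exp (- (a / 2) * v\<^sup>2)"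
proof -
  have 1: "1 + \<bar>v\<bar> + v\<^sup>2 \<le> 2 * (1 + v\<^sup>2)"
  proof (cases "\<bar>v\<bar> \<le> 1")
    case True then show ?thesis by simp (smt (verit) zero_le_power2)
  next
    case False
    then have "\<bar>v\<bar> * 1 \<le> \<bar>v\<bar> * \<bar>v\<bar>" by (intro mult_left_mono) auto
    then show ?thesis by (simp add: power2_eq_square)
  qed
  have "(1 + v\<^sup>2) \<le> (1 + 2 / a) * (1 + a / 2 * v\<^sup>2)"
    using assms by (simp add: field_simps)
  also have "\<dots> \<le> (1 + 2 / a) * exp (a / 2 * v\<^sup>2)"
    using assms by (intro mult_left_mono) auto
  finally have "2 * (1 + v\<^sup>2) \<le> 2 * ((1 + 2 / a) * exp (a / 2 * v\<^sup>2))" by (rule mult_left_mono) simp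
  with 1 have "1 + \<bar>v\<bar> + v\<^sup>2 \<le> 2 * ((1 + 2 / a) * exp (a / 2 * v\<^sup>2))" by (rule order_trans)
  then have 2: "1 + \<bar>v\<bar> + v\<^sup>2 \<le> 2 * (1 + 2 / a) * exp (a / 2 * v\<^sup>2)" by (simp only: mult.assoc)
  have "gauss b v \<le> sqrt (2 * a / pi) * exp (- a * v\<^sup>2)"
    unfolding gauss_def using assms
    by (intro mult_mono) (auto simp: divide_right_mono mult_right_mono)
  then have "(1 + \<bar>v\<bar> + v\<^sup>2) * gauss b v \<le>
      (2 * (1 + 2 / a) * exp (a / 2 * v\<^sup>2)) * (sqrt (2 * a / pi) * exp (- a * v\<^sup>2))"
    using 2 assms by (intro mult_mono) (auto simp: gauss_def)
  also have "\<dots> = 2 * (1 + 2 / a) * sqrt (2 * a / pi) * (exp (a / 2 * v\<^sup>2) * exp (- a * v\<^sup>2))" by simp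
  also have "exp (a / 2 * v\<^sup>2) * exp (- a * v\<^sup>2) = exp (- (a / 2) * v\<^sup>2)"
    by (simp add: flip: exp_add)
  finally show ?thesis .
qed

lemma integrable_exp_minus_square:
  assumes "0 < (c::real)" shows "integrable lborel (\<lambda>v. exp (- c * v\<^sup>2))"
proof -
  have "integrable lborel (\<lambda>v. normal_density 0 (1 / sqrt (2 * c)) v / sqrt (c / pi))"
    using assms by (intro integrable_divide) auto
  moreover have "normal_density 0 (1 / sqrt (2 * c)) v / sqrt (c / pi) = exp (- c * v\<^sup>2)" for v
  proof -
    have "normal_density 0 (1 / sqrt (2 * c)) v = sqrt (c / pi) * exp (- c * v\<^sup>2)"
      using gauss_eq_normal_density[of "1 / sqrt (2 * c)" v] assms
      by (simp add: gauss_def power_divide)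
    then show ?thesis using assms by simp
  qed
  ultimately show ?thesis by simp
qed

text \<open>Each summand of the weight is dominated by the other one on one side of
  \<open>1\<close>: by \<open>z powr (- \<kappa>)\<close> below, where \<open>\<kappa> < 1\<close>
  gives integrability, and by \<open>1\<close> above, where the Gaussian does.\<close>

lemma integrable_powr_weight_gauss:
  assumes "0 \<le> \<kappa>" "\<kappa> < 1" "0 < c"
  shows "integrable lborel (\<lambda>z. powr_weight \<kappa> z * exp (- c * z\<^sup>2))"
proof (rule Bochner_Integration.integrable_bound)
  let ?p = "\<lambda>z::real. indicator {0..1} z * z powr (- \<kappa>)"
  have "((\<lambda>z. z powr (- \<kappa>)) has_integral 1 powr (- \<kappa> + 1) / (- \<kappa> + 1)) {0..1}"
    using assms by (intro has_integral_powr_from_0) auto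
  then have "(?p has_integral 1 powr (- \<kappa> + 1) / (- \<kappa> + 1)) UNIV"
    by (subst (asm) has_integral_restrict_UNIV[symmetric])
       (rule has_integral_eq[rotated], assumption, auto simp: indicator_def)
  then have "(\<integral>\<^sup>+z. ?p z \<partial>lborel) = ennreal (1 powr (- \<kappa> + 1) / (- \<kappa> + 1))"
    by (intro nn_integral_has_integral_lborel) auto
  then have "integrable lborel ?p"
    by (intro integrableI_nonneg) auto
  then show "integrable lborel (\<lambda>z. 2 * ?p z + 2 * exp (- c * z\<^sup>2))"
    using integrable_exp_minus_square[OF assms(3)] by auto
  show "AE z in lborel. norm (powr_weight \<kappa> z * exp (- c * z\<^sup>2)) \<le> norm (2 * ?p z + 2 * exp (- c * z\<^sup>2))"
  proof (rule AE_I2)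
    fix z :: real
    have e: "exp (- c * z\<^sup>2) \<le> 1" using assms by simp
    consider "z \<le> 0" | "0 < z" "z \<le> 1" | "1 < z" by linarith
    then show "norm (powr_weight \<kappa> z * exp (- c * z\<^sup>2)) \<le> norm (2 * ?p z + 2 * exp (- c * z\<^sup>2))"
    proof cases
      case 2
      have "1 \<le> z powr (- \<kappa>)"
        using 2 assms powr_mono'[of "- \<kappa>" 0 z] by simp
      moreover have "z powr (- \<kappa>) * exp (- c * z\<^sup>2) \<le> z powr (- \<kappa>)"
        using mult_left_mono[OF e, of "z powr (- \<kappa>)"] by (simp only: mult_1_right powr_ge_zero)
      moreover have "0 \<le> z powr (- \<kappa>) * exp (- c * z\<^sup>2)" "0 \<le> exp (- c * z\<^sup>2)" by simp_all
      moreover have "powr_weight \<kappa> z * exp (- c * z\<^sup>2) = exp (- c * z\<^sup>2) + z powr (- \<kappa>) * exp (- c * z\<^sup>2)"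
        "?p z = z powr (- \<kappa>)"
        using 2 by (simp_all add: powr_weight_def distrib_right)
      ultimately show ?thesis unfolding real_norm_def by linarith
    next
      case 3
      have "z powr (- \<kappa>) \<le> 1" using 3 assms powr_mono[of "- \<kappa>" 0 z] by simp
      then have "(1 + z powr (- \<kappa>)) * exp (- c * z\<^sup>2) \<le> 2 * exp (- c * z\<^sup>2)"
        by (intro mult_right_mono) auto
      then show ?thesis using 3 by (simp add: powr_weight_def abs_mult)
    qed (auto simp: powr_weight_def)
  qed
qed auto

text \<open>Since \<open>(z - 2 * y)\<^sup>2\<close> is non-negative,
  \<open>z\<^sup>2 / 2 - y\<^sup>2 \<le> (z - y)\<^sup>2\<close>. Halving the exponent thus moves
  the shift into a constant, which produces majorants that do not depend on \<open>y\<close> in a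
  bounded range.\<close>

lemma exp_minus_square_shift:
  assumes "\<bar>y\<bar> \<le> R" "0 < (c::real)"
  shows "exp (- c * (z - y)\<^sup>2) \<le> exp (c * R\<^sup>2) * exp (- (c / 2) * z\<^sup>2)"
proof -
  have "z\<^sup>2 / 2 - y\<^sup>2 \<le> (z - y)\<^sup>2"
    using zero_le_power2[of "z - 2 * y"] by (simp add: power2_eq_square algebra_simps)
  moreover have "y\<^sup>2 \<le> R\<^sup>2" using assms by (simp add: abs_le_square_iff[symmetric])
  ultimately have "z\<^sup>2 / 2 - R\<^sup>2 \<le> (z - y)\<^sup>2" by simp
  then have "c * (z\<^sup>2 / 2 - R\<^sup>2) \<le> c * (z - y)\<^sup>2" using assms by simp
  then show ?thesis by (simp add: algebra_simps flip: exp_add)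
qed

text \<open>The second conclusion is the majorant common to all \<open>\<bar>y\<bar> \<le> R\<close>
  that differentiation under the integral asks for.\<close>

lemma convolution_integrable:
  fixes w h :: "real \<Rightarrow> real"
  assumes [measurable]: "w \<in> borel_measurable borel" "h \<in> borel_measurable borel"
    and w: "\<And>z. \<bar>w z\<bar> \<le> C * powr_weight \<kappa> z" and \<kappa>: "0 \<le> \<kappa>" "\<kappa> < 1"
    and h: "\<And>v. \<bar>h v\<bar> \<le> K * exp (- c * v\<^sup>2)" and c: "0 < c"
  shows "integrable lborel (\<lambda>z. w z * h (z - y))"
    and "\<And>z R. \<bar>y\<bar> \<le> R \<Longrightarrow> \<bar>w z * h (z - y)\<bar> \<le> C * K * exp (c * R\<^sup>2) * (powr_weight \<kappa> z * exp (- (c / 2) * z\<^sup>2))"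
proof -
  have "0 \<le> \<bar>h 0\<bar>" by simp
  also have "\<dots> \<le> K" using h[of 0] by simp
  finally have K: "0 \<le> K" .
  have "0 \<le> \<bar>w 1\<bar>" by simp
  also have "\<dots> \<le> C * 2" using w[of 1] by (simp add: powr_weight_def)
  finally have C: "0 \<le> C" by simp
  show bd: "\<bar>w z * h (z - y)\<bar> \<le> C * K * exp (c * R\<^sup>2) * (powr_weight \<kappa> z * exp (- (c / 2) * z\<^sup>2))"
    if "\<bar>y\<bar> \<le> R" for z R
  proof -
    have "\<bar>h (z - y)\<bar> \<le> K * (exp (c * R\<^sup>2) * exp (- (c / 2) * z\<^sup>2))"
      using h[of "z - y"] mult_left_mono[OF exp_minus_square_shift[OF that c, of z] K] by linarith
    then have "\<bar>w z\<bar> * \<bar>h (z - y)\<bar> \<le> (C * powr_weight \<kappa> z) * (K * (exp (c * R\<^sup>2) * exp (- (c / 2) * z\<^sup>2)))"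
      using w[of z] C powr_weight_nonneg[of \<kappa> z] by (intro mult_mono) auto
    then show ?thesis by (simp add: abs_mult algebra_simps)
  qed
  show "integrable lborel (\<lambda>z. w z * h (z - y))"
  proof (rule Bochner_Integration.integrable_bound)
    show "integrable lborel (\<lambda>z. C * K * exp (c * \<bar>y\<bar>\<^sup>2) * (powr_weight \<kappa> z * exp (- (c / 2) * z\<^sup>2)))"
      using \<kappa> c by (intro integrable_mult_right integrable_powr_weight_gauss) auto
    show "AE z in lborel. norm (w z * h (z - y)) \<le> norm (C * K * exp (c * \<bar>y\<bar>\<^sup>2) * (powr_weight \<kappa> z * exp (- (c / 2) * z\<^sup>2)))"
      using order_trans[OF bd[OF order_refl] abs_ge_self] by simp
  qed auto
qed

lemma convolution_has_real_derivative:
  fixes w h h' :: "real \<Rightarrow> real"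
  assumes [measurable]: "w \<in> borel_measurable borel" "h \<in> borel_measurable borel" "h' \<in> borel_measurable borel"
    and w: "\<And>z. \<bar>w z\<bar> \<le> C * powr_weight \<kappa> z" and \<kappa>: "0 \<le> \<kappa>" "\<kappa> < 1"
    and h: "\<And>v. \<bar>h v\<bar> \<le> K * exp (- c * v\<^sup>2)" and h': "\<And>v. \<bar>h' v\<bar> \<le> K * exp (- c * v\<^sup>2)"
    and c: "0 < c" and d: "\<And>v. (h has_real_derivative h' v) (at v)"
  shows "((\<lambda>y. LINT z|lborel. w z * h (z - y)) has_real_derivative (LINT z|lborel. w z * (- h' (z - y)))) (at y)"
proof (rule has_real_derivative_integral[where h = "\<lambda>y z. w z * h (z - y)" and h' = "\<lambda>y z. w z * (- h' (z - y))"
      and D = "\<lambda>z. C * K * exp (c * (\<bar>y\<bar> + 1)\<^sup>2) * (powr_weight \<kappa> z * exp (- (c / 2) * z\<^sup>2))"])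
  show "integrable lborel (\<lambda>z. w z * h (z - y))" for y
    by (rule convolution_integrable[OF _ _ w \<kappa> h c]) auto
  show "((\<lambda>y. w z * h (z - y)) has_real_derivative w z * - h' (z - y)) (at y)" for y z
  proof -
    have "((\<lambda>y. h (z - y)) has_real_derivative h' (z - y) * (0 - 1)) (at y)"
      by (rule DERIV_chain2[OF d]) (auto intro!: derivative_eq_intros)
    from DERIV_cmult[OF this, of "w z"] show ?thesis by simp
  qed
  show "\<bar>w z * - h' (z - y')\<bar> \<le> C * K * exp (c * (\<bar>y\<bar> + 1)\<^sup>2) * (powr_weight \<kappa> z * exp (- (c / 2) * z\<^sup>2))"
    if "\<bar>y' - y\<bar> < 1" for y' z
    using that convolution_integrable(2)[OF _ _ w \<kappa> h' c, of y' "\<bar>y\<bar> + 1" z] by auto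
  show "integrable lborel (\<lambda>z. C * K * exp (c * (\<bar>y\<bar> + 1)\<^sup>2) * (powr_weight \<kappa> z * exp (- (c / 2) * z\<^sup>2)))"
    using \<kappa> c by (intro integrable_mult_right integrable_powr_weight_gauss) auto
qed auto

lemma gaussian_decay_tendsto_0:
  assumes h: "\<And>v::real. \<bar>h v :: real\<bar> \<le> K * exp (- c * v\<^sup>2)" and c: "0 < c"
    and g: "filterlim (\<lambda>y. \<bar>g y :: real\<bar>) at_top F"
  shows "((\<lambda>y. h (g y)) \<longlongrightarrow> 0) F"
proof (rule Lim_null_comparison)
  show "eventually (\<lambda>y. norm (h (g y)) \<le> K * exp (- (c * \<bar>g y\<bar>\<^sup>2))) F" using h by auto
  have "LIM y F. c * \<bar>g y\<bar>\<^sup>2 :> at_top"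
    using c by (intro filterlim_tendsto_pos_mult_at_top[OF tendsto_const]
        filterlim_pow_at_top g) auto
  then have "LIM y F. - (c * \<bar>g y\<bar>\<^sup>2) :> at_bot" by (simp add: filterlim_uminus_at_top)
  then have "((\<lambda>y. exp (- (c * \<bar>g y\<bar>\<^sup>2))) \<longlongrightarrow> 0) F"
    by (rule filterlim_compose[OF exp_at_bot])
  then show "((\<lambda>y. K * exp (- (c * \<bar>g y\<bar>\<^sup>2))) \<longlongrightarrow> 0) F"
    by (rule tendsto_mult_right_zero)
qed

text \<open>The weight lives on \<open>z > 0\<close>, where \<open>z + y \<ge> z\<close> for
  \<open>y \<ge> 0\<close>; hence the majorant at \<open>y = 0\<close> serves all these
  \<open>y\<close>.\<close>

lemma reflected_argument_convolution_tendsto_0: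
  fixes w h :: "real \<Rightarrow> real"
  assumes [measurable]: "w \<in> borel_measurable borel" "h \<in> borel_measurable borel"
    and w: "\<And>z. \<bar>w z\<bar> \<le> C * powr_weight \<kappa> z" and \<kappa>: "0 \<le> \<kappa>" "\<kappa> < 1"
    and h: "\<And>v. \<bar>h v\<bar> \<le> K * exp (- c * v\<^sup>2)" and c: "0 < c"
  shows "((\<lambda>y. LINT z|lborel. w z * h (z + y)) \<longlongrightarrow> 0) at_top"
proof -
  have w0: "w z = 0" if "z \<le> 0" for z using w[of z] that by (simp add: powr_weight_def)
  have C: "0 \<le> C" using w[of 1] by (simp add: powr_weight_def)
  have K: "0 \<le> K" using h[of 0] by simp
  have "((\<lambda>y. LINT z|lborel. w z * h (z + y)) \<longlongrightarrow> (LINT z|(lborel :: real measure). 0)) at_top"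
  proof (rule integral_dominated_convergence_at_top[where w = "\<lambda>z. C * K * (powr_weight \<kappa> z * exp (- c * z\<^sup>2))"])
    show "integrable lborel (\<lambda>z. C * K * (powr_weight \<kappa> z * exp (- c * z\<^sup>2)))"
      using \<kappa> c by (intro integrable_mult_right integrable_powr_weight_gauss) auto
    show "\<forall>\<^sub>F y in at_top. AE z in lborel. norm (w z * h (z + y)) \<le> C * K * (powr_weight \<kappa> z * exp (- c * z\<^sup>2))"
      using eventually_ge_at_top[of 0]
    proof eventually_elim
      case (elim y)
      show ?case
      proof (rule AE_I2)
        fix z show "norm (w z * h (z + y)) \<le> C * K * (powr_weight \<kappa> z * exp (- c * z\<^sup>2))"
        proof (cases "z \<le> 0")
          case True then show ?thesis using C K by (simp add: w0 powr_weight_nonneg)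
        next
          case False
          then have "z\<^sup>2 \<le> (z + y)\<^sup>2" using elim by (intro power_mono) auto
          then have "exp (- c * (z + y)\<^sup>2) \<le> exp (- c * z\<^sup>2)" using c by simp
          then have "\<bar>h (z + y)\<bar> \<le> K * exp (- c * z\<^sup>2)"
            using h[of "z + y"] mult_left_mono[OF _ K, of "exp (- c * (z + y)\<^sup>2)" "exp (- c * z\<^sup>2)"] by linarith
          then have "\<bar>w z\<bar> * \<bar>h (z + y)\<bar> \<le> (C * powr_weight \<kappa> z) * (K * exp (- c * z\<^sup>2))"
            using w[of z] C powr_weight_nonneg[of \<kappa> z] by (intro mult_mono) auto
          then show ?thesis by (simp add: abs_mult algebra_simps)
        qed
      qed
    qed
    have "filterlim (\<lambda>y. \<bar>z + y\<bar>) at_top at_top" for z :: real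
      by (rule filterlim_at_top_mono[OF filterlim_tendsto_add_at_top[OF tendsto_const[of z] filterlim_ident]])
         (auto intro!: always_eventually)
    then show "AE z in lborel. ((\<lambda>y. w z * h (z + y)) \<longlongrightarrow> 0) at_top"
      by (intro AE_I2 tendsto_mult_right_zero gaussian_decay_tendsto_0[OF h c])
  qed auto
  then show ?thesis by simp
qed

text \<open>The Gaussian bump travels with \<open>y\<close>, so the singularity of \<open>w\<close>
  at \<open>0\<close> and its decay at infinity require different arguments. On \<open>{..1}\<close>
  the window is fixed and the bump leaves it. On \<open>{1<..}\<close> the weight is bounded, and
  the substitution \<open>z = y + v\<close> fixes the bump and moves the weight, which then tends to
  \<open>0\<close> pointwise.\<close>

lemma convolution_tendsto_0_at_top:
  fixes w h :: "real \<Rightarrow> real"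
  assumes [measurable]: "w \<in> borel_measurable borel" "h \<in> borel_measurable borel"
    and w: "\<And>z. \<bar>w z\<bar> \<le> C * powr_weight \<kappa> z" and \<kappa>: "0 \<le> \<kappa>" "\<kappa> < 1"
    and h: "\<And>v. \<bar>h v\<bar> \<le> K * exp (- c * v\<^sup>2)" and c: "0 < c"
    and wlim: "(w \<longlongrightarrow> 0) at_top"
  shows "((\<lambda>y. LINT z|lborel. w z * h (z - y)) \<longlongrightarrow> 0) at_top"
proof -
  have C: "0 \<le> C" using w[of 1] by (simp add: powr_weight_def)
  have K: "0 \<le> K" using h[of 0] by simp
  define w1 where "w1 = (\<lambda>z. w z * indicator {..1} z)"
  define w2 where "w2 = (\<lambda>z. w z * indicator {1<..} z)"
  have [measurable]: "w1 \<in> borel_measurable borel" "w2 \<in> borel_measurable borel"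
    by (auto simp: w1_def w2_def)
  have w1: "\<bar>w1 z\<bar> \<le> C * powr_weight \<kappa> z" and w2: "\<bar>w2 z\<bar> \<le> C * powr_weight \<kappa> z" for z
    using w[of z] C powr_weight_nonneg[of \<kappa> z] by (auto simp: w1_def w2_def indicator_def)
  have w2b: "\<bar>w2 z\<bar> \<le> 2 * C" for z
  proof (cases "1 < z")
    case True
    then have "z powr (- \<kappa>) \<le> 1" using \<kappa> powr_mono[of "- \<kappa>" 0 z] by simp
    then have "C * powr_weight \<kappa> z \<le> C * 2" using C True by (intro mult_left_mono) (auto simp: powr_weight_def)
    then show ?thesis using w2[of z] by simp
  qed (use C in \<open>auto simp: w2_def\<close>)
  have "((\<lambda>y. LINT z|lborel. w1 z * h (z - y)) \<longlongrightarrow> (LINT z|(lborel :: real measure). 0)) at_top"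
  \<comment> \<open>Where \<open>w1\<close> does not vanish, \<open>0 < z \<le> 1\<close> and
    \<open>exp c * exp (- c * z\<^sup>2)\<close> is at least \<open>1\<close>. The majorant is the
    weight itself, brought into a form already known to be integrable.\<close>
  proof (rule integral_dominated_convergence_at_top[where w = "\<lambda>z. C * K * exp c * (powr_weight \<kappa> z * exp (- c * z\<^sup>2))"])
    show "integrable lborel (\<lambda>z. C * K * exp c * (powr_weight \<kappa> z * exp (- c * z\<^sup>2)))"
      using \<kappa> c by (intro integrable_mult_right integrable_powr_weight_gauss) auto
    have bd: "norm (w1 z * h (z - y)) \<le> C * K * exp c * (powr_weight \<kappa> z * exp (- c * z\<^sup>2))" for y z
    proof (cases "0 < z \<and> z \<le> 1")
      case True
      then have "z\<^sup>2 \<le> 1" by (simp add: abs_square_le_1)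
      then have "1 \<le> exp c * exp (- c * z\<^sup>2)"
        using c mult_left_mono[of "z\<^sup>2" 1 c] by (simp flip: exp_add)
      then have "K * 1 \<le> K * (exp c * exp (- c * z\<^sup>2))" using K by (intro mult_left_mono) auto
      moreover have "\<bar>h (z - y)\<bar> \<le> K * 1"
        using h[of "z - y"] mult_left_mono[of "exp (- c * (z - y)\<^sup>2)" 1 K] K c by simp
      ultimately have "\<bar>h (z - y)\<bar> \<le> K * (exp c * exp (- c * z\<^sup>2))" by linarith
      then have "\<bar>w1 z\<bar> * \<bar>h (z - y)\<bar> \<le> (C * powr_weight \<kappa> z) * (K * (exp c * exp (- c * z\<^sup>2)))"
        using w1[of z] C powr_weight_nonneg[of \<kappa> z] by (intro mult_mono) auto
      then show ?thesis by (simp add: abs_mult algebra_simps)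
    next
      case False
      then have "w1 z = 0" using w1[of z] by (auto simp: w1_def powr_weight_def)
      then show ?thesis using C K by (simp add: powr_weight_nonneg)
    qed
    show "\<forall>\<^sub>F y in at_top. AE z in lborel. norm (w1 z * h (z - y)) \<le> C * K * exp c * (powr_weight \<kappa> z * exp (- c * z\<^sup>2))"
      using bd by (intro always_eventually allI AE_I2)
    have "filterlim (\<lambda>y. \<bar>z - y\<bar>) at_top at_top" for z :: real
    proof (rule filterlim_at_top_mono)
      show "filterlim (\<lambda>y. - z + y) at_top at_top"
        by (intro filterlim_tendsto_add_at_top[OF tendsto_const] filterlim_ident)
    qed (auto intro!: always_eventually)
    then show "AE z in lborel. ((\<lambda>y. w1 z * h (z - y)) \<longlongrightarrow> 0) at_top"
      by (intro AE_I2 tendsto_mult_right_zero gaussian_decay_tendsto_0[OF h c])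
  qed auto
  moreover have "((\<lambda>y. LINT v|lborel. w2 (y + 1 * v) * h v) \<longlongrightarrow> (LINT z|(lborel :: real measure). 0)) at_top"
  proof (rule integral_dominated_convergence_at_top[where w = "\<lambda>v. 2 * C * K * exp (- c * v\<^sup>2)"])
    show "integrable lborel (\<lambda>v. 2 * C * K * exp (- c * v\<^sup>2))"
      using integrable_exp_minus_square[OF c] by auto
    show "\<forall>\<^sub>F y in at_top. AE v in lborel. norm (w2 (y + 1 * v) * h v) \<le> 2 * C * K * exp (- c * v\<^sup>2)"
    proof (intro always_eventually allI AE_I2)
      fix y v
      have "\<bar>w2 (y + 1 * v)\<bar> * \<bar>h v\<bar> \<le> 2 * C * (K * exp (- c * v\<^sup>2))"
        using w2b h C by (intro mult_mono) auto
      then show "norm (w2 (y + 1 * v) * h v) \<le> 2 * C * K * exp (- c * v\<^sup>2)"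
        by (simp add: abs_mult algebra_simps)
    qed
    have "(w2 \<longlongrightarrow> 0) at_top"
    proof (rule Lim_transform_eventually[OF wlim])
      show "\<forall>\<^sub>F z in at_top. w z = w2 z"
        using eventually_gt_at_top[of 1] by eventually_elim (simp add: w2_def)
    qed
    then have "((\<lambda>y. w2 (y + 1 * v)) \<longlongrightarrow> 0) at_top" for v
      by (rule filterlim_compose)
         (use filterlim_tendsto_add_at_top[OF tendsto_const[of v] filterlim_ident] in \<open>simp add: add.commute\<close>)
    then show "AE v in lborel. ((\<lambda>y. w2 (y + 1 * v) * h v) \<longlongrightarrow> 0) at_top"
      by (intro AE_I2 tendsto_mult_left_zero)
  qed auto
  moreover have "(LINT v|lborel. w2 (y + 1 * v) * h v) = (LINT z|lborel. w2 z * h (z - y))" for y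
    by (subst lborel_integral_real_affine[of 1 _ y]) auto
  ultimately have "((\<lambda>y. (LINT z|lborel. w1 z * h (z - y)) + (LINT z|lborel. w2 z * h (z - y))) \<longlongrightarrow> 0 + 0) at_top"
    by (intro tendsto_add) auto
  moreover have "(LINT z|lborel. w1 z * h (z - y)) + (LINT z|lborel. w2 z * h (z - y)) = (LINT z|lborel. w z * h (z - y))" for y
  proof -
    have "(LINT z|lborel. w1 z * h (z - y)) + (LINT z|lborel. w2 z * h (z - y)) =
        (LINT z|lborel. w1 z * h (z - y) + w2 z * h (z - y))"
      using convolution_integrable(1)[OF _ _ w1 \<kappa> h c] convolution_integrable(1)[OF _ _ w2 \<kappa> h c]
      by (intro Bochner_Integration.integral_add[symmetric]) auto
    also have "(\<lambda>z. w1 z * h (z - y) + w2 z * h (z - y)) = (\<lambda>z. w z * h (z - y))"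
      by (auto simp: w1_def w2_def indicator_def fun_eq_iff)
    finally show ?thesis .
  qed
  ultimately show ?thesis by simp
qed

text \<open>The first factor dominates the coefficients of the three polynomials that accompany
  \<open>gauss\<close> in its derivatives up to order two, measured against
  \<open>1 + \<bar>v\<bar> + v\<^sup>2\<close>; the second is the constant of
  \<open>gauss_bound\<close>.\<close>

definition gauss_const :: "real \<Rightarrow> real" where
  "gauss_const a = (1 + 4 * a + 4 * a\<^sup>2) * (2 * (1 + 2 / a) * sqrt (2 * a / pi))"

lemma gauss_derivative_bounds:
  assumes a: "0 < a" and b: "a \<le> b" "b \<le> 2 * a"
  shows "\<bar>gauss b v\<bar> \<le> gauss_const a * exp (- (a / 2) * v\<^sup>2)"
    and "\<bar>- (2 * b * v * gauss b v)\<bar> \<le> gauss_const a * exp (- (a / 2) * v\<^sup>2)"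
    and "\<bar>(4 * a\<^sup>2 * v\<^sup>2 - 2 * a) * gauss a v\<bar> \<le> gauss_const a * exp (- (a / 2) * v\<^sup>2)"
proof -
  let ?G = "2 * (1 + 2 / a) * sqrt (2 * a / pi) * exp (- (a / 2) * v\<^sup>2)"
  let ?k = "1 + 4 * a + 4 * a\<^sup>2"
  have K: "gauss_const a * exp (- (a / 2) * v\<^sup>2) = ?k * ?G"
    by (simp add: gauss_const_def)
  have *: "\<bar>P * gauss c v\<bar> \<le> gauss_const a * exp (- (a / 2) * v\<^sup>2)"
    if P: "\<bar>P\<bar> \<le> ?k * (1 + \<bar>v\<bar> + v\<^sup>2)" and c: "a \<le> c" "c \<le> 2 * a" for P c
  proof -
    have g: "0 \<le> gauss c v" using a c by (intro gauss_nonneg) auto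
    have "\<bar>P * gauss c v\<bar> \<le> (?k * (1 + \<bar>v\<bar> + v\<^sup>2)) * gauss c v"
      using P g by (simp add: abs_mult mult_right_mono)
    also have "\<dots> = ?k * ((1 + \<bar>v\<bar> + v\<^sup>2) * gauss c v)" by simp
    also have "\<dots> \<le> ?k * ?G"
      using gauss_bound[OF a c, of v] a by (intro mult_left_mono) auto
    finally show ?thesis by (simp only: K)
  qed
  have sq: "0 \<le> v\<^sup>2" "0 \<le> a\<^sup>2" "0 \<le> a * \<bar>v\<bar>" "0 \<le> a * v\<^sup>2" "0 \<le> a\<^sup>2 * v\<^sup>2" "0 \<le> a\<^sup>2 * \<bar>v\<bar>"
    using a by auto
  have ex: "?k * (1 + \<bar>v\<bar> + v\<^sup>2) = 1 + \<bar>v\<bar> + v\<^sup>2 + 4 * a + 4 * (a * \<bar>v\<bar>) + 4 * (a * v\<^sup>2) + 4 * a\<^sup>2 + 4 * (a\<^sup>2 * \<bar>v\<bar>) + 4 * (a\<^sup>2 * v\<^sup>2)"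
    by (simp add: algebra_simps)
  show "\<bar>gauss b v\<bar> \<le> gauss_const a * exp (- (a / 2) * v\<^sup>2)"
    using *[of 1 b] sq a b unfolding ex by simp
  have "\<bar>- (2 * b * v)\<bar> = 2 * (b * \<bar>v\<bar>)" using a b by (simp add: abs_mult)
  also have "\<dots> \<le> 2 * (2 * a * \<bar>v\<bar>)" using b by (intro mult_left_mono mult_right_mono) auto
  also have "\<dots> \<le> ?k * (1 + \<bar>v\<bar> + v\<^sup>2)" unfolding ex using sq a by simp
  finally show "\<bar>- (2 * b * v * gauss b v)\<bar> \<le> gauss_const a * exp (- (a / 2) * v\<^sup>2)"
    using *[of "- (2 * b * v)" b] b by simp
  have "\<bar>4 * a\<^sup>2 * v\<^sup>2 - 2 * a\<bar> \<le> 4 * (a\<^sup>2 * v\<^sup>2) + 2 * a"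
    using a abs_triangle_ineq4[of "4 * (a\<^sup>2 * v\<^sup>2)" "2 * a"] by (simp add: mult.assoc)
  also have "\<dots> \<le> ?k * (1 + \<bar>v\<bar> + v\<^sup>2)" unfolding ex using sq a by simp
  finally show "\<bar>(4 * a\<^sup>2 * v\<^sup>2 - 2 * a) * gauss a v\<bar> \<le> gauss_const a * exp (- (a / 2) * v\<^sup>2)"
    using *[of "4 * a\<^sup>2 * v\<^sup>2 - 2 * a" a] a by simp
qed

text \<open>The derivative, in the rescaled starting point \<open>z\<close>, of the kernel absorbed
  at \<open>0\<close>. It is paired with the tail of the initial law where the kernel itself would
  be paired with the density.\<close>

definition reflected_gauss_deriv :: "real \<Rightarrow> real \<Rightarrow> real \<Rightarrow> real" where
  "reflected_gauss_deriv b y z = 2 * b * (y - z) * gauss b (y - z) + 2 * b * (y + z) * gauss b (y + z)"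

lemma reflected_gauss_has_real_derivative:
  "((\<lambda>z. gauss b (y - z) - gauss b (y + z)) has_real_derivative reflected_gauss_deriv b y z) (at z)"
  unfolding gauss_def reflected_gauss_deriv_def by (auto intro!: derivative_eq_intros simp: algebra_simps)

lemma reflected_gauss_deriv_measurable[measurable]:
  "reflected_gauss_deriv b y \<in> borel_measurable borel"
  unfolding reflected_gauss_deriv_def by measurable

lemma reflected_gauss_deriv_bound:
  assumes a: "0 < a" and b: "a \<le> b" "b \<le> 2 * a"
  shows "\<bar>reflected_gauss_deriv b y z\<bar> \<le> 2 * gauss_const a * exp (a / 2 * y\<^sup>2) * exp (- (a / 4) * z\<^sup>2)"
proof -
  have K: "0 \<le> gauss_const a" using a by (simp add: gauss_const_def)
  have "\<bar>2 * b * (y - z) * gauss b (y - z)\<bar> \<le> gauss_const a * exp (- (a / 2) * (z - y)\<^sup>2)"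
    using gauss_derivative_bounds(2)[OF a b, of "y - z"] by (simp add: power2_commute)
  also have "\<dots> \<le> gauss_const a * (exp (a / 2 * \<bar>y\<bar>\<^sup>2) * exp (- (a / 2 / 2) * z\<^sup>2))"
    using a by (intro mult_left_mono[OF exp_minus_square_shift K]) auto
  finally have 1: "\<bar>2 * b * (y - z) * gauss b (y - z)\<bar> \<le> gauss_const a * exp (a / 2 * y\<^sup>2) * exp (- (a / 4) * z\<^sup>2)"
    by simp
  have "\<bar>2 * b * (y + z) * gauss b (y + z)\<bar> \<le> gauss_const a * exp (- (a / 2) * (z - - y)\<^sup>2)"
    using gauss_derivative_bounds(2)[OF a b, of "y + z"] by (simp add: add.commute)
  also have "\<dots> \<le> gauss_const a * (exp (a / 2 * \<bar>y\<bar>\<^sup>2) * exp (- (a / 2 / 2) * z\<^sup>2))"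
    using a by (intro mult_left_mono[OF exp_minus_square_shift K]) auto
  finally have 2: "\<bar>2 * b * (y + z) * gauss b (y + z)\<bar> \<le> gauss_const a * exp (a / 2 * y\<^sup>2) * exp (- (a / 4) * z\<^sup>2)"
    by simp
  show ?thesis unfolding reflected_gauss_deriv_def using 1 2 by linarith
qed

text \<open>This is the \<open>U\<close> of the overview for a general weight. Differentiating
  \<open>gauss b (y - z)\<close> in \<open>y\<close> or in \<open>z\<close> differs by a sign, while
  for \<open>gauss b (y + z)\<close> it makes no difference; so the sum here is, up to sign, an
  antiderivative in \<open>y\<close> of the convolution with
  \<open>reflected_gauss_deriv\<close>.\<close>

definition symmetric_convolution :: "(real \<Rightarrow> real) \<Rightarrow> real \<Rightarrow> real \<Rightarrow> real" where
  "symmetric_convolution w b y = (LINT z|lborel. w z * gauss b (z - y)) + (LINT z|lborel. w z * gauss b (z + y))"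

definition reflected_convolution :: "(real \<Rightarrow> real) \<Rightarrow> real \<Rightarrow> real \<Rightarrow> real" where
  "reflected_convolution w b y = (LINT z|lborel. w z * reflected_gauss_deriv b y z)"

section \<open>Derivatives, decay and total mass of the convolutions of a dominated weight\<close>

locale gaussian_weight =
  fixes w :: "real \<Rightarrow> real" and C \<kappa> :: real
  assumes w_measurable[measurable]: "w \<in> borel_measurable borel"
    and w_bound: "\<And>z. \<bar>w z\<bar> \<le> C * powr_weight \<kappa> z"
    and \<kappa>: "0 \<le> \<kappa>" "\<kappa> < 1"
begin

lemma
  assumes b: "0 < b"
  shows gauss_convolution_integrable: "integrable lborel (\<lambda>z. w z * gauss b (z - y))"
    and gauss'_convolution_integrable: "integrable lborel (\<lambda>z. w z * (- (2 * b * (z - y) * gauss b (z - y))))"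
    and gauss''_convolution_integrable: "integrable lborel (\<lambda>z. w z * ((4 * b\<^sup>2 * (z - y)\<^sup>2 - 2 * b) * gauss b (z - y)))"
proof -
  note bd = gauss_derivative_bounds[OF b order_refl]
  have b2: "0 < b / 2" "b \<le> 2 * b" using b by auto
  show "integrable lborel (\<lambda>z. w z * gauss b (z - y))"
    by (rule convolution_integrable(1)[OF _ _ w_bound \<kappa> bd(1)]) (use b2 in auto)
  show "integrable lborel (\<lambda>z. w z * (- (2 * b * (z - y) * gauss b (z - y))))"
    by (rule convolution_integrable(1)[OF _ _ w_bound \<kappa> bd(2)]) (use b2 in auto)
  show "integrable lborel (\<lambda>z. w z * ((4 * b\<^sup>2 * (z - y)\<^sup>2 - 2 * b) * gauss b (z - y)))"
    by (rule convolution_integrable(1)[OF _ _ w_bound \<kappa> bd(3)]) (use b2 in auto)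
qed

lemma
  assumes b: "0 < b"
  shows gauss_convolution_deriv: "((\<lambda>y. LINT z|lborel. w z * gauss b (z - y)) has_real_derivative
      (LINT z|lborel. w z * (2 * b * (z - y) * gauss b (z - y)))) (at y)"
    and gauss'_convolution_deriv: "((\<lambda>y. LINT z|lborel. w z * (2 * b * (z - y) * gauss b (z - y))) has_real_derivative
      (LINT z|lborel. w z * ((4 * b\<^sup>2 * (z - y)\<^sup>2 - 2 * b) * gauss b (z - y)))) (at y)"
proof -
  note bd = gauss_derivative_bounds[OF b order_refl]
  have b2: "0 < b / 2" "b \<le> 2 * b" using b by auto
  show "((\<lambda>y. LINT z|lborel. w z * gauss b (z - y)) has_real_derivative
      (LINT z|lborel. w z * (2 * b * (z - y) * gauss b (z - y)))) (at y)"
    using convolution_has_real_derivative[OF _ _ _ w_bound \<kappa> bd(1) bd(2) b2(1) gauss_has_real_derivative, of y] b2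
    by simp
  have "((\<lambda>y. LINT z|lborel. w z * (- (2 * b * (z - y) * gauss b (z - y)))) has_real_derivative
      (LINT z|lborel. w z * (- ((4 * b\<^sup>2 * (z - y)\<^sup>2 - 2 * b) * gauss b (z - y))))) (at y)"
    using convolution_has_real_derivative[OF _ _ _ w_bound \<kappa> bd(2) bd(3) b2(1) gauss_second_derivative, of y] b2
    by simp
  from DERIV_minus[OF this] show "((\<lambda>y. LINT z|lborel. w z * (2 * b * (z - y) * gauss b (z - y))) has_real_derivative
      (LINT z|lborel. w z * ((4 * b\<^sup>2 * (z - y)\<^sup>2 - 2 * b) * gauss b (z - y)))) (at y)"
    by simp
qed

lemma reflected_convolution_eq:
  assumes b: "0 < b"
  shows "reflected_convolution w b y =
    (LINT z|lborel. w z * (2 * b * (z + y) * gauss b (z + y))) - (LINT z|lborel. w z * (2 * b * (z - y) * gauss b (z - y)))"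
proof -
  have "reflected_convolution w b y = (LINT z|lborel. w z * (2 * b * (z - (- y)) * gauss b (z - (- y))) - w z * (2 * b * (z - y) * gauss b (z - y)))"
    unfolding reflected_convolution_def reflected_gauss_deriv_def
    using gauss_even[of b] by (intro Bochner_Integration.integral_cong)
      (auto simp: algebra_simps gauss_def power2_eq_square)
  also have "\<dots> = (LINT z|lborel. w z * (2 * b * (z - (- y)) * gauss b (z - (- y)))) - (LINT z|lborel. w z * (2 * b * (z - y) * gauss b (z - y)))"
    using integrable_minus[OF gauss'_convolution_integrable[OF b, of y]] integrable_minus[OF gauss'_convolution_integrable[OF b, of "- y"]]
    by (intro Bochner_Integration.integral_diff) auto
  finally show ?thesis by simp
qed

lemma symmetric_convolution_deriv:
  assumes b: "0 < b"
  shows "(symmetric_convolution w b has_real_derivative - reflected_convolution w b y) (at y)"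
proof -
  have "((\<lambda>y. LINT z|lborel. w z * gauss b (z - (- y))) has_real_derivative
      (LINT z|lborel. w z * (2 * b * (z - (- y)) * gauss b (z - (- y)))) * (- 1)) (at y)"
    by (rule DERIV_chain2[OF gauss_convolution_deriv[OF b]]) (auto intro!: derivative_eq_intros)
  from DERIV_add[OF gauss_convolution_deriv[OF b] this] show ?thesis
    unfolding symmetric_convolution_def[abs_def] reflected_convolution_eq[OF b] by simp
qed

lemma reflected_convolution_deriv:
  assumes b: "0 < b"
  shows "(reflected_convolution w b has_real_derivative
    - ((LINT z|lborel. w z * ((4 * b\<^sup>2 * (z - y)\<^sup>2 - 2 * b) * gauss b (z - y)))
     + (LINT z|lborel. w z * ((4 * b\<^sup>2 * (z + y)\<^sup>2 - 2 * b) * gauss b (z + y))))) (at y)"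
proof -
  have "((\<lambda>y. LINT z|lborel. w z * (2 * b * (z - (- y)) * gauss b (z - (- y)))) has_real_derivative
      (LINT z|lborel. w z * ((4 * b\<^sup>2 * (z - (- y))\<^sup>2 - 2 * b) * gauss b (z - (- y)))) * (- 1)) (at y)"
    by (rule DERIV_chain2[OF gauss'_convolution_deriv[OF b]]) (auto intro!: derivative_eq_intros)
  note D = DERIV_diff[OF this gauss'_convolution_deriv[OF b]]
  have eq: "reflected_convolution w b = (\<lambda>y. (LINT z|lborel. w z * (2 * b * (z - (- y)) * gauss b (z - (- y))))
      - (LINT z|lborel. w z * (2 * b * (z - y) * gauss b (z - y))))"
    by (rule ext) (simp add: reflected_convolution_eq[OF b])
  show ?thesis unfolding eq by (rule DERIV_cong[OF D]) simp
qed

lemma symmetric_convolution_tendsto_0: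
  assumes b: "0 < b" and lim: "(w \<longlongrightarrow> 0) at_top"
  shows "(symmetric_convolution w b \<longlongrightarrow> 0) at_top"
proof -
  note bd = gauss_derivative_bounds(1)[OF b order_refl]
  have b2: "0 < b / 2" "b \<le> 2 * b" using b by auto
  have "((\<lambda>y. (LINT z|lborel. w z * gauss b (z - y)) + (LINT z|lborel. w z * gauss b (z + y))) \<longlongrightarrow> 0 + 0) at_top"
    by (intro tendsto_add convolution_tendsto_0_at_top[OF _ _ w_bound \<kappa> bd b2(1) lim]
        reflected_argument_convolution_tendsto_0[OF _ _ w_bound \<kappa> bd b2(1)]) (use b2 in auto)
  then show ?thesis unfolding symmetric_convolution_def[abs_def] by simp
qed

lemma reflected_convolution_measurable[measurable]:
  assumes b: "0 < b" shows "reflected_convolution w b \<in> borel_measurable borel"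
  using reflected_convolution_deriv[OF b]
  by (intro borel_measurable_continuous_onI continuous_at_imp_continuous_on ballI DERIV_isCont)

text \<open>The fundamental theorem on the half-line with antiderivative
  \<open>- symmetric_convolution w b\<close>, which vanishes at infinity. Total masses thereby
  become point values at \<open>0\<close>, and no integrability of the convolution has to be known
  beforehand.\<close>

lemma nn_integral_reflected_convolution:
  assumes b: "0 < b" and lim: "(w \<longlongrightarrow> 0) at_top"
    and nonneg: "\<And>y. 0 \<le> y \<Longrightarrow> 0 \<le> reflected_convolution w b y"
  shows "(\<integral>\<^sup>+y. ennreal (reflected_convolution w b y) * indicator {0..} y \<partial>lborel) = symmetric_convolution w b 0"
proof -
  have "(\<integral>\<^sup>+y. ennreal (reflected_convolution w b y) * indicator {0..} y \<partial>lborel) = ennreal (- 0 - (- symmetric_convolution w b 0))"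
    using DERIV_minus[OF symmetric_convolution_deriv[OF b]] reflected_convolution_measurable[OF b] nonneg
      tendsto_minus[OF symmetric_convolution_tendsto_0[OF b lim]]
    by (intro nn_integral_FTC_atLeast) auto
  then show ?thesis by simp
qed

end

text \<open>One majorant serves all \<open>n\<close>, because the weights share \<open>C\<close> and
  \<open>\<kappa>\<close> and the parameters stay in \<open>{a..2 * a}\<close>. The second limit is
  needed only at \<open>0\<close>, where it expresses convergence of the total masses.\<close>

lemma convolution_limits:
  fixes w :: "nat \<Rightarrow> real \<Rightarrow> real"
  assumes w: "\<And>n. gaussian_weight (w n) C \<kappa>" and v: "gaussian_weight v C \<kappa>"
    and lim: "\<And>z. (\<lambda>n. w n z) \<longlonglongrightarrow> v z"
    and a: "0 < a" and b: "\<And>n. a \<le> b n" "\<And>n. b n \<le> 2 * a" "b \<longlonglongrightarrow> a"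
  shows "(\<lambda>n. reflected_convolution (w n) (b n) y) \<longlonglongrightarrow> reflected_convolution v a y"
    and "(\<lambda>n. symmetric_convolution (w n) (b n) 0) \<longlonglongrightarrow> symmetric_convolution v a 0"
proof -
  interpret v: gaussian_weight v C \<kappa> by (rule v)
  have [measurable]: "w n \<in> borel_measurable borel" for n
    using w[of n] by (simp add: gaussian_weight_def)
  have wb: "\<bar>w n z\<bar> \<le> C * powr_weight \<kappa> z" for n z
    using w[of n] by (simp add: gaussian_weight_def)
  have C: "0 \<le> C" using v.w_bound[of 1] by (simp add: powr_weight_def)
  have glim: "(\<lambda>n. gauss (b n) x) \<longlonglongrightarrow> gauss a x" for x
    unfolding gauss_def by (intro tendsto_intros b(3)) auto
  show "(\<lambda>n. reflected_convolution (w n) (b n) y) \<longlonglongrightarrow> reflected_convolution v a y"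
    unfolding reflected_convolution_def
  proof (rule integral_dominated_convergence[where w =
        "\<lambda>z. C * (2 * gauss_const a * exp (a / 2 * y\<^sup>2)) * (powr_weight \<kappa> z * exp (- (a / 4) * z\<^sup>2))"])
    show "integrable lborel (\<lambda>z. C * (2 * gauss_const a * exp (a / 2 * y\<^sup>2)) * (powr_weight \<kappa> z * exp (- (a / 4) * z\<^sup>2)))"
      using v.\<kappa> a by (intro integrable_mult_right integrable_powr_weight_gauss) auto
    show "AE z in lborel. (\<lambda>n. w n z * reflected_gauss_deriv (b n) y z) \<longlonglongrightarrow> v z * reflected_gauss_deriv a y z"
      unfolding reflected_gauss_deriv_def by (intro AE_I2 tendsto_intros lim glim b(3))
    show "AE z in lborel. norm (w n z * reflected_gauss_deriv (b n) y z)
        \<le> C * (2 * gauss_const a * exp (a / 2 * y\<^sup>2)) * (powr_weight \<kappa> z * exp (- (a / 4) * z\<^sup>2))" for n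
    proof (rule AE_I2)
      fix z
      have "\<bar>w n z\<bar> * \<bar>reflected_gauss_deriv (b n) y z\<bar> \<le>
        (C * powr_weight \<kappa> z) * (2 * gauss_const a * exp (a / 2 * y\<^sup>2) * exp (- (a / 4) * z\<^sup>2))"
        using C powr_weight_nonneg[of \<kappa> z] by (intro mult_mono wb reflected_gauss_deriv_bound a b) auto
      then show "norm (w n z * reflected_gauss_deriv (b n) y z)
        \<le> C * (2 * gauss_const a * exp (a / 2 * y\<^sup>2)) * (powr_weight \<kappa> z * exp (- (a / 4) * z\<^sup>2))"
        by (simp add: abs_mult algebra_simps)
    qed
  qed auto
  have "(\<lambda>n. LINT z|lborel. w n z * gauss (b n) z) \<longlonglongrightarrow> (LINT z|lborel. v z * gauss a z)"
  proof (rule integral_dominated_convergence[where w = "\<lambda>z. C * gauss_const a * (powr_weight \<kappa> z * exp (- (a / 2) * z\<^sup>2))"])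
    show "integrable lborel (\<lambda>z. C * gauss_const a * (powr_weight \<kappa> z * exp (- (a / 2) * z\<^sup>2)))"
      using v.\<kappa> a by (intro integrable_mult_right integrable_powr_weight_gauss) auto
    show "AE z in lborel. (\<lambda>n. w n z * gauss (b n) z) \<longlonglongrightarrow> v z * gauss a z"
      by (intro AE_I2 tendsto_intros lim glim)
    show "AE z in lborel. norm (w n z * gauss (b n) z) \<le> C * gauss_const a * (powr_weight \<kappa> z * exp (- (a / 2) * z\<^sup>2))" for n
    proof (rule AE_I2)
      fix z
      have "\<bar>w n z\<bar> * \<bar>gauss (b n) z\<bar> \<le> (C * powr_weight \<kappa> z) * (gauss_const a * exp (- (a / 2) * z\<^sup>2))"
        using C powr_weight_nonneg[of \<kappa> z] by (intro mult_mono wb gauss_derivative_bounds(1) a b) auto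
      then show "norm (w n z * gauss (b n) z) \<le> C * gauss_const a * (powr_weight \<kappa> z * exp (- (a / 2) * z\<^sup>2))"
        by (simp add: abs_mult algebra_simps)
    qed
  qed auto
  then show "(\<lambda>n. symmetric_convolution (w n) (b n) 0) \<longlonglongrightarrow> symmetric_convolution v a 0"
    unfolding symmetric_convolution_def by (auto intro: tendsto_add)
qed

section \<open>The eigenfunction\<close>

text \<open>A Gronwall argument that justifies the definite description in
  \<open>eigenfunction\<close>: the energy \<open>u\<^sup>2 + u'\<^sup>2\<close> of the difference
  satisfies \<open>\<bar>E'\<bar> \<le> K * E\<close> between \<open>0\<close> and
  \<open>x0\<close>, so \<open>E\<close> times a decaying exponential to the right of
  \<open>0\<close>, or a growing one to the left, is monotone and compares \<open>E x0\<close> with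
  \<open>E 0 = 0\<close>.\<close>

lemma eigen_ode_solution_unique:
  assumes 1: "eigen_ode_solution a l \<phi>" and 2: "eigen_ode_solution a l \<psi>" and a: "0 < a"
  shows "\<phi> = \<psi>"
proof
  fix x0 :: real
  define u where "u x = \<phi> x - \<psi> x" for x
  define u' where "u' x = deriv \<phi> x - deriv \<psi> x" for x
  define u'' where "u'' x = - 2 * (a + l) * u x - 2 * a * x * u' x" for x
  have ode: "deriv (deriv g) x = - 2 * (a + l) * g x - 2 * a * x * deriv g x"
    "(g has_real_derivative deriv g x) (at x)"
    "(deriv g has_real_derivative deriv (deriv g) x) (at x)"
    if "eigen_ode_solution a l g" for g x
  proof -
    show d: "(g has_real_derivative deriv g x) (at x)"
      using that by (auto simp: eigen_ode_solution_def field_differentiable_derivI)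
    show "(deriv g has_real_derivative deriv (deriv g) x) (at x)"
      using that by (auto simp: eigen_ode_solution_def field_differentiable_derivI)
    have "deriv (\<lambda>y. a * y * g y) x = a * g x + a * x * deriv g x"
      by (rule DERIV_imp_deriv) (auto intro!: derivative_eq_intros d)
    moreover have "1 / 2 * deriv (deriv g) x + deriv (\<lambda>y. a * y * g y) x = - l * g x"
      using that unfolding eigen_ode_solution_def by blast
    ultimately show "deriv (deriv g) x = - 2 * (a + l) * g x - 2 * a * x * deriv g x"
      by (simp add: algebra_simps)
  qed
  have du: "(u has_real_derivative u' x) (at x)" for x
    unfolding u_def[abs_def] u'_def by (intro DERIV_diff ode 1 2)
  have du': "(u' has_real_derivative u'' x) (at x)" for x
  proof -
    have "(u' has_real_derivative (deriv (deriv \<phi>) x - deriv (deriv \<psi>) x)) (at x)"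
      unfolding u'_def[abs_def] by (intro DERIV_diff ode 1 2)
    then show ?thesis
      by (simp add: ode(1)[OF 1] ode(1)[OF 2] u''_def u_def u'_def algebra_simps)
  qed
  define E where "E x = (u x)\<^sup>2 + (u' x)\<^sup>2" for x
  define E' where "E' x = 2 * u x * u' x + 2 * u' x * u'' x" for x
  have dE: "(E has_real_derivative E' x) (at x)" for x
    unfolding E_def[abs_def] E'_def by (auto intro!: derivative_eq_intros du du')
  have E0: "E 0 = 0"
    using 1 2 by (simp add: E_def u_def u'_def eigen_ode_solution_def)
  \<comment> \<open>The coefficient \<open>2 * a * x\<close> is unbounded on the line, so
    \<open>K\<close> is chosen for the segment between \<open>0\<close> and \<open>x0\<close>
    only.\<close>
  define R where "R = \<bar>x0\<bar>"
  define K where "K = 1 + 2 * (a + \<bar>l\<bar>) + 4 * a * R"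
  have bd: "\<bar>E' x\<bar> \<le> K * E x" if x: "\<bar>x\<bar> \<le> R" for x
  proof -
    have am: "2 * \<bar>u x * u' x\<bar> \<le> E x"
      using zero_le_power2[of "\<bar>u x\<bar> - \<bar>u' x\<bar>"] by (simp add: E_def power2_diff abs_mult)
    have sq: "(u' x)\<^sup>2 \<le> E x" by (simp add: E_def)
    have "E' x = (1 - 2 * (a + l)) * (2 * (u x * u' x)) + (- 4 * a * x) * (u' x)\<^sup>2"
      by (simp add: E'_def u''_def algebra_simps power2_eq_square)
    also have "\<bar>\<dots>\<bar> \<le> \<bar>1 - 2 * (a + l)\<bar> * (2 * \<bar>u x * u' x\<bar>) + \<bar>- 4 * a * x\<bar> * (u' x)\<^sup>2"
      by (rule order_trans[OF abs_triangle_ineq]) (simp add: abs_mult)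
    also have "\<dots> \<le> (1 + 2 * (a + \<bar>l\<bar>)) * E x + (4 * a * R) * E x"
      using am sq a x by (intro add_mono mult_mono) (auto simp: abs_mult)
    finally show ?thesis by (simp add: K_def algebra_simps)
  qed
  have "E x0 \<le> 0"
  proof (cases "0 \<le> x0")
    case True
    have "exp (- K * x0) * E x0 \<le> exp (- K * 0) * E 0"
    proof (rule DERIV_nonpos_imp_nonincreasing[OF True])
      fix x assume x: "0 \<le> x" "x \<le> x0"
      have "((\<lambda>x. exp (- K * x) * E x) has_real_derivative exp (- K * x) * (E' x - K * E x)) (at x)"
        by (auto intro!: derivative_eq_intros dE simp: algebra_simps)
      moreover have "exp (- K * x) * (E' x - K * E x) \<le> 0"
        using bd[of x] x by (intro mult_nonneg_nonpos) (auto simp: R_def)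
      ultimately show "\<exists>y. ((\<lambda>x. exp (- K * x) * E x) has_real_derivative y) (at x) \<and> y \<le> 0" by blast
    qed
    then show ?thesis by (simp add: E0 mult_le_0_iff)
  next
    case False
    then have "x0 \<le> 0" by simp
    have "exp (K * x0) * E x0 \<le> exp (K * 0) * E 0"
    proof (rule DERIV_nonneg_imp_nondecreasing[OF \<open>x0 \<le> 0\<close>])
      fix x assume x: "x0 \<le> x" "x \<le> 0"
      have "((\<lambda>x. exp (K * x) * E x) has_real_derivative exp (K * x) * (E' x + K * E x)) (at x)"
        by (auto intro!: derivative_eq_intros dE simp: algebra_simps)
      moreover have "0 \<le> exp (K * x) * (E' x + K * E x)"
        using bd[of x] x by (intro mult_nonneg_nonneg) (auto simp: R_def)
      ultimately show "\<exists>y. ((\<lambda>x. exp (K * x) * E x) has_real_derivative y) (at x) \<and> 0 \<le> y" by blast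
    qed
    then show ?thesis by (simp add: E0 mult_le_0_iff)
  qed
  then have "u x0 = 0" unfolding E_def by (simp add: sum_power2_le_zero_iff)
  then show "\<phi> x0 = \<psi> x0" by (simp add: u_def)
qed

section \<open>The limiting weight and the differential equation of its convolutions\<close>

definition power_tail :: "real \<Rightarrow> real \<Rightarrow> real" where
  "power_tail \<eta> z = indicator {0<..} z * z powr (- \<eta>)"

lemma gaussian_weight_power_tail:
  assumes "0 \<le> \<eta>" "\<eta> \<le> \<kappa>" "\<kappa> < 1" "1 \<le> C"
  shows "gaussian_weight (power_tail \<eta>) C \<kappa>"
proof
  show "power_tail \<eta> \<in> borel_measurable borel"
    unfolding power_tail_def by measurable
  show "\<bar>power_tail \<eta> z\<bar> \<le> C * powr_weight \<kappa> z" for z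
  proof (cases "0 < z")
    case True
    have "z powr (- \<eta>) \<le> 1 + z powr (- \<kappa>)"
    proof (cases "z \<le> 1")
      case True
      with \<open>0 < z\<close> assms have "z powr (- \<eta>) \<le> z powr (- \<kappa>)" by (intro powr_mono') auto
      then show ?thesis by simp
    next
      case False
      then have "z powr (- \<eta>) \<le> z powr 0" using assms by (intro powr_mono) auto
      with False have "z powr (- \<eta>) \<le> 1" by simp
      with powr_ge_zero[of z "- \<kappa>"] show ?thesis by linarith
    qed
    also have "\<dots> \<le> C * (1 + z powr (- \<kappa>))"
      using assms mult_right_mono[of 1 C "1 + z powr (- \<kappa>)"] by simp
    finally show ?thesis using True by (simp add: power_tail_def powr_weight_def)
  qed (simp add: power_tail_def powr_weight_def)
qed (use assms in auto)

lemma power_tail_tendsto_0: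
  assumes "0 < \<eta>" shows "(power_tail \<eta> \<longlongrightarrow> 0) at_top"
proof (rule Lim_transform_eventually)
  show "((\<lambda>z. z powr (- \<eta>)) \<longlongrightarrow> 0) at_top"
    using assms by (intro tendsto_neg_powr filterlim_ident) auto
  show "\<forall>\<^sub>F z in at_top. z powr (- \<eta>) = power_tail \<eta> z"
    using eventually_gt_at_top[of 0] by eventually_elim (simp add: power_tail_def)
qed

text \<open>The integrand is the derivative of \<open>- 2 a z\<^sup>1\<^sup>-\<^sup>\<eta> gauss a (z - y)\<close>, which vanishes at both ends.\<close>

lemma power_tail_convolution_ode:
  assumes a: "0 < a" and \<eta>: "0 < \<eta>" "\<eta> < 1"
  shows "(LINT z|lborel. power_tail \<eta> z * ((4 * a\<^sup>2 * (z - y)\<^sup>2 - 2 * a) * gauss a (z - y)))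
    + 2 * a * y * (LINT z|lborel. power_tail \<eta> z * (2 * a * (z - y) * gauss a (z - y)))
    + 2 * a * \<eta> * (LINT z|lborel. power_tail \<eta> z * gauss a (z - y)) = 0"
proof -
  interpret gaussian_weight "power_tail \<eta>" 1 \<eta>
    using \<eta> by (intro gaussian_weight_power_tail) auto
  define F where "F z = - 2 * a * (z powr (1 - \<eta>) * gauss a (z - y))" for z
  define f where "f z = z powr (- \<eta>) * (4 * a\<^sup>2 * z * (z - y) - 2 * a * (1 - \<eta>)) * gauss a (z - y)" for z
  note i = gauss''_convolution_integrable[OF a, of y] integrable_minus[OF gauss'_convolution_integrable[OF a, of y], simplified]
    gauss_convolution_integrable[OF a, of y]
  note i2 = integrable_mult_right[OF i(2), of "2 * a * y"]
    and i3 = integrable_mult_right[OF i(3), of "2 * a * \<eta>"]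
  have eq: "power_tail \<eta> z * ((4 * a\<^sup>2 * (z - y)\<^sup>2 - 2 * a) * gauss a (z - y))
        + 2 * a * y * (power_tail \<eta> z * (2 * a * (z - y) * gauss a (z - y)))
        + 2 * a * \<eta> * (power_tail \<eta> z * gauss a (z - y)) = indicator {0<..} z *\<^sub>R f z" for z
    unfolding power_tail_def f_def by (simp add: algebra_simps power2_eq_square)
  have int: "integrable lborel (\<lambda>z. indicator {0<..} z *\<^sub>R f z)"
    unfolding eq[symmetric]
    by (intro Bochner_Integration.integrable_add integrable_mult_right i)
  have "(LINT z|lborel. power_tail \<eta> z * ((4 * a\<^sup>2 * (z - y)\<^sup>2 - 2 * a) * gauss a (z - y)))
    + 2 * a * y * (LINT z|lborel. power_tail \<eta> z * (2 * a * (z - y) * gauss a (z - y)))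
    + 2 * a * \<eta> * (LINT z|lborel. power_tail \<eta> z * gauss a (z - y)) = (LINT z|lborel. indicator {0<..} z *\<^sub>R f z)"
    unfolding eq[symmetric]
    by (simp only: Bochner_Integration.integral_add[OF Bochner_Integration.integrable_add[OF i(1) i2] i3]
        Bochner_Integration.integral_add[OF i(1) i2] integral_mult_right_zero)
  also have "\<dots> = (LBINT z=0..\<infinity>. f z)"
    by (simp add: interval_lebesgue_integral_def set_lebesgue_integral_def zero_ereal_def)
  also have "\<dots> = 0 - 0"
  proof (rule interval_integral_FTC_integrable)
    show "set_integrable lborel (einterval 0 \<infinity>) f"
      using int by (simp add: set_integrable_def zero_ereal_def)
    fix z :: real assume "0 < ereal z"
    then have z: "0 < z" by simp
    have zp: "z powr (1 - \<eta>) = z * z powr (- \<eta>)"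
      using z powr_add[of z 1 "- \<eta>"] by simp
    have "((\<lambda>z. gauss a (z - y)) has_real_derivative - (2 * a * (z - y) * gauss a (z - y)) * (1 - 0)) (at z)"
      by (rule DERIV_chain2[OF gauss_has_real_derivative]) (auto intro!: derivative_eq_intros)
    then have "(F has_real_derivative - 2 * a * ((1 - \<eta>) * z powr (1 - \<eta> - 1) * gauss a (z - y)
        + - (2 * a * (z - y) * gauss a (z - y)) * z powr (1 - \<eta>))) (at z)"
      unfolding F_def[abs_def] using z
      by (intro DERIV_cmult DERIV_mult has_real_derivative_powr) auto
    also have "- 2 * a * ((1 - \<eta>) * z powr (1 - \<eta> - 1) * gauss a (z - y)
        + - (2 * a * (z - y) * gauss a (z - y)) * z powr (1 - \<eta>)) = f z"
      by (simp add: f_def zp algebra_simps power2_eq_square)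
    finally show "(F has_vector_derivative f z) (at z)"
      by (simp add: has_real_derivative_iff_has_vector_derivative)
    show "isCont f z"
      unfolding f_def[abs_def] gauss_def using z by (intro continuous_intros) auto
  next
    \<comment> \<open>The boundary term at \<open>0\<close> vanishes because
      \<open>\<eta> < 1\<close>.\<close>
    have "((\<lambda>z. z powr (1 - \<eta>)) \<longlongrightarrow> 0) (at_right 0)"
      using \<eta> by (intro tendsto_zero_powrI[where b = "1 - \<eta>"] tendsto_intros) (auto intro!: eventually_mono[OF eventually_at_right_less])
    moreover have "((\<lambda>z. gauss a (z - y)) \<longlongrightarrow> gauss a (0 - y)) (at_right 0)"
      unfolding gauss_def by (intro tendsto_intros)
    ultimately have "(F \<longlongrightarrow> - 2 * a * (0 * gauss a (0 - y))) (at_right 0)"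
      unfolding F_def[abs_def] by (intro tendsto_intros)
    then show "((F \<circ> real_of_ereal) \<longlongrightarrow> 0) (at_right 0)"
      by (simp add: zero_ereal_def ereal_tendsto_simps)
    have lim: "filterlim (\<lambda>z. \<bar>z - y\<bar>) at_top at_top"
      by (rule filterlim_at_top_mono[OF filterlim_tendsto_add_at_top[OF tendsto_const[of "- y"] filterlim_ident]])
         (auto intro!: always_eventually)
    have a2: "0 < a / 2" "a \<le> 2 * a" using a by auto
    have "((\<lambda>z. - (2 * a * (z - y) * gauss a (z - y))) \<longlongrightarrow> 0) at_top"
      by (rule gaussian_decay_tendsto_0[OF gauss_derivative_bounds(2)[OF a order_refl a2(2)] a2(1) lim])
    moreover have "((\<lambda>z. gauss a (z - y)) \<longlongrightarrow> 0) at_top"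
      by (rule gaussian_decay_tendsto_0[OF gauss_derivative_bounds(1)[OF a order_refl a2(2)] a2(1) lim])
    \<comment> \<open>Writing \<open>z = (z - y) + y\<close> reduces the decay of
      \<open>z * gauss a (z - y)\<close> to that of \<open>gauss\<close> and of its
      derivative.\<close>
    ultimately have "((\<lambda>z. - (- (2 * a * (z - y) * gauss a (z - y))) + 2 * a * y * gauss a (z - y)) \<longlongrightarrow> - 0 + 2 * a * y * 0) at_top"
      by (intro tendsto_intros)
    then have dom: "((\<lambda>z. 2 * a * (z * gauss a (z - y))) \<longlongrightarrow> 0) at_top"
      by (simp add: algebra_simps)
    have "(F \<longlongrightarrow> 0) at_top"
    proof (rule Lim_null_comparison[OF _ dom])
      show "\<forall>\<^sub>F z in at_top. norm (F z) \<le> 2 * a * (z * gauss a (z - y))"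
        using eventually_ge_at_top[of 1]
      proof eventually_elim
        case (elim z)
        have "z powr (1 - \<eta>) \<le> z powr 1" using elim \<eta> by (intro powr_mono) auto
        then have "z powr (1 - \<eta>) * gauss a (z - y) \<le> z * gauss a (z - y)"
          using elim a by (intro mult_right_mono gauss_nonneg) auto
        then show ?case using a gauss_nonneg[OF a, of "z - y"] by (simp add: F_def abs_mult)
      qed
    qed
    then show "((F \<circ> real_of_ereal) \<longlongrightarrow> 0) (at_left \<infinity>)"
      by (simp add: ereal_tendsto_simps)
  qed auto
  finally show ?thesis by simp
qed

text \<open>Write \<open>q\<close> and \<open>U\<close> for the two convolutions. The equation for
  \<open>U\<close> together with \<open>U' = - q\<close> says
  \<open>q' / 2 + a * y * q = a * \<eta> * U\<close>, and one more differentiation yields the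
  eigenvalue equation with eigenvalue \<open>a * \<eta>\<close>. By oddness \<open>q\<close>
  vanishes at \<open>0\<close>, so its slope there is \<open>2 * a * \<eta> * U 0\<close>, which is
  the normalising constant.\<close>

lemma eigenfunction_eq:
  assumes a: "0 < a" and \<eta>: "0 < \<eta>" "\<eta> < 1"
  shows "eigenfunction a (a * \<eta>) =
    (\<lambda>y. reflected_convolution (power_tail \<eta>) a y / (2 * a * \<eta> * symmetric_convolution (power_tail \<eta>) a 0))"
    and "0 < symmetric_convolution (power_tail \<eta>) a 0"
proof -
  interpret gaussian_weight "power_tail \<eta>" 1 \<eta>
    using \<eta> by (intro gaussian_weight_power_tail) auto
  let ?q = "reflected_convolution (power_tail \<eta>) a"
  let ?U = "symmetric_convolution (power_tail \<eta>) a"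
  \<comment> \<open>Both convolutions are built from the points \<open>y\<close> and
    \<open>- y\<close>; the identity is used at each and the two are added.\<close>
  have combine: "- (A1 + A2) = 2 * a * \<eta> * (C1 + C2) - 2 * a * y * (B2 - B1)"
    if "A1 + 2 * a * y * B1 + 2 * a * \<eta> * C1 = 0" "A2 + 2 * a * (- y) * B2 + 2 * a * \<eta> * C2 = 0"
    for A1 A2 B1 B2 C1 C2 y
    using that by (simp add: algebra_simps)
  have q': "(?q has_real_derivative 2 * a * \<eta> * ?U y - 2 * a * y * ?q y) (at y)" for y
  proof -
    have "- ((LINT z|lborel. power_tail \<eta> z * ((4 * a\<^sup>2 * (z - y)\<^sup>2 - 2 * a) * gauss a (z - y)))
     + (LINT z|lborel. power_tail \<eta> z * ((4 * a\<^sup>2 * (z + y)\<^sup>2 - 2 * a) * gauss a (z + y))))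
     = 2 * a * \<eta> * ?U y - 2 * a * y * ?q y"
      unfolding symmetric_convolution_def reflected_convolution_eq[OF a]
      by (rule combine[OF power_tail_convolution_ode[OF a \<eta>, of y]
          power_tail_convolution_ode[OF a \<eta>, of "- y", unfolded diff_minus_eq_add]])
    with reflected_convolution_deriv[OF a, of y] show ?thesis by simp
  qed
  have U: "0 < ?U 0"
  proof -
    have int: "integrable lborel (\<lambda>z. power_tail \<eta> z * gauss a z)"
      using gauss_convolution_integrable[OF a, of 0] by simp
    have nn: "0 \<le> power_tail \<eta> z * gauss a z" for z
      using a by (simp add: power_tail_def gauss_nonneg)
    have "(LINT z|lborel. power_tail \<eta> z * gauss a z) \<noteq> 0"
    proof
      assume "(LINT z|lborel. power_tail \<eta> z * gauss a z) = 0"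
      then have "AE z in lborel. power_tail \<eta> z * gauss a z = 0"
        using integral_nonneg_eq_0_iff_AE[OF int] nn by auto
      then have "AE z in lborel. z \<notin> {0<..<1::real}"
        by eventually_elim (use a in \<open>auto simp: power_tail_def gauss_def\<close>)
      then have "{0<..<1::real} \<in> null_sets lborel"
        by (subst AE_iff_null_sets) auto
      then have "emeasure lborel {0<..<1::real} = 0" by (simp only: null_setsD1)
      then show False by simp
    qed
    then have "0 < (LINT z|lborel. power_tail \<eta> z * gauss a z)"
      using nn by (simp add: less_le integral_nonneg_AE)
    then show ?thesis by (simp add: symmetric_convolution_def)
  qed
  then show "0 < ?U 0" .
  define c where "c = 2 * a * \<eta> * ?U 0"
  have c: "0 < c" using a \<eta> U by (simp add: c_def)
  let ?\<phi> = "\<lambda>y. ?q y / c"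
  have d1: "(?\<phi> has_real_derivative (2 * a * \<eta> * ?U y - 2 * a * y * ?q y) / c) (at y)" for y
    by (intro DERIV_cdivide q')
  have dphi: "deriv ?\<phi> = (\<lambda>y. (2 * a * \<eta> * ?U y - 2 * a * y * ?q y) / c)"
    by (intro ext DERIV_imp_deriv d1)
  have d2: "(deriv ?\<phi> has_real_derivative (- 2 * a * \<eta> * ?q y - 2 * a * ?q y - 2 * a * y * (2 * a * \<eta> * ?U y - 2 * a * y * ?q y)) / c) (at y)" for y
    unfolding dphi
    by (rule DERIV_cong[OF DERIV_cdivide[OF DERIV_diff[OF DERIV_cmult[OF symmetric_convolution_deriv[OF a]]
        DERIV_mult[OF DERIV_cmult_Id q']]]]) (simp add: algebra_simps)
  have d3: "((\<lambda>y. a * y * ?\<phi> y) has_real_derivative (a * ?\<phi> y + a * y * ((2 * a * \<eta> * ?U y - 2 * a * y * ?q y) / c))) (at y)" for y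
    by (rule DERIV_cong[OF DERIV_mult[OF DERIV_cmult_Id d1]]) simp
  have sol: "eigen_ode_solution a (a * \<eta>) ?\<phi>"
    unfolding eigen_ode_solution_def
  proof (intro conjI allI)
    fix y
    show "?\<phi> field_differentiable at y" using d1 by (auto simp: field_differentiable_def)
    show "deriv ?\<phi> field_differentiable at y" using d2 unfolding field_differentiable_def by blast
    show "1 / 2 * deriv (deriv ?\<phi>) y + deriv (\<lambda>y. a * y * ?\<phi> y) y = - (a * \<eta>) * ?\<phi> y"
      unfolding DERIV_imp_deriv[OF d2] DERIV_imp_deriv[OF d3]
      using c by (simp add: field_simps)
    have q0: "?q 0 = 0" by (simp add: reflected_convolution_def reflected_gauss_deriv_def gauss_def)
    then show "?\<phi> 0 = 0" by simp
    show "deriv ?\<phi> 0 = 1" unfolding dphi using q0 a \<eta> U by (simp add: c_def)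
  qed
  have "eigenfunction a (a * \<eta>) = ?\<phi>"
    unfolding eigenfunction_def
    by (rule the_equality[of "eigen_ode_solution a (a * \<eta>)", OF sol]) (rule eigen_ode_solution_unique[OF _ sol a])
  then show "eigenfunction a (a * \<eta>) = (\<lambda>y. ?q y / (2 * a * \<eta> * ?U 0))"
    by (simp add: c_def)
qed

section \<open>Reflection for the Ornstein-Uhlenbeck process\<close>

context prob_space begin

lemma normal_trig_expectation:
  assumes X: "distributed M lborel X (normal_density 0 \<sigma>)" and \<sigma>: "0 < \<sigma>"
  shows "expectation (\<lambda>\<omega>. cos (\<theta> * X \<omega>)) = exp (- (\<theta>\<^sup>2 * \<sigma>\<^sup>2 / 2))"
    and "expectation (\<lambda>\<omega>. sin (\<theta> * X \<omega>)) = 0"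
proof -
  have [measurable]: "X \<in> borel_measurable M"
    using distributed_measurable[OF X] by simp
  let ?Z = "\<lambda>\<omega>. (X \<omega> - 0) / \<sigma>"
  have Z: "distributed M lborel ?Z std_normal_density"
    using X normal_standard_normal_convert[OF \<sigma>] by simp
  have d: "distr M borel ?Z = std_normal_distribution"
    using distributed_distr_eq_density[OF Z] by (simp cong: distr_cong)
  have "expectation (\<lambda>\<omega>. iexp (\<theta> * X \<omega>)) = (CLINT x|distr M borel ?Z. iexp (\<theta> * \<sigma> * x))"
    using \<sigma> by (subst integral_distr) auto
  also have "\<dots> = of_real (exp (- ((\<theta> * \<sigma>)\<^sup>2) / 2))"
    unfolding d using fun_cong[OF char_std_normal_distribution, of "\<theta> * \<sigma>"] by (simp add: char_def)
  finally have e: "expectation (\<lambda>\<omega>. iexp (\<theta> * X \<omega>)) = of_real (exp (- ((\<theta> * \<sigma>)\<^sup>2) / 2))" .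
  have int: "integrable M (\<lambda>\<omega>. iexp (\<theta> * X \<omega>))"
    by (rule integrable_const_bound[where B = 1]) auto
  have "Re (expectation (\<lambda>\<omega>. iexp (\<theta> * X \<omega>))) = expectation (\<lambda>\<omega>. cos (\<theta> * X \<omega>))"
    using int by (subst integral_Re[symmetric]) (auto simp: Re_exp)
  then show "expectation (\<lambda>\<omega>. cos (\<theta> * X \<omega>)) = exp (- (\<theta>\<^sup>2 * \<sigma>\<^sup>2 / 2))"
    unfolding e by (simp add: power_mult_distrib)
  have "Im (expectation (\<lambda>\<omega>. iexp (\<theta> * X \<omega>))) = expectation (\<lambda>\<omega>. sin (\<theta> * X \<omega>))"
    using int by (subst integral_Im[symmetric]) (auto simp: Im_exp)
  then show "expectation (\<lambda>\<omega>. sin (\<theta> * X \<omega>)) = 0"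
    unfolding e by simp
qed

text \<open>By the addition theorem, averaging \<open>sin (\<theta> * (S + \<xi>))\<close> over an
  independent centred Gaussian step leaves \<open>sin (\<theta> * S)\<close> times
  \<open>exp (- (\<theta>\<^sup>2 * \<sigma>\<^sup>2 / 2))\<close>, so
  \<open>exp (Q k) * sin (\<theta> * S k)\<close> is a martingale. Stopping it at the first entry
  into \<open>{..\<epsilon>}\<close>, or at \<open>n\<close>, preserves the expectation. The
  stopping index appears only through the conditions on \<open>k\<close>, so no random index has to
  be measurable.\<close>

lemma stopped_sine_martingale:
  fixes \<xi> :: "nat \<Rightarrow> 'a \<Rightarrow> real" and \<sigma> :: "nat \<Rightarrow> real" and \<theta> \<epsilon> :: real
  assumes ind: "indep_vars (\<lambda>_. borel) \<xi> {..n}"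
    and norm: "\<And>j. j < n \<Longrightarrow> distributed M lborel (\<xi> (Suc j)) (normal_density 0 (\<sigma> j))"
    and \<sigma>: "\<And>j. j < n \<Longrightarrow> 0 < \<sigma> j"
  defines "S \<equiv> \<lambda>k \<omega>. \<Sum>i\<le>k. \<xi> i \<omega>" and "Q \<equiv> \<lambda>k. \<Sum>j<k. \<theta>\<^sup>2 * (\<sigma> j)\<^sup>2 / 2"
  obtains Z where "random_variable borel Z"
    and "expectation Z = exp (- Q n) * expectation (\<lambda>\<omega>. sin (\<theta> * \<xi> 0 \<omega>))"
    and "\<And>\<omega> k. k \<le> n \<Longrightarrow> (\<And>j. j < k \<Longrightarrow> \<epsilon> < S j \<omega>) \<Longrightarrow> k = n \<or> S k \<omega> \<le> \<epsilon> \<Longrightarrow>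
        Z \<omega> = exp (Q k - Q n) * sin (\<theta> * S k \<omega>)"
proof -
  have meas: "\<xi> i \<in> borel_measurable M" if "i \<le> n" for i
    using ind that by (auto simp: indep_vars_def)
  have S_meas: "S k \<in> borel_measurable M" if "k \<le> n" for k
    unfolding S_def using that meas by (intro borel_measurable_sum) auto
  \<comment> \<open>The event that the walk has not stopped up to and including index
    \<open>k\<close>. It depends on the first variables only and is therefore independent of the
    next step.\<close>
  define G where "G k \<omega> = (\<Prod>j\<le>k. indicator {\<epsilon><..} (S j \<omega>) :: real)" for k \<omega>
  have G_meas: "G k \<in> borel_measurable M" if "k \<le> n" for k
    unfolding G_def[abs_def] using that
    by (intro borel_measurable_prod measurable_compose[OF S_meas borel_measurable_indicator]) auto
  have G_bound: "0 \<le> G k \<omega>" "G k \<omega> \<le> 1" for k \<omega>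
    unfolding G_def by (auto intro!: prod_nonneg prod_le_1 simp: indicator_def)
  have G_trig: "norm (G k \<omega> * sin x) \<le> 1" "norm (G k \<omega> * cos x) \<le> 1" for k \<omega> x
    using mult_mono[OF G_bound(2)[of k \<omega>] abs_sin_le_one[of x]] mult_mono[OF G_bound(2)[of k \<omega>] abs_cos_le_one[of x]]
      G_bound(1)[of k \<omega>] by (simp_all add: abs_mult)
  define H where "H k \<omega> = exp (Q k) * sin (\<theta> * S k \<omega>)" for k \<omega>
  have int: "integrable M (\<lambda>\<omega>. G i \<omega> * sin (\<theta> * S k \<omega>))" "integrable M (\<lambda>\<omega>. sin (\<theta> * S k \<omega>))" if "i \<le> n" "k \<le> n" for i k
  proof -
    note [measurable] = G_meas[OF that(1)] S_meas[OF that(2)]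
    show "integrable M (\<lambda>\<omega>. G i \<omega> * sin (\<theta> * S k \<omega>))" "integrable M (\<lambda>\<omega>. sin (\<theta> * S k \<omega>))"
      by (rule integrable_const_bound[where B = 1]; use G_trig in simp)+
  qed
  have step: "expectation (\<lambda>\<omega>. G k \<omega> * sin (\<theta> * S (Suc k) \<omega>)) =
      exp (- (\<theta>\<^sup>2 * (\<sigma> k)\<^sup>2 / 2)) * expectation (\<lambda>\<omega>. G k \<omega> * sin (\<theta> * S k \<omega>))" if k: "k < n" for k
  proof -
    let ?P = "PiM {..k} (\<lambda>_. borel :: real measure)" and ?P' = "PiM {Suc k} (\<lambda>_. borel :: real measure)"
    let ?g = "\<lambda>v. \<Prod>j\<le>k. indicator {\<epsilon><..} (\<Sum>i\<le>j. v i) :: real"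
    let ?s = "\<lambda>v. \<Sum>i\<le>k. v i :: real"
    have sm: "(\<lambda>v. \<Sum>i\<le>j. v i) \<in> borel_measurable ?P" if "j \<le> k" for j
      using that by (intro borel_measurable_sum measurable_component_singleton) auto
    have [measurable]: "?g \<in> borel_measurable ?P" "?s \<in> borel_measurable ?P"
      by (intro borel_measurable_prod measurable_compose[OF sm borel_measurable_indicator]; simp)
         (rule sm, simp)
    have indep: "indep_var ?P (\<lambda>\<omega>. restrict (\<lambda>i. \<xi> i \<omega>) {..k}) ?P' (\<lambda>\<omega>. restrict (\<lambda>i. \<xi> i \<omega>) {Suc k})"
      using k by (intro indep_var_restrict[OF ind]) auto
    have g_eq: "?g (restrict (\<lambda>i. \<xi> i \<omega>) {..k}) = G k \<omega>" for \<omega>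
      unfolding G_def S_def by (intro prod.cong refl arg_cong[where f = "indicator _"] sum.cong) auto
    have s_eq: "?s (restrict (\<lambda>i. \<xi> i \<omega>) {..k}) = S k \<omega>" for \<omega>
      unfolding S_def by (intro sum.cong) auto
    have indep2: "indep_var borel (\<lambda>\<omega>. G k \<omega> * u (\<theta> * S k \<omega>)) borel (\<lambda>\<omega>. u' (\<theta> * \<xi> (Suc k) \<omega>))"
      if [measurable]: "u \<in> borel_measurable borel" "u' \<in> borel_measurable borel" for u u' :: "real \<Rightarrow> real"
    proof -
      have "indep_var borel ((\<lambda>v. ?g v * u (\<theta> * ?s v)) \<circ> (\<lambda>\<omega>. restrict (\<lambda>i. \<xi> i \<omega>) {..k}))
          borel ((\<lambda>v. u' (\<theta> * v (Suc k))) \<circ> (\<lambda>\<omega>. restrict (\<lambda>i. \<xi> i \<omega>) {Suc k}))"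
        by (intro indep_var_compose[OF indep]) auto
      then show ?thesis by (simp only: comp_def g_eq s_eq restrict_apply singleton_iff if_True refl)
    qed
    have S_le: "k \<le> n" "Suc k \<le> n" using k by auto
    note [measurable] = G_meas[OF S_le(1)] S_meas[OF S_le(1)] meas[OF S_le(2)]
    have int1: "integrable M (\<lambda>\<omega>. G k \<omega> * sin (\<theta> * S k \<omega>))" "integrable M (\<lambda>\<omega>. G k \<omega> * cos (\<theta> * S k \<omega>))"
      "integrable M (\<lambda>\<omega>. sin (\<theta> * \<xi> (Suc k) \<omega>))" "integrable M (\<lambda>\<omega>. cos (\<theta> * \<xi> (Suc k) \<omega>))"
      by (rule integrable_const_bound[where B = 1]; use G_trig in simp)+
    have "G k \<omega> * sin (\<theta> * S (Suc k) \<omega>) =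
        (G k \<omega> * sin (\<theta> * S k \<omega>)) * cos (\<theta> * \<xi> (Suc k) \<omega>) + (G k \<omega> * cos (\<theta> * S k \<omega>)) * sin (\<theta> * \<xi> (Suc k) \<omega>)" for \<omega>
      by (simp add: S_def distrib_left sin_add)
    then have "expectation (\<lambda>\<omega>. G k \<omega> * sin (\<theta> * S (Suc k) \<omega>)) =
        expectation (\<lambda>\<omega>. (G k \<omega> * sin (\<theta> * S k \<omega>)) * cos (\<theta> * \<xi> (Suc k) \<omega>)) +
        expectation (\<lambda>\<omega>. (G k \<omega> * cos (\<theta> * S k \<omega>)) * sin (\<theta> * \<xi> (Suc k) \<omega>))"
      using indep_var_integrable[OF indep2 int1(1) int1(4)] indep_var_integrable[OF indep2 int1(2) int1(3)]
      by simp
    also have "expectation (\<lambda>\<omega>. (G k \<omega> * sin (\<theta> * S k \<omega>)) * cos (\<theta> * \<xi> (Suc k) \<omega>)) =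
        expectation (\<lambda>\<omega>. G k \<omega> * sin (\<theta> * S k \<omega>)) * expectation (\<lambda>\<omega>. cos (\<theta> * \<xi> (Suc k) \<omega>))"
      by (rule indep_var_lebesgue_integral[OF indep2 int1(1) int1(4)]) auto
    also have "expectation (\<lambda>\<omega>. (G k \<omega> * cos (\<theta> * S k \<omega>)) * sin (\<theta> * \<xi> (Suc k) \<omega>)) =
        expectation (\<lambda>\<omega>. G k \<omega> * cos (\<theta> * S k \<omega>)) * expectation (\<lambda>\<omega>. sin (\<theta> * \<xi> (Suc k) \<omega>))"
      by (rule indep_var_lebesgue_integral[OF indep2 int1(2) int1(3)]) auto
    finally show ?thesis
      using normal_trig_expectation[OF norm[OF k] \<sigma>[OF k]] by simp
  qed
  \<comment> \<open>The martingale transform by \<open>G\<close>: increments before the stopping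
    index telescope, later ones carry a factor \<open>0\<close>.\<close>
  define D where "D \<omega> = H 0 \<omega> + (\<Sum>i<n. G i \<omega> * (H (Suc i) \<omega> - H i \<omega>))" for \<omega>
  have stop: "D \<omega> = H k \<omega>" if k: "k \<le> n" "\<And>j. j < k \<Longrightarrow> \<epsilon> < S j \<omega>" "k = n \<or> S k \<omega> \<le> \<epsilon>" for \<omega> k
  proof -
    have "(\<Sum>i<n. G i \<omega> * (H (Suc i) \<omega> - H i \<omega>)) = (\<Sum>i<k. G i \<omega> * (H (Suc i) \<omega> - H i \<omega>))"
    proof (rule sum.mono_neutral_right)
      show "\<forall>i\<in>{..<n} - {..<k}. G i \<omega> * (H (Suc i) \<omega> - H i \<omega>) = 0"
      proof
        fix i assume i: "i \<in> {..<n} - {..<k}"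
        then have "S k \<omega> \<le> \<epsilon>" "k \<le> i" using k by auto
        then have "G i \<omega> = 0" unfolding G_def by (intro prod_zero) (auto intro!: bexI[of _ k])
        then show "G i \<omega> * (H (Suc i) \<omega> - H i \<omega>) = 0" by simp
      qed
    qed (use k in auto)
    also have "\<dots> = (\<Sum>i<k. H (Suc i) \<omega> - H i \<omega>)"
    proof (rule sum.cong)
      fix i assume "i \<in> {..<k}"
      then have "G i \<omega> = 1" unfolding G_def using k(2) by (intro prod.neutral) auto
      then show "G i \<omega> * (H (Suc i) \<omega> - H i \<omega>) = H (Suc i) \<omega> - H i \<omega>" by simp
    qed simp
    also have "\<dots> = H k \<omega> - H 0 \<omega>" by (rule sum_lessThan_telescope)
    finally show ?thesis by (simp add: D_def)
  qed
  have D_int: "integrable M (\<lambda>\<omega>. G i \<omega> * (H (Suc i) \<omega> - H i \<omega>))"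
    "expectation (\<lambda>\<omega>. G i \<omega> * (H (Suc i) \<omega> - H i \<omega>)) = 0" if i: "i < n" for i
  proof -
    have le: "i \<le> n" "Suc i \<le> n" using i by auto
    have eq: "G i \<omega> * (H (Suc i) \<omega> - H i \<omega>) =
      exp (Q (Suc i)) * (G i \<omega> * sin (\<theta> * S (Suc i) \<omega>)) - exp (Q i) * (G i \<omega> * sin (\<theta> * S i \<omega>))" for \<omega>
      by (simp add: H_def algebra_simps)
    show "integrable M (\<lambda>\<omega>. G i \<omega> * (H (Suc i) \<omega> - H i \<omega>))"
      unfolding eq using int le by (intro Bochner_Integration.integrable_diff integrable_mult_right) auto
    have "expectation (\<lambda>\<omega>. G i \<omega> * (H (Suc i) \<omega> - H i \<omega>)) =
      exp (Q (Suc i)) * expectation (\<lambda>\<omega>. G i \<omega> * sin (\<theta> * S (Suc i) \<omega>)) - exp (Q i) * expectation (\<lambda>\<omega>. G i \<omega> * sin (\<theta> * S i \<omega>))"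
      unfolding eq using int le by simp
    also have "\<dots> = 0"
      unfolding step[OF i] by (simp add: Q_def exp_add exp_minus)
    finally show "expectation (\<lambda>\<omega>. G i \<omega> * (H (Suc i) \<omega> - H i \<omega>)) = 0" .
  qed
  have H0: "H 0 = (\<lambda>\<omega>. sin (\<theta> * \<xi> 0 \<omega>))" by (simp add: H_def Q_def S_def fun_eq_iff)
  have H0_int: "integrable M (H 0)" using int(2)[of 0 0] by (simp add: H0 S_def)
  have D_expectation: "expectation D = expectation (\<lambda>\<omega>. sin (\<theta> * \<xi> 0 \<omega>))"
  proof -
    have "expectation D = expectation (H 0) + (\<Sum>i<n. expectation (\<lambda>\<omega>. G i \<omega> * (H (Suc i) \<omega> - H i \<omega>)))"
      unfolding D_def[abs_def] using H0_int D_int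
      by (subst Bochner_Integration.integral_add) (auto intro!: Bochner_Integration.integrable_sum Bochner_Integration.integral_sum)
    also have "(\<Sum>i<n. expectation (\<lambda>\<omega>. G i \<omega> * (H (Suc i) \<omega> - H i \<omega>))) = 0"
      using D_int by simp
    finally show ?thesis by (simp add: H0)
  qed
  have D_integrable: "integrable M D"
    unfolding D_def[abs_def] using H0_int D_int by (intro Bochner_Integration.integrable_add Bochner_Integration.integrable_sum) auto
  show thesis
  \<comment> \<open>Dividing by \<open>exp (Q n)\<close> leaves factors
    \<open>exp (Q k - Q n)\<close>, which are at most \<open>1\<close>; hence \<open>Z\<close> is
    bounded by \<open>1\<close> whatever the grid, as dominated convergence will require.\<close>
  proof (rule that[of "\<lambda>\<omega>. exp (- Q n) * D \<omega>"])
    show "random_variable borel (\<lambda>\<omega>. exp (- Q n) * D \<omega>)" using D_integrable by auto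
    show "expectation (\<lambda>\<omega>. exp (- Q n) * D \<omega>) = exp (- Q n) * expectation (\<lambda>\<omega>. sin (\<theta> * \<xi> 0 \<omega>))"
      using D_expectation by simp
    show "exp (- Q n) * D \<omega> = exp (Q k - Q n) * sin (\<theta> * S k \<omega>)"
      if "k \<le> n" "\<And>j. j < k \<Longrightarrow> \<epsilon> < S j \<omega>" "k = n \<or> S k \<omega> \<le> \<epsilon>" for \<omega> k
      using stop[OF that] by (simp add: H_def exp_diff exp_minus divide_inverse)
  qed
qed

end

text \<open>A left-point sum for \<open>b 0\<close> plus the integral of \<open>exp (a * s)\<close>
  against \<open>b\<close>, which is formally \<open>exp (a * t) * x t\<close> for a solution
  \<open>x\<close> of the equation driven by \<open>b\<close>. The weights are deterministic, so for
  a Brownian path the summands are independent Gaussian variables.\<close>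

definition euler_sum :: "real \<Rightarrow> (real \<Rightarrow> real) \<Rightarrow> real \<Rightarrow> nat \<Rightarrow> nat \<Rightarrow> real" where
  "euler_sum a b T n k = b 0 + (\<Sum>j<k. exp (a * (T * real j / real n)) * (b (T * real (Suc j) / real n) - b (T * real j / real n)))"

text \<open>The estimate is deterministic and uses only uniform continuity of \<open>b\<close>.
  Integration by parts gives \<open>exp (a * s) * x s = exp (a * s) * b s - a * L s\<close> with
  \<open>L' s = exp (a * s) * b s\<close>, so \<open>b\<close> is never differentiated; one step
  then errs by at most an increment of \<open>e' * exp (a * s)\<close>, and these increments
  telescope. The bound on single increments will limit the overshoot below the stopping
  level.\<close>

lemma euler_sum_approx:
  fixes b x :: "real \<Rightarrow> real"
  assumes a: "0 < a" and T: "0 < T" and e: "0 < e"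
    and b: "continuous_on {0..} b" and x: "continuous_on {0..} x"
    and eq: "\<And>t. 0 \<le> t \<Longrightarrow> x t - x 0 = (b t - b 0) - a * integral {0..t} x" and x0: "x 0 = b 0"
  shows "eventually (\<lambda>n. \<forall>k\<le>n. \<bar>euler_sum a b T n k - exp (a * (T * real k / real n)) * x (T * real k / real n)\<bar> \<le> e
      \<and> (k < n \<longrightarrow> \<bar>euler_sum a b T n (Suc k) - euler_sum a b T n k\<bar> \<le> e)) sequentially"
proof -
  \<comment> \<open>The factor compensates the largest weight \<open>exp (a * T)\<close>.\<close>
  define e' where "e' = e * exp (- a * T)"
  have e': "0 < e'" using e by (simp add: e'_def)
  have bT: "continuous_on {0..T} b" and xT: "continuous_on {0..T} x"
    using b x by (auto intro: continuous_on_subset)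
  have "uniformly_continuous_on {0..T} b"
    by (intro compact_uniformly_continuous bT) auto
  then obtain d where d: "0 < d" "\<And>s t. s \<in> {0..T} \<Longrightarrow> t \<in> {0..T} \<Longrightarrow> dist s t < d \<Longrightarrow> dist (b s) (b t) < e'"
    unfolding uniformly_continuous_on_def using e' by metis
  obtain N where N: "T / d < real N" using reals_Archimedean2 by blast
  define L where "L s = exp (a * s) * integral {0..s} x" for s
  have dI: "((\<lambda>s. integral {0..s} x) has_real_derivative x s) (at s)" if "0 < s" "s < T" for s
    using integral_has_real_derivative[OF xT, of s] that at_within_interior[of s "{0..T}"] by (simp add: interior_atLeastAtMost_real)
  have xb: "x s = b s - a * integral {0..s} x" if "0 \<le> s" for s
    using eq[OF that] x0 by simp
  have dL: "(L has_real_derivative exp (a * s) * b s) (at s)" if "0 < s" "s < T" for s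
    unfolding L_def[abs_def]
    proof -
    have "b s = x s + a * integral {0..s} x" using xb[of s] that by simp
    moreover have "((\<lambda>s. exp (a * s) * integral {0..s} x) has_real_derivative
        exp (a * s) * a * integral {0..s} x + x s * exp (a * s)) (at s)"
      by (intro DERIV_mult dI that) (auto intro!: derivative_eq_intros)
    moreover have "exp (a * s) * a * integral {0..s} x + x s * exp (a * s) = exp (a * s) * (x s + a * integral {0..s} x)"
      by (simp add: algebra_simps)
    ultimately show "((\<lambda>s. exp (a * s) * integral {0..s} x) has_real_derivative exp (a * s) * b s) (at s)"
      by (simp only:)
  qed
  have cL: "continuous_on {0..T} L"
    unfolding L_def[abs_def]
    by (intro continuous_intros indefinite_integral_continuous_1 integrable_continuous_real xT)
  have yL: "exp (a * s) * x s = exp (a * s) * b s - a * L s" if "0 \<le> s" for s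
    unfolding xb[OF that] L_def by (simp add: algebra_simps)
  show ?thesis
    using eventually_ge_at_top[of "Suc N"]
  proof eventually_elim
    case (elim n)
    define t where "t k = T * real k / real n" for k
    have n: "0 < real n" "T / d < real n" using elim N by auto
    have t0: "0 \<le> t k" for k using T n by (simp add: t_def)
    have t_Suc: "t (Suc k) - t k = T / real n" for k by (simp add: t_def distrib_left add_divide_distrib)
    have dt: "T / real n < d" using n d by (simp add: field_simps)
    have t_lt: "t k < t (Suc k)" for k using t_Suc[of k] T n by (smt (verit) divide_pos_pos)
    have t_le: "t k \<le> T" if "k \<le> n" for k using that T n by (simp add: t_def field_simps)
    have close: "\<bar>b s - b (t (Suc k))\<bar> \<le> e'" if "k < n" "t k \<le> s" "s \<le> t (Suc k)" for s k
    proof -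
      have "dist (b s) (b (t (Suc k))) < e'"
        using that t_Suc[of k] dt t0[of k] t0[of "Suc k"] t_le[of "Suc k"] by (intro d) (auto simp: dist_real_def)
      then show ?thesis by (simp add: dist_real_def)
    qed
    have S: "euler_sum a b T n (Suc k) - euler_sum a b T n k = exp (a * t k) * (b (t (Suc k)) - b (t k))" for k
      by (simp add: euler_sum_def t_def)
    have step: "\<bar>(exp (a * t (Suc k)) * x (t (Suc k)) - exp (a * t k) * x (t k)) - (euler_sum a b T n (Suc k) - euler_sum a b T n k)\<bar>
        \<le> e' * exp (a * t (Suc k)) - e' * exp (a * t k)" if k: "k < n" for k
    proof -
      \<comment> \<open>The increment of \<open>p\<close> is minus the error of the step. Its
        derivative is \<open>a * exp (a * s)\<close> times the oscillation
        \<open>b s - b (t (Suc k))\<close>, which is at most \<open>e'\<close> in modulus.\<close>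
      define p where "p s = a * L s - exp (a * s) * b (t (Suc k))" for s
      have sub: "{t k..t (Suc k)} \<subseteq> {0..T}" using t0[of k] t_le[of "Suc k"] k by auto
      have "norm (p (t (Suc k)) - p (t k)) \<le> e' * exp (a * t (Suc k)) - e' * exp (a * t k)"
      proof (rule differentiable_bound_general[OF t_lt, where f' = "\<lambda>s. a * (exp (a * s) * b s) - a * exp (a * s) * b (t (Suc k))"
            and \<phi>' = "\<lambda>s. e' * (a * exp (a * s))"])
        show "continuous_on {t k..t (Suc k)} p"
          unfolding p_def[abs_def] by (intro continuous_intros continuous_on_subset[OF cL sub])
        show "continuous_on {t k..t (Suc k)} (\<lambda>s. e' * exp (a * s))" by (intro continuous_intros)
        fix s assume s: "t k < s" "s < t (Suc k)"
        then have s': "0 < s" "s < T" using t0[of k] t_le[of "Suc k"] k by auto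
        have "(p has_real_derivative a * (exp (a * s) * b s) - a * exp (a * s) * b (t (Suc k))) (at s)"
          unfolding p_def[abs_def]
          by (rule derivative_eq_intros dL s' refl)+ simp
        then show "(p has_vector_derivative a * (exp (a * s) * b s) - a * exp (a * s) * b (t (Suc k))) (at s)"
          by (simp add: has_real_derivative_iff_has_vector_derivative)
        have "((\<lambda>s. e' * exp (a * s)) has_real_derivative e' * (a * exp (a * s))) (at s)"
          by (rule derivative_eq_intros refl)+ simp
        then show "((\<lambda>s. e' * exp (a * s)) has_vector_derivative e' * (a * exp (a * s))) (at s)"
          by (simp add: has_real_derivative_iff_has_vector_derivative)
        have "norm (a * (exp (a * s) * b s) - a * exp (a * s) * b (t (Suc k))) = a * exp (a * s) * \<bar>b s - b (t (Suc k))\<bar>"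
        proof -
          have "a * (exp (a * s) * b s) - a * exp (a * s) * b (t (Suc k)) = a * exp (a * s) * (b s - b (t (Suc k)))"
            by (simp add: algebra_simps)
          then show ?thesis using a by (simp add: abs_mult)
        qed
        also have "\<dots> \<le> a * exp (a * s) * e'"
          using close[of k s] s k a by (intro mult_left_mono) auto
        finally show "norm (a * (exp (a * s) * b s) - a * exp (a * s) * b (t (Suc k))) \<le> e' * (a * exp (a * s))"
          by (simp add: algebra_simps)
      qed
      moreover have "(exp (a * t (Suc k)) * x (t (Suc k)) - exp (a * t k) * x (t k)) - (euler_sum a b T n (Suc k) - euler_sum a b T n k)
          = - (p (t (Suc k)) - p (t k))"
        unfolding S yL[OF t0] p_def by (simp add: algebra_simps)
      ultimately show ?thesis by (simp add: abs_minus_commute)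
    qed
    have tot: "\<bar>euler_sum a b T n k - exp (a * t k) * x (t k)\<bar> \<le> e' * exp (a * t k) - e'" if "k \<le> n" for k
      using that
    proof (induction k)
      case 0
      then show ?case by (simp add: euler_sum_def t_def x0)
    next
      case (Suc k)
      then show ?case using step[of k] by simp
    qed
    have exp_le: "e' * exp (a * t k) \<le> e" if "k \<le> n" for k
    proof -
      have "exp (a * t k) \<le> exp (a * T)" using t_le[OF that] a by simp
      then have "e' * exp (a * t k) \<le> e' * exp (a * T)" using e' by simp
      also have "\<dots> = e" by (simp add: e'_def flip: exp_add)
      finally show ?thesis .
    qed
    show ?case
    proof (intro allI impI conjI)
      fix k assume k: "k \<le> n"
      show "\<bar>euler_sum a b T n k - exp (a * (T * real k / real n)) * x (T * real k / real n)\<bar> \<le> e"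
        using tot[OF k] exp_le[OF k] e' unfolding t_def by linarith
      assume k': "k < n"
      have "\<bar>exp (a * t k) * (b (t (Suc k)) - b (t k))\<bar> = exp (a * t k) * \<bar>b (t k) - b (t (Suc k))\<bar>"
        by (simp add: abs_mult abs_minus_commute)
      also have "\<dots> \<le> exp (a * t k) * e'"
        using close[OF k', of "t k"] t_lt[of k] by (intro mult_left_mono) auto
      also have "\<dots> \<le> e" using exp_le[OF k] by (simp add: mult.commute)
      finally show "\<bar>euler_sum a b T n (Suc k) - euler_sum a b T n k\<bar> \<le> e" unfolding S .
    qed
  qed
qed

text \<open>Absence of zeros up to \<open>t\<close> alone would only bound the infimum below by
  \<open>t\<close>. Continuity at \<open>t\<close> keeps the path away from \<open>0\<close> a
  little longer, which makes the inequality strict.\<close>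

lemma ereal_less_hitting_time_zero_iff:
  assumes cont: "continuous_on {0..} (\<lambda>t. X t \<omega>)" and t: "0 \<le> t"
  shows "ereal t < hitting_time_zero X \<omega> \<longleftrightarrow> (\<forall>s\<in>{0..t}. X s \<omega> \<noteq> 0)"
proof
  assume h: "ereal t < hitting_time_zero X \<omega>"
  show "\<forall>s\<in>{0..t}. X s \<omega> \<noteq> 0"
  proof
    fix s assume s: "s \<in> {0..t}"
    show "X s \<omega> \<noteq> 0"
    proof
      assume "X s \<omega> = 0"
      then have "hitting_time_zero X \<omega> \<le> ereal s"
        unfolding hitting_time_zero_def using s by (intro INF_lower) auto
      then have "hitting_time_zero X \<omega> \<le> ereal t" using s by (simp add: order_trans)
      then show False using h by simp
    qed
  qed
next
  assume h: "\<forall>s\<in>{0..t}. X s \<omega> \<noteq> 0"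
  have "continuous (at t within {0..}) (\<lambda>t. X t \<omega>)" using cont t by (simp add: continuous_on_eq_continuous_within)
  then obtain d where d: "0 < d" "\<And>s. s \<in> {0..} \<Longrightarrow> dist s t < d \<Longrightarrow> dist (X s \<omega>) (X t \<omega>) < \<bar>X t \<omega>\<bar>"
    unfolding continuous_within_eps_delta using h t by (metis atLeastAtMost_iff order_refl zero_less_abs_iff)
  have "ereal (t + d) \<le> hitting_time_zero X \<omega>"
    unfolding hitting_time_zero_def
  proof (rule INF_greatest)
    fix s assume s: "s \<in> {s. 0 \<le> s \<and> X s \<omega> = 0}"
    then have "t < s" using h by force
    then show "ereal (t + d) \<le> ereal s" using d(2)[of s] s by (force simp: dist_real_def)
  qed
  moreover have "ereal t < ereal (t + d)" using d by simp
  ultimately show "ereal t < hitting_time_zero X \<omega>" by (rule less_le_trans[rotated])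
qed

text \<open>Compactness turns strict positivity into a uniform margin, and a non-strict bound passes
  from rational times to all times. The right-hand side is a countable combination of events;
  clamping to \<open>{0..t}\<close> lets \<open>q\<close> run through all rationals.\<close>

lemma positive_on_interval_iff:
  fixes x :: "real \<Rightarrow> real"
  assumes x: "continuous_on {0..} x" and t: "0 \<le> t"
  shows "(\<forall>s\<in>{0..t}. c < x s) \<longleftrightarrow> (\<exists>m. \<forall>q\<in>\<rat>. c + 1 / real (Suc m) \<le> x (min t (max 0 q)))"
proof
  assume h: "\<forall>s\<in>{0..t}. c < x s"
  have "continuous_on {0..t} x" using x by (rule continuous_on_subset) auto
  from continuous_attains_inf[OF _ _ this] t obtain s where s: "s \<in> {0..t}" "\<forall>r\<in>{0..t}. x s \<le> x r" by auto
  from h s obtain m where "1 / real (Suc m) < x s - c"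
    using nat_approx_posE[of "x s - c"] by auto
  moreover have "x s \<le> x (min t (max 0 q))" for q using s t by auto
  ultimately have "c + 1 / real (Suc m) \<le> x (min t (max 0 q))" for q by (smt (verit))
  then show "\<exists>m. \<forall>q\<in>\<rat>. c + 1 / real (Suc m) \<le> x (min t (max 0 q))" by blast
next
  assume "\<exists>m. \<forall>q\<in>\<rat>. c + 1 / real (Suc m) \<le> x (min t (max 0 q))"
  then obtain m where m: "\<And>q. q \<in> \<rat> \<Longrightarrow> c + 1 / real (Suc m) \<le> x (min t (max 0 q))" by blast
  have cont: "continuous_on UNIV (\<lambda>q. x (min t (max 0 q)))"
    by (rule continuous_on_compose2[OF x]) (use t in \<open>auto intro!: continuous_intros\<close>)
  show "\<forall>s\<in>{0..t}. c < x s"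
  proof
    fix s assume s: "s \<in> {0..t}"
    have "c + 1 / real (Suc m) \<le> x (min t (max 0 s))"
      by (rule continuous_ge_on_closure[where S = "\<rat>" and f = "\<lambda>q. x (min t (max 0 q))"])
         (use m cont Rats_closure_real in \<open>auto intro: continuous_on_subset\<close>)
    moreover have "min t (max 0 s) = s" using s by auto
    ultimately have "c + 1 / real (Suc m) \<le> x s" by (simp only:)
    moreover have "0 < 1 / real (Suc m)" by simp
    ultimately show "c < x s" by linarith
  qed
qed

lemma abs_sin_diff_le: "\<bar>sin x - sin y\<bar> \<le> \<bar>x - y\<bar>" for x y :: real
proof -
  have "\<bar>sin x - sin y\<bar> = 2 * \<bar>sin ((x - y) / 2)\<bar> * \<bar>cos ((x + y) / 2)\<bar>"
    by (simp add: sin_diff_sin abs_mult)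
  also have "\<dots> \<le> 2 * \<bar>(x - y) / 2\<bar> * 1"
    by (intro mult_mono abs_sin_x_le_abs_x) auto
  finally show ?thesis by simp
qed

text \<open>The sum is geometric, so its limit comes from the derivative of the exponential at
  \<open>0\<close>. With \<open>c = 2 * a\<close> it is the variance accumulated by the weighted
  increments.\<close>

lemma exponential_riemann_sum_tendsto:
  assumes c: "0 < c" and T: "0 < T"
  shows "(\<lambda>n. \<Sum>j<n. exp (c * (T * real j / real n)) * (T / real n)) \<longlonglongrightarrow> (exp (c * T) - 1) / c"
proof -
  have "((\<lambda>h. exp (c * h)) has_real_derivative c) (at 0)"
    by (auto intro!: derivative_eq_intros)
  then have d: "((\<lambda>h. (exp (c * h) - 1) / h) \<longlongrightarrow> c) (at 0)"
    by (simp add: has_field_derivative_iff)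
  have "(\<lambda>n. T * inverse (real (Suc n))) \<longlonglongrightarrow> T * 0"
    by (intro tendsto_intros LIMSEQ_inverse_real_of_nat)
  then have "filterlim (\<lambda>n. T / real (Suc n)) (at 0) sequentially"
    using T by (simp add: filterlim_at divide_inverse)
  from filterlim_compose[OF d this]
  have "(\<lambda>n. (exp (c * T) - 1) / ((exp (c * (T / real (Suc n))) - 1) / (T / real (Suc n)))) \<longlonglongrightarrow> (exp (c * T) - 1) / c"
    using c by (intro tendsto_intros) auto
  moreover have "(exp (c * T) - 1) / ((exp (c * (T / real (Suc n))) - 1) / (T / real (Suc n))) =
      (\<Sum>j<Suc n. exp (c * (T * real j / real (Suc n))) * (T / real (Suc n)))" for n
  proof -
    define r where "r = exp (c * (T / real (Suc n)))"
    have r: "r \<noteq> 1" using c T by (simp add: r_def)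
    have "exp (c * (T * real j / real (Suc n))) = r ^ j" for j
      unfolding r_def by (simp add: mult_ac flip: exp_of_nat_mult)
    then have "(\<Sum>j<Suc n. exp (c * (T * real j / real (Suc n))) * (T / real (Suc n))) = (\<Sum>j<Suc n. r ^ j) * (T / real (Suc n))"
      by (simp only: sum_distrib_right)
    also have "(\<Sum>j<Suc n. r ^ j) = (r ^ Suc n - 1) / (r - 1)"
      using r by (rule geometric_sum)
    also have "r ^ Suc n = exp (c * T)"
      unfolding r_def by (simp del: of_nat_Suc power_Suc flip: exp_of_nat_mult)
    finally show ?thesis using r by (simp add: r_def)
  qed
  ultimately show ?thesis by (intro LIMSEQ_imp_Suc[of "\<lambda>n. \<Sum>j<n. exp (c * (T * real j / real n)) * (T / real n)"]) (simp only:)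
qed

lemma positive_on_interval_measurable:
  fixes Y :: "real \<Rightarrow> 'a \<Rightarrow> real"
  assumes "\<And>s. 0 \<le> s \<Longrightarrow> Y s \<in> borel_measurable M" and t: "0 \<le> t"
    and cont: "\<And>\<omega>. \<omega> \<in> space M \<Longrightarrow> continuous_on {0..} (\<lambda>s. Y s \<omega>)"
  shows "{\<omega> \<in> space M. \<forall>s\<in>{0..t}. c < Y s \<omega>} \<in> sets M"
proof -
  have [measurable]: "Y (min t (max 0 q)) \<in> borel_measurable M" for q by (rule assms(1)) (use t in auto)
  have "{\<omega> \<in> space M. \<forall>s\<in>{0..t}. c < Y s \<omega>} =
      {\<omega> \<in> space M. \<exists>m. \<forall>q\<in>\<rat>. c + 1 / real (Suc m) \<le> Y (min t (max 0 q)) \<omega>}"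
    using positive_on_interval_iff[OF cont t, of _ c] by auto
  also have "\<dots> = (\<Union>m. (\<Inter>q\<in>\<rat>. {\<omega> \<in> space M. c + 1 / real (Suc m) \<le> Y (min t (max 0 q)) \<omega>}))"
    using Rats_0 by auto
  also have "\<dots> \<in> sets M"
  proof (intro sets.countable_UN image_subsetI)
    fix m :: nat
    show "(\<Inter>q\<in>\<rat>. {\<omega> \<in> space M. c + 1 / real (Suc m) \<le> Y (min t (max 0 q)) \<omega>}) \<in> sets M"
      using Rats_0 by (intro sets.countable_INT' countable_rat image_subsetI) auto
  qed
  finally show ?thesis .
qed

section \<open>The sine transform of the surviving process\<close>

context brownian_motion
begin

text \<open>The walk starts with the variable \<open>B 0\<close> of arbitrary law at index
  \<open>0\<close>; only the later ones, the increments weighted by \<open>exp (a * t j)\<close>,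
  are Gaussian.\<close>

lemma euler_sum_stopped:
  fixes a T \<theta> \<epsilon> :: real
  assumes T: "0 < T" and n: "0 < n"
  defines "Q \<equiv> \<lambda>k. \<Sum>j<k. \<theta>\<^sup>2 * (exp (a * (T * real j / real n)) * sqrt (T / real n))\<^sup>2 / 2"
  obtains Z where "random_variable borel Z"
    and "expectation Z = exp (- Q n) * expectation (\<lambda>\<omega>. sin (\<theta> * B 0 \<omega>))"
    and "\<And>\<omega> k. k \<le> n \<Longrightarrow> (\<And>j. j < k \<Longrightarrow> \<epsilon> < euler_sum a (\<lambda>s. B s \<omega>) T n j) \<Longrightarrow>
        k = n \<or> euler_sum a (\<lambda>s. B s \<omega>) T n k \<le> \<epsilon> \<Longrightarrow>
        Z \<omega> = exp (Q k - Q n) * sin (\<theta> * euler_sum a (\<lambda>s. B s \<omega>) T n k)"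
proof -
  define t where "t j = T * real j / real n" for j
  have tm: "t j < t (Suc j)" "0 \<le> t j" "t (Suc j) - t j = T / real n" for j
    using T n by (auto simp: t_def divide_strict_right_mono distrib_left add_divide_distrib)
  define \<xi>0 where "\<xi>0 i \<omega> = (case i of 0 \<Rightarrow> B 0 \<omega> | Suc j \<Rightarrow> B (t (Suc j)) \<omega> - B (t j) \<omega>)" for i \<omega>
  define \<xi> where "\<xi> i \<omega> = (case i of 0 \<Rightarrow> 1 | Suc j \<Rightarrow> exp (a * t j)) * \<xi>0 i \<omega>" for i \<omega>
  have "indep_vars (\<lambda>_. borel) \<xi>0 {..n}"
    unfolding \<xi>0_def[abs_def] using tm(1) by (intro independent_increments) (auto simp: t_def less_imp_le)
  then have ind: "indep_vars (\<lambda>_. borel) \<xi> {..n}"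
    unfolding \<xi>_def[abs_def] by (rule indep_vars_compose2) auto
  have norm: "distributed M lborel (\<xi> (Suc j)) (normal_density 0 (exp (a * (T * real j / real n)) * sqrt (T / real n)))" for j
  proof -
    have "distributed M lborel (\<lambda>\<omega>. B (t (Suc j)) \<omega> - B (t j) \<omega>) (normal_density 0 (sqrt (T / real n)))"
      using normal_increments[OF tm(2) tm(1), of j] tm(3)[of j] by simp
    from normal_density_affine[OF this, of "exp (a * t j)" 0]
    show ?thesis using T n by (simp add: \<xi>_def[abs_def] \<xi>0_def t_def)
  qed
  have S: "(\<Sum>i\<le>k. \<xi> i \<omega>) = euler_sum a (\<lambda>s. B s \<omega>) T n k" for k \<omega>
    by (induction k) (simp_all add: \<xi>_def \<xi>0_def euler_sum_def t_def)
  have \<sigma>: "0 < exp (a * (T * real j / real n)) * sqrt (T / real n)" for j using T n by simp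
  have \<xi>0: "\<xi> 0 = B 0" by (simp add: \<xi>_def \<xi>0_def fun_eq_iff)
  obtain Z where "random_variable borel Z"
    "expectation Z = exp (- Q n) * expectation (\<lambda>\<omega>. sin (\<theta> * \<xi> 0 \<omega>))"
    "\<And>\<omega> k. k \<le> n \<Longrightarrow> (\<And>j. j < k \<Longrightarrow> \<epsilon> < (\<Sum>i\<le>j. \<xi> i \<omega>)) \<Longrightarrow> k = n \<or> (\<Sum>i\<le>k. \<xi> i \<omega>) \<le> \<epsilon> \<Longrightarrow>
        Z \<omega> = exp (Q k - Q n) * sin (\<theta> * (\<Sum>i\<le>k. \<xi> i \<omega>))"
    using stopped_sine_martingale[OF ind norm \<sigma>, of \<theta> \<epsilon>] unfolding Q_def by blast
  then show thesis using that unfolding S \<xi>0 by blast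
qed

text \<open>Stopping at the level \<open>\<epsilon>\<close> rather than at \<open>0\<close> makes every path that reaches \<open>0\<close> stop on all fine
  grids. The price is the event that the path stays positive but comes within \<open>\<epsilon>\<close> of \<open>0\<close>.\<close>

lemma sine_survival_approx:
  assumes a: "0 < a" and T: "0 < T" and ou: "ornstein_uhlenbeck M a B X"
    and pos: "AE \<omega> in M. 0 \<le> B 0 \<omega>" and \<epsilon>: "0 < \<epsilon>"
  defines "W \<equiv> \<lambda>c. {\<omega> \<in> space M. \<forall>s\<in>{0..T}. c < exp (a * s) * X s \<omega>}"
  shows "\<bar>exp (- (\<theta>\<^sup>2 / 2 * ((exp (2 * a * T) - 1) / (2 * a)))) * expectation (\<lambda>\<omega>. sin (\<theta> * B 0 \<omega>))
      - expectation (\<lambda>\<omega>. sin (\<theta> * (exp (a * T) * X T \<omega>)) * indicator (W 0) \<omega>)\<bar>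
      \<le> \<bar>\<theta>\<bar> * \<epsilon> + 2 * prob (W 0 - W \<epsilon>)"
proof -
  let ?E = "\<lambda>\<omega> n k. euler_sum a (\<lambda>s. B s \<omega>) T n k"
  have X_meas: "X t \<in> borel_measurable M" if "0 \<le> t" for t
    using ou that by (simp add: ornstein_uhlenbeck_def)
  have X_cont: "continuous_on {0..} (\<lambda>t. X t \<omega>)" if "\<omega> \<in> space M" for \<omega>
    using ou that by (simp add: ornstein_uhlenbeck_def)
  have Y_cont: "continuous_on {0..} (\<lambda>t. exp (a * t) * X t \<omega>)" if "\<omega> \<in> space M" for \<omega>
    by (intro continuous_intros X_cont that)
  have W_sets [measurable]: "W c \<in> sets M" for c
    unfolding W_def using X_meas Y_cont T by (intro positive_on_interval_measurable) auto
  have [measurable]: "X T \<in> borel_measurable M" using X_meas T by simp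
  define Q where "Q n k = (\<Sum>j<k. \<theta>\<^sup>2 * (exp (a * (T * real j / real n)) * sqrt (T / real n))\<^sup>2 / 2)" for n k
  define good where "good n Z \<longleftrightarrow> random_variable borel Z \<and>
      expectation Z = exp (- Q n n) * expectation (\<lambda>\<omega>. sin (\<theta> * B 0 \<omega>)) \<and>
      (\<forall>\<omega> k. k \<le> n \<longrightarrow> (\<forall>j<k. \<epsilon> < ?E \<omega> n j) \<longrightarrow> k = n \<or> ?E \<omega> n k \<le> \<epsilon> \<longrightarrow>
        Z \<omega> = exp (Q n k - Q n n) * sin (\<theta> * ?E \<omega> n k))" for n Z
  have "\<exists>Z. good (Suc n) Z" for n
  proof (rule euler_sum_stopped[OF T zero_less_Suc[of n], where \<theta> = \<theta> and \<epsilon> = \<epsilon> and a = a, folded Q_def])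
    fix Z assume "random_variable borel Z"
      "expectation Z = exp (- Q (Suc n) (Suc n)) * expectation (\<lambda>\<omega>. sin (\<theta> * B 0 \<omega>))"
      "\<And>\<omega> k. k \<le> Suc n \<Longrightarrow> (\<And>j. j < k \<Longrightarrow> \<epsilon> < ?E \<omega> (Suc n) j) \<Longrightarrow> k = Suc n \<or> ?E \<omega> (Suc n) k \<le> \<epsilon> \<Longrightarrow>
        Z \<omega> = exp (Q (Suc n) k - Q (Suc n) (Suc n)) * sin (\<theta> * ?E \<omega> (Suc n) k)"
    then have "good (Suc n) Z" unfolding good_def by (intro conjI allI impI) simp_all
    then show ?thesis by (intro exI[of _ Z])
  qed
  then obtain Z' where Z': "\<And>n. good (Suc n) (Z' n)" by metis
  \<comment> \<open>The grid with \<open>n = 0\<close> is degenerate, so the variables are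
    constructed at \<open>Suc n\<close> and shifted back.\<close>
  define Z where "Z n = Z' (n - 1)" for n
  have Z: "good n (Z n)" if "0 < n" for n
    using Z'[of "n - 1"] that by (simp add: Z_def)
  have Z_meas [measurable]: "Z n \<in> borel_measurable M" for n
    using Z'[of "n - 1"] by (simp add: Z_def good_def)
  have Q_mono: "Q n k \<le> Q n n" if "k \<le> n" for n k
    unfolding Q_def using that by (intro sum_mono2) auto
  have stop: "\<exists>k\<le>n. (\<forall>j<k. \<epsilon> < ?E \<omega> n j) \<and> (k = n \<or> ?E \<omega> n k \<le> \<epsilon>) \<and> Z n \<omega> = exp (Q n k - Q n n) * sin (\<theta> * ?E \<omega> n k)
      \<and> \<bar>Z n \<omega>\<bar> \<le> \<bar>sin (\<theta> * ?E \<omega> n k)\<bar>" if n: "0 < n" for n \<omega>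
  proof -
    define k where "k = (LEAST k. k = n \<or> ?E \<omega> n k \<le> \<epsilon>)"
    have 1: "k = n \<or> ?E \<omega> n k \<le> \<epsilon>" unfolding k_def by (rule LeastI[of _ n]) simp
    have 2: "k \<le> n" unfolding k_def by (rule Least_le) simp
    have 3: "\<epsilon> < ?E \<omega> n j" if "j < k" for j
      using not_less_Least[of j "\<lambda>k. k = n \<or> ?E \<omega> n k \<le> \<epsilon>"] that unfolding k_def by auto
    have 4: "Z n \<omega> = exp (Q n k - Q n n) * sin (\<theta> * ?E \<omega> n k)"
      using Z[OF n] 1 2 3 unfolding good_def by blast
    have "\<bar>Z n \<omega>\<bar> \<le> 1 * \<bar>sin (\<theta> * ?E \<omega> n k)\<bar>"
      unfolding 4 abs_mult using Q_mono[OF 2] by (intro mult_right_mono) auto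
    then show ?thesis using 1 2 3 4 by auto
  qed
  have Z_bound: "\<bar>Z n \<omega>\<bar> \<le> 1" if "0 < n" for n \<omega>
    using stop[OF that, of \<omega>] abs_sin_le_one by (meson order_trans)
  define V where "V \<omega> = sin (\<theta> * (exp (a * T) * X T \<omega>)) * indicator (W 0) \<omega>" for \<omega>
  \<comment> \<open>Paths that hit \<open>0\<close> and paths that stay above
    \<open>\<epsilon>\<close> allow an error \<open>\<bar>\<theta>\<bar> * \<epsilon>\<close>. On
    the remaining event only the trivial bound \<open>2\<close> is used.\<close>
  define b where "b \<omega> = \<bar>\<theta>\<bar> * \<epsilon> + 2 * indicator (W 0 - W \<epsilon>) \<omega>" for \<omega> :: 'a
  have V_bound: "\<bar>V \<omega>\<bar> \<le> 1" for \<omega> by (simp add: V_def indicator_def)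
  have b_bound: "0 \<le> b \<omega>" "b \<omega> \<le> \<bar>\<theta>\<bar> * \<epsilon> + 2" for \<omega> using \<epsilon> by (auto simp: b_def indicator_def)
  have [measurable]: "V \<in> borel_measurable M" "b \<in> borel_measurable M" by (simp_all add: V_def[abs_def] b_def[abs_def])
  have path: "eventually (\<lambda>n. \<bar>Z n \<omega> - V \<omega>\<bar> \<le> b \<omega>) sequentially" if \<omega>: "\<omega> \<in> space M" and B0: "0 \<le> B 0 \<omega>" for \<omega>
  proof -
    let ?Y = "\<lambda>s. exp (a * s) * X s \<omega>"
    have ode: "X t \<omega> - X 0 \<omega> = (B t \<omega> - B 0 \<omega>) - a * integral {0..t} (\<lambda>s. X s \<omega>)" if "0 \<le> t" for t
      using ou \<omega> that unfolding ornstein_uhlenbeck_def by blast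
    have X0: "X 0 \<omega> = B 0 \<omega>" using ou \<omega> by (simp add: ornstein_uhlenbeck_def)
    have approx: "eventually (\<lambda>n. \<forall>k\<le>n. \<bar>?E \<omega> n k - ?Y (T * real k / real n)\<bar> \<le> e
      \<and> (k < n \<longrightarrow> \<bar>?E \<omega> n (Suc k) - ?E \<omega> n k\<bar> \<le> e)) sequentially" if "0 < e" for e
      by (rule euler_sum_approx[OF a T that continuous_paths[OF \<omega>] X_cont[OF \<omega>] _ X0]) (rule ode)
    consider "\<omega> \<notin> W 0" | "\<omega> \<in> W \<epsilon>" | "\<omega> \<in> W 0 - W \<epsilon>" by blast
    then show ?thesis
    proof cases
      \<comment> \<open>Here \<open>V\<close> is \<open>0\<close>. Near a time with value at most
        \<open>0\<close> the walk lies below \<open>\<epsilon>\<close>, so it stops. Its previous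
        value exceeds \<open>\<epsilon>\<close> and single steps are at most
        \<open>\<epsilon> / 2\<close>, so it stops between \<open>0\<close> and
        \<open>\<epsilon>\<close>; stopping at index \<open>0\<close> is covered by
        \<open>0 \<le> B 0 \<omega>\<close>.\<close>
      case 1
      then obtain s where s: "0 \<le> s" "s \<le> T" "?Y s \<le> 0" using \<omega> unfolding W_def by force
      have "continuous (at s within {0..}) ?Y"
        using Y_cont[OF \<omega>] s by (simp add: continuous_on_eq_continuous_within)
      then obtain d where d: "0 < d" "\<And>r. r \<in> {0..} \<Longrightarrow> dist r s < d \<Longrightarrow> dist (?Y r) (?Y s) < \<epsilon> / 2"
        unfolding continuous_within_eps_delta using \<epsilon> by (meson half_gt_zero)
      obtain N where N: "T / d < real N" using reals_Archimedean2 by blast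
      have "0 < \<epsilon> / 2" using \<epsilon> by simp
      from approx[OF this] eventually_ge_at_top[of "Suc N"] show ?thesis
      proof eventually_elim
        case (elim n)
        have n: "0 < n" "T / d < real n" using elim N by auto
        define m where "m = nat \<lfloor>s * real n / T\<rfloor>"
        have m: "real m \<le> s * real n / T" "s * real n / T < real m + 1"
          using s n T by (simp_all add: m_def)
        have "m \<le> n"
        proof -
          have "s * real n / T \<le> real n" using s n T by (simp add: field_simps mult_right_mono)
          then have "real m \<le> real n" using m by linarith
          then show ?thesis by simp
        qed
        have t: "0 \<le> T * real m / real n" "T * real m / real n \<le> s" "s < T * real m / real n + T / real n"
          using m n T by (auto simp: field_simps)
        have "T / real n < d" using n d by (simp add: field_simps)
        then have "dist (T * real m / real n) s < d" using t by (simp add: dist_real_def)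
        then have "dist (?Y (T * real m / real n)) (?Y s) < \<epsilon> / 2" using t by (intro d(2)) auto
        then have "?Y (T * real m / real n) < \<epsilon> / 2" using s(3) unfolding dist_real_def by linarith
        moreover have "\<bar>?E \<omega> n m - ?Y (T * real m / real n)\<bar> \<le> \<epsilon> / 2" using elim \<open>m \<le> n\<close> by blast
        ultimately have Em: "?E \<omega> n m \<le> \<epsilon>" by linarith
        obtain k where k: "k \<le> n" "\<forall>j<k. \<epsilon> < ?E \<omega> n j" "k = n \<or> ?E \<omega> n k \<le> \<epsilon>"
          "\<bar>Z n \<omega>\<bar> \<le> \<bar>sin (\<theta> * ?E \<omega> n k)\<bar>" using stop[OF n(1), of \<omega>] by blast
        have "k \<le> m" using k(2) Em by (meson not_le not_less_iff_gr_or_eq order_less_le)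
        then have Ek: "?E \<omega> n k \<le> \<epsilon>" using k(3) Em \<open>m \<le> n\<close> by force
        have "0 \<le> ?E \<omega> n k"
        proof (cases k)
          case 0 then show ?thesis using B0 by (simp add: euler_sum_def)
        next
          case (Suc j)
          then have "\<epsilon> < ?E \<omega> n j" "\<bar>?E \<omega> n k - ?E \<omega> n j\<bar> \<le> \<epsilon> / 2" using k elim by auto
          then show ?thesis by linarith
        qed
        then have "\<bar>sin (\<theta> * ?E \<omega> n k)\<bar> \<le> \<bar>\<theta>\<bar> * \<epsilon>"
          using abs_sin_x_le_abs_x[of "\<theta> * ?E \<omega> n k"] Ek mult_left_mono[of "\<bar>?E \<omega> n k\<bar>" \<epsilon> "\<bar>\<theta>\<bar>"]
          by (simp add: abs_mult)
        then show ?case using k(4) 1 by (simp add: V_def b_def)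
      qed
    next
      case 2
      have "continuous_on {0..T} ?Y" using Y_cont[OF \<omega>] by (rule continuous_on_subset) auto
      from continuous_attains_inf[OF _ _ this] T obtain s where s: "s \<in> {0..T}" "\<And>r. r \<in> {0..T} \<Longrightarrow> ?Y s \<le> ?Y r" by auto
      have sY: "\<epsilon> < ?Y s" using 2 s by (simp add: W_def)
      \<comment> \<open>Half of the margin keeps the walk above \<open>\<epsilon>\<close> at all
        grid points, so that it runs to the end; the bound by \<open>\<epsilon>\<close> controls the
        error there.\<close>
      define e where "e = min \<epsilon> ((?Y s - \<epsilon>) / 2)"
      have e: "0 < e" using sY \<epsilon> by (simp add: e_def)
      from approx[OF e] eventually_gt_at_top[of 0] show ?thesis
      proof eventually_elim
        case (elim n)
        have large: "\<epsilon> < ?E \<omega> n k" if "k \<le> n" for k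
        proof -
          have "T * real k / real n \<in> {0..T}" using that elim T by (auto simp: field_simps)
          then have "?Y s \<le> ?Y (T * real k / real n)" by (rule s)
          moreover have "\<bar>?E \<omega> n k - ?Y (T * real k / real n)\<bar> \<le> e" using elim that by blast
          moreover have "e \<le> (?Y s - \<epsilon>) / 2" unfolding e_def by (rule min.cobounded2)
          moreover have "\<epsilon> < C" if "A \<le> D" "\<bar>C - D\<bar> \<le> e" "e \<le> (A - \<epsilon>) / 2" "\<epsilon> < A" for A C D :: real
          proof -
            have "D - C \<le> e" using that(2) by (simp add: abs_le_iff)
            moreover have "2 * e \<le> A - \<epsilon>" using that(3) by simp
            ultimately show ?thesis using that(1,4) by linarith
          qed
          ultimately show ?thesis using sY by blast
        qed
        obtain k where k: "k \<le> n" "k = n \<or> ?E \<omega> n k \<le> \<epsilon>" "Z n \<omega> = exp (Q n k - Q n n) * sin (\<theta> * ?E \<omega> n k)"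
          using stop[OF elim(2), of \<omega>] by blast
        then have "k = n" using large[of k] by auto
        then have Zn: "Z n \<omega> = sin (\<theta> * ?E \<omega> n n)" using k by simp
        have W0: "\<omega> \<in> W 0" using 2 \<epsilon> unfolding W_def by force
        have "\<bar>?E \<omega> n n - ?Y (T * real n / real n)\<bar> \<le> e" using elim(1) by blast
        moreover have "e \<le> \<epsilon>" unfolding e_def by (rule min.cobounded1)
        ultimately have "\<bar>?E \<omega> n n - ?Y (T * real n / real n)\<bar> \<le> \<epsilon>" by (rule order_trans)
        then have En: "\<bar>?E \<omega> n n - ?Y T\<bar> \<le> \<epsilon>" using elim by simp
        have "\<bar>sin (\<theta> * ?E \<omega> n n) - sin (\<theta> * ?Y T)\<bar> \<le> \<bar>\<theta> * ?E \<omega> n n - \<theta> * ?Y T\<bar>"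
          by (rule abs_sin_diff_le)
        also have "\<dots> = \<bar>\<theta>\<bar> * \<bar>?E \<omega> n n - ?Y T\<bar>" by (simp add: abs_mult flip: right_diff_distrib)
        also have "\<dots> \<le> \<bar>\<theta>\<bar> * \<epsilon>" using En by (intro mult_left_mono) auto
        finally show ?case using W0 2 by (simp add: Zn V_def b_def)
      qed
    next
      case 3
      then have "2 \<le> b \<omega>" using \<epsilon> by (simp add: b_def)
      then have "\<bar>Z n \<omega> - V \<omega>\<bar> \<le> b \<omega>" if "0 < n" for n
        using Z_bound[OF that, of \<omega>] V_bound[of \<omega>] by linarith
      then show ?thesis by (intro eventually_mono[OF eventually_gt_at_top[of "0::nat"]])
    qed
  qed
  \<comment> \<open>Taking the maximum with \<open>b\<close> turns the eventual inequality into
    convergence to \<open>b\<close>, to which dominated convergence applies.\<close>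
  have lim1: "(\<lambda>n. expectation (\<lambda>\<omega>. max \<bar>Z (Suc n) \<omega> - V \<omega>\<bar> (b \<omega>))) \<longlonglongrightarrow> expectation b"
  proof (rule integral_dominated_convergence[where w = "\<lambda>_. \<bar>\<theta>\<bar> * \<epsilon> + 2"])
    show "AE \<omega> in M. (\<lambda>n. max \<bar>Z (Suc n) \<omega> - V \<omega>\<bar> (b \<omega>)) \<longlonglongrightarrow> b \<omega>"
      using pos AE_space
    proof eventually_elim
      case (elim \<omega>)
      have "eventually (\<lambda>n. max \<bar>Z n \<omega> - V \<omega>\<bar> (b \<omega>) = b \<omega>) sequentially"
        using path[OF elim(2,1)] by eventually_elim simp
      then have "(\<lambda>n. max \<bar>Z n \<omega> - V \<omega>\<bar> (b \<omega>)) \<longlonglongrightarrow> b \<omega>" by (rule tendsto_eventually)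
      then show ?case by (rule LIMSEQ_Suc)
    qed
    show "AE \<omega> in M. norm (max \<bar>Z (Suc n) \<omega> - V \<omega>\<bar> (b \<omega>)) \<le> \<bar>\<theta>\<bar> * \<epsilon> + 2" for n
    proof (rule AE_I2)
      fix \<omega>
      have "0 \<le> \<bar>\<theta>\<bar> * \<epsilon>" using \<epsilon> by simp
      then show "norm (max \<bar>Z (Suc n) \<omega> - V \<omega>\<bar> (b \<omega>)) \<le> \<bar>\<theta>\<bar> * \<epsilon> + 2"
        using Z_bound[of "Suc n" \<omega>] V_bound[of \<omega>] b_bound[of \<omega>] by (simp add: max_def) linarith
    qed
  qed auto
  have b_expectation: "expectation b = \<bar>\<theta>\<bar> * \<epsilon> + 2 * prob (W 0 - W \<epsilon>)"
  proof -
    have "integrable M (\<lambda>\<omega>. indicator (W 0 - W \<epsilon>) \<omega> :: real)" by (intro integrable_real_indicator) (auto simp: emeasure_eq_measure)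
    then show ?thesis unfolding b_def by (simp add: prob_space)
  qed
  have Q_lim: "(\<lambda>n. Q (Suc n) (Suc n)) \<longlonglongrightarrow> \<theta>\<^sup>2 / 2 * ((exp (2 * a * T) - 1) / (2 * a))"
  proof -
    have "Q n n = \<theta>\<^sup>2 / 2 * (\<Sum>j<n. exp (2 * a * (T * real j / real n)) * (T / real n))" for n
    proof -
      have sq: "(exp (a * u))\<^sup>2 = exp (2 * a * u)" for u
        by (simp add: exp_double[symmetric] mult.assoc)
      show ?thesis
        unfolding Q_def sum_distrib_left power_mult_distrib sq using T by (intro sum.cong refl) simp
    qed
    moreover have "(\<lambda>n. \<theta>\<^sup>2 / 2 * (\<Sum>j<n. exp (2 * a * (T * real j / real n)) * (T / real n))) \<longlonglongrightarrow> \<theta>\<^sup>2 / 2 * ((exp (2 * a * T) - 1) / (2 * a))"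
      using a T by (intro tendsto_intros exponential_riemann_sum_tendsto) auto
    ultimately have "(\<lambda>n. Q n n) \<longlonglongrightarrow> \<theta>\<^sup>2 / 2 * ((exp (2 * a * T) - 1) / (2 * a))" by (simp only:)
    then show ?thesis by (rule LIMSEQ_Suc)
  qed
  have lim2: "(\<lambda>n. \<bar>expectation (Z (Suc n)) - expectation V\<bar>) \<longlonglongrightarrow>
     \<bar>exp (- (\<theta>\<^sup>2 / 2 * ((exp (2 * a * T) - 1) / (2 * a)))) * expectation (\<lambda>\<omega>. sin (\<theta> * B 0 \<omega>)) - expectation V\<bar>"
  proof -
    have "expectation (Z (Suc n)) = exp (- Q (Suc n) (Suc n)) * expectation (\<lambda>\<omega>. sin (\<theta> * B 0 \<omega>))" for n
      using Z[of "Suc n"] by (simp add: good_def)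
    then show ?thesis by (simp only:) (intro tendsto_intros Q_lim)
  qed
  have le: "\<bar>expectation (Z (Suc n)) - expectation V\<bar> \<le> expectation (\<lambda>\<omega>. max \<bar>Z (Suc n) \<omega> - V \<omega>\<bar> (b \<omega>))" for n
  proof -
    have iZ: "integrable M (Z (Suc n))" by (rule integrable_const_bound[where B = 1]) (use Z_bound in auto)
    have iV: "integrable M V" by (rule integrable_const_bound[where B = 1]) (use V_bound in auto)
    have ib: "integrable M b" by (rule integrable_const_bound[where B = "\<bar>\<theta>\<bar> * \<epsilon> + 2"]) (use b_bound in auto)
    have "\<bar>expectation (Z (Suc n)) - expectation V\<bar> = \<bar>expectation (\<lambda>\<omega>. Z (Suc n) \<omega> - V \<omega>)\<bar>"
      using iZ iV by simp
    also have "\<dots> \<le> expectation (\<lambda>\<omega>. \<bar>Z (Suc n) \<omega> - V \<omega>\<bar>)" by (rule integral_abs_bound)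
    also have "\<dots> \<le> expectation (\<lambda>\<omega>. max \<bar>Z (Suc n) \<omega> - V \<omega>\<bar> (b \<omega>))"
      using iZ iV ib by (intro integral_mono integrable_max integrable_abs Bochner_Integration.integrable_diff) auto
    finally show ?thesis .
  qed
  have "\<bar>exp (- (\<theta>\<^sup>2 / 2 * ((exp (2 * a * T) - 1) / (2 * a)))) * expectation (\<lambda>\<omega>. sin (\<theta> * B 0 \<omega>)) - expectation V\<bar> \<le> expectation b"
    by (rule LIMSEQ_le[OF lim2 lim1]) (use le in auto)
  then show ?thesis unfolding b_expectation V_def .
qed

text \<open>The events that the path stays positive but not above \<open>\<epsilon>\<close> decrease
  to the empty set as \<open>\<epsilon>\<close> tends to \<open>0\<close>, since a positive
  continuous path has a positive minimum on \<open>{0..T}\<close>. Both error terms of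
  \<open>sine_survival_approx\<close> therefore vanish.\<close>

lemma sine_survival:
  assumes a: "0 < a" and T: "0 < T" and ou: "ornstein_uhlenbeck M a B X"
    and pos: "AE \<omega> in M. 0 \<le> B 0 \<omega>"
  shows "expectation (\<lambda>\<omega>. sin (\<theta> * (exp (a * T) * X T \<omega>)) * indicator {\<omega> \<in> space M. \<forall>s\<in>{0..T}. 0 < X s \<omega>} \<omega>)
     = exp (- (\<theta>\<^sup>2 / 2 * ((exp (2 * a * T) - 1) / (2 * a)))) * expectation (\<lambda>\<omega>. sin (\<theta> * B 0 \<omega>))"
proof -
  define W where "W c = {\<omega> \<in> space M. \<forall>s\<in>{0..T}. c < exp (a * s) * X s \<omega>}" for c
  have W0: "W 0 = {\<omega> \<in> space M. \<forall>s\<in>{0..T}. 0 < X s \<omega>}"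
    by (simp add: W_def zero_less_mult_iff)
  have W_sets: "W c \<in> sets M" for c
    unfolding W_def using ou T
    by (intro positive_on_interval_measurable) (auto simp: ornstein_uhlenbeck_def intro!: continuous_intros)
  define A where "A m = W 0 - W (1 / real (Suc m))" for m
  have "(\<lambda>m. prob (A m)) \<longlonglongrightarrow> prob (\<Inter>m. A m)"
  proof (rule finite_Lim_measure_decseq)
    show "range A \<subseteq> sets M" using W_sets by (auto simp: A_def)
    show "decseq A"
    proof (rule decseq_SucI)
      fix m
      have "1 / real (Suc (Suc m)) \<le> 1 / real (Suc m)" by (intro divide_left_mono) auto
      then have "W (1 / real (Suc m)) \<subseteq> W (1 / real (Suc (Suc m)))"
        unfolding W_def by (auto intro: le_less_trans)
      then show "A (Suc m) \<subseteq> A m" by (auto simp: A_def)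
    qed
  qed
  moreover have "(\<Inter>m. A m) = {}"
  proof (rule ccontr)
    assume "(\<Inter>m. A m) \<noteq> {}"
    then obtain \<omega> where \<omega>: "\<And>m. \<omega> \<in> A m" by auto
    then have \<omega>0: "\<omega> \<in> space M" "\<omega> \<in> W 0" by (auto simp: A_def W_def)
    have "continuous_on {0..T} (\<lambda>s. exp (a * s) * X s \<omega>)"
    proof -
      have "continuous_on {0..} (\<lambda>s. X s \<omega>)" using ou \<omega>0 by (simp add: ornstein_uhlenbeck_def)
      then have "continuous_on {0..T} (\<lambda>s. X s \<omega>)" by (rule continuous_on_subset) auto
      then show ?thesis by (intro continuous_intros)
    qed
    from continuous_attains_inf[OF _ _ this] T obtain s where s: "s \<in> {0..T}"
      "\<And>r. r \<in> {0..T} \<Longrightarrow> exp (a * s) * X s \<omega> \<le> exp (a * r) * X r \<omega>" by auto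
    have "0 < exp (a * s) * X s \<omega>" using s(1) \<omega>0 by (simp add: W_def)
    then obtain m where "1 / real (Suc m) < exp (a * s) * X s \<omega>" using nat_approx_posE by blast
    then have "\<omega> \<in> W (1 / real (Suc m))" using s(2) \<omega>0 unfolding W_def by (auto intro: less_le_trans)
    then show False using \<omega>[of m] by (simp add: A_def)
  qed
  ultimately have A: "(\<lambda>m. prob (A m)) \<longlonglongrightarrow> 0" by simp
  have "(\<lambda>m. \<bar>\<theta>\<bar> * (1 / real (Suc m)) + 2 * prob (A m)) \<longlonglongrightarrow> \<bar>\<theta>\<bar> * 0 + 2 * 0"
    by (intro tendsto_intros A) (use LIMSEQ_inverse_real_of_nat in \<open>simp add: divide_inverse\<close>)
  then have lim: "(\<lambda>m. \<bar>\<theta>\<bar> * (1 / real (Suc m)) + 2 * prob (A m)) \<longlonglongrightarrow> 0" by simp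
  have "\<bar>exp (- (\<theta>\<^sup>2 / 2 * ((exp (2 * a * T) - 1) / (2 * a)))) * expectation (\<lambda>\<omega>. sin (\<theta> * B 0 \<omega>))
      - expectation (\<lambda>\<omega>. sin (\<theta> * (exp (a * T) * X T \<omega>)) * indicator (W 0) \<omega>)\<bar> \<le> \<bar>\<theta>\<bar> * (1 / real (Suc m)) + 2 * prob (A m)" for m
    using sine_survival_approx[OF a T ou pos, of "1 / real (Suc m)" \<theta>] unfolding A_def W_def by simp
  then have "\<bar>exp (- (\<theta>\<^sup>2 / 2 * ((exp (2 * a * T) - 1) / (2 * a)))) * expectation (\<lambda>\<omega>. sin (\<theta> * B 0 \<omega>))
      - expectation (\<lambda>\<omega>. sin (\<theta> * (exp (a * T) * X T \<omega>)) * indicator (W 0) \<omega>)\<bar> \<le> 0"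
    by (intro LIMSEQ_le_const[OF lim]) auto
  then show ?thesis unfolding W0 by simp
qed

end

text \<open>The average of two laws, realised as the law of a variable that a fair coin selects from
  an independent pair; this keeps it a probability distribution.\<close>

definition fair_mixture :: "real measure \<Rightarrow> real measure \<Rightarrow> real measure" where
  "fair_mixture P Q = distr (measure_pmf (bernoulli_pmf (1 / 2)) \<Otimes>\<^sub>M (P \<Otimes>\<^sub>M Q)) borel
     (\<lambda>z. if fst z then fst (snd z) else snd (snd z))"

lemma
  assumes "real_distribution P" "real_distribution Q"
  shows real_distribution_fair_mixture: "real_distribution (fair_mixture P Q)"
    and integral_fair_mixture: "\<And>\<phi> :: real \<Rightarrow> 'b :: {banach, second_countable_topology}.
      \<phi> \<in> borel_measurable borel \<Longrightarrow> (\<And>x. norm (\<phi> x) \<le> 1) \<Longrightarrow>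
      (LINT x|fair_mixture P Q. \<phi> x) = (1 / 2) *\<^sub>R ((LINT x|P. \<phi> x) + (LINT x|Q. \<phi> x))"
proof -
  interpret P: real_distribution P by fact
  interpret Q: real_distribution Q by fact
  interpret PQ: pair_prob_space P Q ..
  let ?K = "measure_pmf (bernoulli_pmf (1 / 2))"
  interpret K: prob_space ?K by (rule prob_space_measure_pmf)
  interpret KPQ: pair_prob_space ?K "P \<Otimes>\<^sub>M Q" ..
  let ?h = "\<lambda>z::bool \<times> real \<times> real. if fst z then fst (snd z) else snd (snd z)"
  have h [measurable]: "?h \<in> borel_measurable (?K \<Otimes>\<^sub>M (P \<Otimes>\<^sub>M Q))"
    by measurable
  show "real_distribution (fair_mixture P Q)"
    unfolding fair_mixture_def using h by (rule KPQ.real_distribution_distr)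
  fix \<phi> :: "real \<Rightarrow> 'b" assume [measurable]: "\<phi> \<in> borel_measurable borel" and b: "\<And>x. norm (\<phi> x) \<le> 1"
  have "(LINT x|fair_mixture P Q. \<phi> x) = (LINT z|(?K \<Otimes>\<^sub>M (P \<Otimes>\<^sub>M Q)). \<phi> (?h z))"
    unfolding fair_mixture_def by (subst integral_distr) auto
  also have "\<dots> = (LINT c|?K. LINT z|(P \<Otimes>\<^sub>M Q). \<phi> (?h (c, z)))"
    by (rule KPQ.integral_fst'[symmetric], rule KPQ.integrable_const_bound[where B = 1]) (use b in auto)
  also have "\<dots> = (1 / 2) *\<^sub>R ((LINT z|(P \<Otimes>\<^sub>M Q). \<phi> (fst z)) + (LINT z|(P \<Otimes>\<^sub>M Q). \<phi> (snd z)))"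
    by (subst integral_measure_pmf[of UNIV]) (auto simp: UNIV_bool scaleR_add_right add.commute)
  also have "(LINT z|(P \<Otimes>\<^sub>M Q). \<phi> (fst z)) = (LINT x|P. \<phi> x)"
    by (subst (2) Q.distr_pair_fst[of P, symmetric], subst integral_distr) auto
  also have "(LINT z|(P \<Otimes>\<^sub>M Q). \<phi> (snd z)) = (LINT x|Q. \<phi> x)"
    using PQ.integral_fst'[OF PQ.integrable_const_bound[where B = 1 and f = "\<lambda>z. \<phi> (snd z)"]] b P.prob_space
    by simp
  finally show "(LINT x|fair_mixture P Q. \<phi> x) = (1 / 2) *\<^sub>R ((LINT x|P. \<phi> x) + (LINT x|Q. \<phi> x))" .
qed

text \<open>Uniqueness for the signed measures \<open>P - Q\<close> and \<open>Q' - P'\<close>,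
  rearranged so that both sides are sums of probability measures. Half of each side is a mixture, to
  which Levy's theorem applies.\<close>

lemma measure_sum_eq_if_char_sum_eq:
  assumes P: "real_distribution P" "real_distribution P'" and Q: "real_distribution Q" "real_distribution Q'"
    and eq: "\<And>t. char P t + char P' t = char Q t + char Q' t" and A: "A \<in> sets borel"
  shows "measure P A + measure P' A = measure Q A + measure Q' A"
proof -
  have char: "char (fair_mixture R R') t = (1 / 2) *\<^sub>R (char R t + char R' t)"
    if "real_distribution R" "real_distribution R'" for R R' t
    unfolding char_def by (rule integral_fair_mixture[OF that]) auto
  have mix: "measure (fair_mixture R R') A = (measure R A + measure R' A) / 2"
    if R: "real_distribution R" "real_distribution R'" for R R'
  proof -
    interpret R: real_distribution R by fact
    interpret R': real_distribution R' by fact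
    interpret RR': real_distribution "fair_mixture R R'" by (rule real_distribution_fair_mixture[OF R])
    have "(LINT x|fair_mixture R R'. indicator A x :: real) = (1 / 2) *\<^sub>R ((LINT x|R. indicator A x) + (LINT x|R'. indicator A x))"
      using A by (intro integral_fair_mixture[OF R]) (auto simp: indicator_def)
    then show ?thesis using A by (simp add: RR'.emeasure_eq_measure)
  qed
  have "fair_mixture P P' = fair_mixture Q Q'"
    by (intro Levy_uniqueness real_distribution_fair_mixture P Q ext) (simp add: char P Q eq)
  then show ?thesis using mix[OF P] mix[OF Q] by simp
qed

lemma integral_gauss: "0 < b \<Longrightarrow> (\<integral>\<^sup>+y. ennreal (gauss b (y - x)) \<partial>lborel) = 1"
proof -
  assume b: "0 < b"
  define \<sigma> where "\<sigma> = 1 / sqrt (2 * b)"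
  have \<sigma>: "0 < \<sigma>" "1 / (2 * \<sigma>\<^sup>2) = b" using b by (auto simp: \<sigma>_def power_divide)
  interpret N: prob_space "density lborel (normal_density x \<sigma>)" by (rule prob_space_normal_density[OF \<sigma>(1)])
  have "normal_density x \<sigma> y = gauss b (y - x)" for y
    using gauss_eq_normal_density[OF \<sigma>(1), of "y - x"] by (simp add: \<sigma>(2) normal_density_def)
  then show ?thesis using N.emeasure_space_1 by (simp add: emeasure_density)
qed

lemma integral_iexp_gauss:
  assumes b: "0 < b"
  shows "(CLINT y|lborel. iexp (\<theta> * y) * of_real (gauss b (y - x))) = iexp (\<theta> * x) * of_real (exp (- \<theta>\<^sup>2 / (4 * b)))"
proof -
  define \<sigma> where "\<sigma> = 1 / sqrt (2 * b)"
  have \<sigma>: "0 < \<sigma>" "1 / (2 * \<sigma>\<^sup>2) = b" "\<sigma>\<^sup>2 = 1 / (2 * b)" using b by (auto simp: \<sigma>_def power_divide)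
  have g: "\<sigma> * gauss b (\<sigma> * z) = std_normal_density z" for z
    using gauss_eq_normal_density[OF \<sigma>(1), of "\<sigma> * z"] \<sigma>(1)
    by (simp add: \<sigma>(2) normal_density_def real_sqrt_mult power_mult_distrib)
  have "(CLINT y|lborel. iexp (\<theta> * y) * of_real (gauss b (y - x))) =
      \<bar>\<sigma>\<bar> *\<^sub>R (CLINT z|lborel. iexp (\<theta> * (x + \<sigma> * z)) * of_real (gauss b (x + \<sigma> * z - x)))"
    using \<sigma>(1) by (intro lborel_integral_real_affine) auto
  also have "\<dots> = (CLINT z|lborel. iexp (\<theta> * x) * (std_normal_density z *\<^sub>R iexp (\<theta> * \<sigma> * z)))"
    unfolding integral_scaleR_right[symmetric] using \<sigma>(1)
    by (intro Bochner_Integration.integral_cong)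
       (auto simp: g[symmetric] scaleR_conv_of_real algebra_simps exp_add)
  also have "\<dots> = iexp (\<theta> * x) * (CLINT z|lborel. std_normal_density z *\<^sub>R iexp (\<theta> * \<sigma> * z))"
    by (rule integral_mult_right_zero)
  also have "(CLINT z|lborel. std_normal_density z *\<^sub>R iexp (\<theta> * \<sigma> * z)) = char std_normal_distribution (\<theta> * \<sigma>)"
    unfolding char_def by (subst integral_density) auto
  also have "\<dots> = of_real (exp (- \<theta>\<^sup>2 / (4 * b)))"
    unfolding char_std_normal_distribution by (simp add: power_mult_distrib \<sigma>(3))
  finally show ?thesis .
qed

section \<open>Gaussian smoothing and the reflection formula\<close>

context prob_space
begin

text \<open>\<open>\<nu>\<close> is the law of \<open>Z\<close> plus an independent centred Gaussian
  variable of variance \<open>1 / (2 * b)\<close>. Writing it as a density avoids enlarging the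
  probability space; Fubini's theorem yields the product of characteristic functions.\<close>

lemma gaussian_smoothing:
  assumes [measurable]: "random_variable borel Z" and b: "0 < b"
  defines "\<nu> \<equiv> density lborel (\<lambda>y. ennreal (expectation (\<lambda>\<omega>. gauss b (y - Z \<omega>))))"
  shows gaussian_smoothing_distribution: "real_distribution \<nu>"
    and gaussian_smoothing_char: "char \<nu> \<theta> = expectation (\<lambda>\<omega>. iexp (\<theta> * Z \<omega>)) * of_real (exp (- \<theta>\<^sup>2 / (4 * b)))"
    and gaussian_smoothing_measure: "A \<in> sets borel \<Longrightarrow>
      measure \<nu> A = (LINT y|lborel. indicator A y * expectation (\<lambda>\<omega>. gauss b (y - Z \<omega>)))"
    and gauss_diff_integrable: "integrable M (\<lambda>\<omega>. gauss b (y - Z \<omega>))"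
    and gaussian_smoothing_integrable: "integrable lborel (\<lambda>y. expectation (\<lambda>\<omega>. gauss b (y - Z \<omega>)))"
proof -
  interpret L: pair_sigma_finite lborel M ..
  let ?h = "\<lambda>y. expectation (\<lambda>\<omega>. gauss b (y - Z \<omega>))"
  have gb: "\<bar>gauss b v\<bar> \<le> sqrt (b / pi)" for v
  proof -
    have "sqrt (b / pi) * exp (- b * v\<^sup>2) \<le> sqrt (b / pi) * 1"
      using b by (intro mult_left_mono) auto
    then show ?thesis using b by (simp add: gauss_def abs_mult)
  qed
  show int: "integrable M (\<lambda>\<omega>. gauss b (y - Z \<omega>))" for y
    by (rule integrable_const_bound[where B = "sqrt (b / pi)"]) (use gb in auto)
  have h0: "0 \<le> ?h y" for y using b by (intro integral_nonneg_AE) (simp add: gauss_nonneg)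
  have [measurable]: "?h \<in> borel_measurable lborel" by measurable
  have en: "ennreal (?h y) = (\<integral>\<^sup>+\<omega>. gauss b (y - Z \<omega>) \<partial>M)" for y
    using b by (intro nn_integral_eq_integral[symmetric] int) (simp add: gauss_nonneg)
  have tot: "(\<integral>\<^sup>+y. ennreal (?h y) \<partial>lborel) = 1"
  proof -
    have "(\<integral>\<^sup>+y. ennreal (?h y) \<partial>lborel) = (\<integral>\<^sup>+\<omega>. \<integral>\<^sup>+y. gauss b (y - Z \<omega>) \<partial>lborel \<partial>M)"
      unfolding en by (rule L.Fubini'[symmetric]) measurable
    then show ?thesis by (simp add: integral_gauss[OF b] emeasure_space_1)
  qed
  show "integrable lborel ?h"
    using tot h0 by (intro integrableI_nonneg) auto
  show \<nu>: "real_distribution \<nu>"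
    unfolding real_distribution_def real_distribution_axioms_def \<nu>_def
    using tot by (auto intro!: prob_spaceI simp: emeasure_density)
  interpret \<nu>: real_distribution \<nu> by (rule \<nu>)
  show "measure \<nu> A = (LINT y|lborel. indicator A y * ?h y)" if A: "A \<in> sets borel"
  proof -
    have "measure \<nu> A = (LINT y|\<nu>. indicator A y)" using A by (simp add: \<nu>.emeasure_eq_measure)
    also have "\<dots> = (LINT y|lborel. ?h y * indicator A y)"
      unfolding \<nu>_def using A h0 by (subst integral_density) auto
    finally show ?thesis by (simp add: mult.commute)
  qed
  have pint: "integrable (lborel \<Otimes>\<^sub>M M) (\<lambda>(y, \<omega>). iexp (\<theta> * y) * of_real (gauss b (y - Z \<omega>)))"
  proof (rule integrableI_bounded)
    have "(\<integral>\<^sup>+z. norm (case z of (y, \<omega>) \<Rightarrow> iexp (\<theta> * y) * of_real (gauss b (y - Z \<omega>))) \<partial>(lborel \<Otimes>\<^sub>M M)) =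
        (\<integral>\<^sup>+z. (case z of (y, \<omega>) \<Rightarrow> ennreal (gauss b (y - Z \<omega>))) \<partial>(lborel \<Otimes>\<^sub>M M))"
      using b by (intro nn_integral_cong) (auto simp: norm_mult gauss_nonneg)
    also have "\<dots> = (\<integral>\<^sup>+y. \<integral>\<^sup>+\<omega>. gauss b (y - Z \<omega>) \<partial>M \<partial>lborel)"
      by (subst nn_integral_fst[symmetric]) auto
    also have "\<dots> = 1" using tot by (simp add: en)
    finally show "(\<integral>\<^sup>+z. norm (case z of (y, \<omega>) \<Rightarrow> iexp (\<theta> * y) * of_real (gauss b (y - Z \<omega>))) \<partial>(lborel \<Otimes>\<^sub>M M)) < \<infinity>"
      by simp
  qed measurable
  have "char \<nu> \<theta> = (CLINT y|lborel. ?h y *\<^sub>R iexp (\<theta> * y))"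
    unfolding char_def \<nu>_def using h0 by (subst integral_density) auto
  also have "\<dots> = (CLINT y|lborel. CLINT \<omega>|M. iexp (\<theta> * y) * of_real (gauss b (y - Z \<omega>)))"
    by (intro Bochner_Integration.integral_cong refl)
       (simp add: scaleR_conv_of_real mult.commute integral_complex_of_real)
  also have "\<dots> = (CLINT \<omega>|M. CLINT y|lborel. iexp (\<theta> * y) * of_real (gauss b (y - Z \<omega>)))"
    by (rule L.Fubini_integral[OF pint, symmetric])
  also have "\<dots> = (CLINT \<omega>|M. iexp (\<theta> * Z \<omega>) * of_real (exp (- \<theta>\<^sup>2 / (4 * b))))"
    by (simp only: integral_iexp_gauss[OF b])
  finally show "char \<nu> \<theta> = expectation (\<lambda>\<omega>. iexp (\<theta> * Z \<omega>)) * of_real (exp (- \<theta>\<^sup>2 / (4 * b)))"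
    by simp
qed

text \<open>Subtracting the mirror image cancels the cosine, which is how a sine transform becomes a
  difference of characteristic functions.\<close>

lemma iexp_expectation_diff:
  assumes [measurable]: "random_variable borel Z"
  shows "expectation (\<lambda>\<omega>. iexp (\<theta> * Z \<omega>)) - expectation (\<lambda>\<omega>. iexp (\<theta> * - Z \<omega>)) = 2 * \<i> * of_real (expectation (\<lambda>\<omega>. sin (\<theta> * Z \<omega>)))"
proof -
  have "expectation (\<lambda>\<omega>. iexp (\<theta> * Z \<omega>)) - expectation (\<lambda>\<omega>. iexp (\<theta> * - Z \<omega>)) =
      expectation (\<lambda>\<omega>. iexp (\<theta> * Z \<omega>) - iexp (\<theta> * - Z \<omega>))"
    by (intro Bochner_Integration.integral_diff[symmetric] integrable_const_bound[where B = 1]) auto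
  also have "\<dots> = expectation (\<lambda>\<omega>. 2 * \<i> * of_real (sin (\<theta> * Z \<omega>)))"
    by (intro Bochner_Integration.integral_cong refl) (simp add: complex_eq_iff Re_exp Im_exp)
  finally show ?thesis by (simp add: integral_complex_of_real)
qed

end

text \<open>By \<open>sine_survival\<close> the killed law minus its mirror image has the same
  characteristic function as the smoothed law of \<open>c * B 0\<close> minus that of
  \<open>- c * B 0\<close>. On a set of positive numbers the mirror image has no mass, and what
  remains is the reflection formula.\<close>

lemma (in brownian_motion) killed_law:
  assumes a: "0 < a" and T: "0 < T" and ou: "ornstein_uhlenbeck M a B X"
    and pos: "AE \<omega> in M. 0 \<le> B 0 \<omega>" and A: "A \<in> sets borel" "A \<subseteq> {0<..}"
  defines "c \<equiv> exp (- a * T)"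
  defines "b \<equiv> a / (1 - c\<^sup>2)"
  shows "prob {\<omega> \<in> space M. X T \<omega> \<in> A \<and> (\<forall>s\<in>{0..T}. 0 < X s \<omega>)} =
    (LINT y|lborel. indicator A y * expectation (\<lambda>\<omega>. gauss b (y - c * B 0 \<omega>) - gauss b (y + c * B 0 \<omega>)))"
proof -
  define W where "W = {\<omega> \<in> space M. \<forall>s\<in>{0..T}. 0 < X s \<omega>}"
  have [measurable]: "W \<in> sets M"
    unfolding W_def using ou T
    by (intro positive_on_interval_measurable) (auto simp: ornstein_uhlenbeck_def)
  have [measurable]: "X T \<in> borel_measurable M" using ou T by (simp add: ornstein_uhlenbeck_def)
  have [measurable]: "B 0 \<in> borel_measurable M" using random_variable_B[of 0] by simp
  have c: "0 < c" "c < 1" using a T by (auto simp: c_def)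
  then have c2: "c\<^sup>2 < 1" by (simp add: power_less_one_iff abs_square_less_1)
  then have b: "0 < b" using a by (simp add: b_def)
  \<comment> \<open>Killed paths are sent to \<open>0\<close>, where the sine vanishes and which
    lies outside \<open>A\<close>.\<close>
  define V where "V \<omega> = X T \<omega> * indicator W \<omega>" for \<omega>
  have [measurable]: "V \<in> borel_measurable M" unfolding V_def[abs_def] by measurable
  let ?\<nu> = "\<lambda>Z. density lborel (\<lambda>y. ennreal (expectation (\<lambda>\<omega>. gauss b (y - Z \<omega>))))"
  let ?P = "distr M borel V" and ?P' = "?\<nu> (\<lambda>\<omega>. - (c * B 0 \<omega>))" and ?Q = "distr M borel (\<lambda>\<omega>. - V \<omega>)" and ?Q' = "?\<nu> (\<lambda>\<omega>. c * B 0 \<omega>)"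
  have m1: "random_variable borel (\<lambda>\<omega>. - (c * B 0 \<omega>))" and m2: "random_variable borel (\<lambda>\<omega>. c * B 0 \<omega>)" by auto
  have "measure ?P A + measure ?P' A = measure ?Q A + measure ?Q' A"
  proof (rule measure_sum_eq_if_char_sum_eq)
    show "real_distribution ?P" "real_distribution ?Q" by auto
    show "real_distribution ?P'" by (rule gaussian_smoothing_distribution[OF m1 b])
    show "real_distribution ?Q'" by (rule gaussian_smoothing_distribution[OF m2 b])
    fix t :: real
    have "char ?P t - char ?Q t = 2 * \<i> * of_real (expectation (\<lambda>\<omega>. sin (t * V \<omega>)))"
      using iexp_expectation_diff[of V t] by (simp add: char_def integral_distr)
    also have "expectation (\<lambda>\<omega>. sin (t * V \<omega>)) = expectation (\<lambda>\<omega>. sin (t * c * (exp (a * T) * X T \<omega>)) * indicator W \<omega>)"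
    proof (intro Bochner_Integration.integral_cong refl)
      fix \<omega>
      have "c * exp (a * T) = 1" by (simp add: c_def flip: exp_add)
      moreover have "t * c * (exp (a * T) * X T \<omega>) = t * (c * exp (a * T)) * X T \<omega>" by (simp only: mult_ac)
      ultimately have "t * c * (exp (a * T) * X T \<omega>) = t * X T \<omega>" by (simp only: mult_1_right)
      then have "sin (t * c * (exp (a * T) * X T \<omega>)) = sin (t * X T \<omega>)" by (rule arg_cong)
      then show "sin (t * V \<omega>) = sin (t * c * (exp (a * T) * X T \<omega>)) * indicator W \<omega>"
        by (simp add: V_def indicator_def)
    qed
    also have "\<dots> = exp (- ((t * c)\<^sup>2 / 2 * ((exp (2 * a * T) - 1) / (2 * a)))) * expectation (\<lambda>\<omega>. sin (t * c * B 0 \<omega>))"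
      unfolding W_def by (rule sine_survival[OF a T ou pos])
    \<comment> \<open>Rescaling by \<open>c\<close> changes the accumulated variance into
      \<open>(1 - c\<^sup>2) / (2 * a) = 1 / (2 * b)\<close>; this is where \<open>b\<close> comes
      from.\<close>
    also have "- ((t * c)\<^sup>2 / 2 * ((exp (2 * a * T) - 1) / (2 * a))) = - t\<^sup>2 / (4 * b)"
    proof -
      have "c\<^sup>2 * exp (2 * a * T) = 1" by (simp add: c_def exp_double[symmetric] flip: exp_add)
      then have "c\<^sup>2 * (exp (2 * a * T) - 1) = 1 - c\<^sup>2" by (simp add: right_diff_distrib)
      moreover have "(t * c)\<^sup>2 / 2 * ((exp (2 * a * T) - 1) / (2 * a)) = t\<^sup>2 * (c\<^sup>2 * (exp (2 * a * T) - 1)) / (4 * a)"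
        by (simp add: power_mult_distrib)
      ultimately show ?thesis by (simp add: b_def)
    qed
    finally have 1: "char ?P t - char ?Q t = 2 * \<i> * of_real (exp (- t\<^sup>2 / (4 * b)) * expectation (\<lambda>\<omega>. sin (t * c * B 0 \<omega>)))" .
    have "char ?Q' t - char ?P' t = (expectation (\<lambda>\<omega>. iexp (t * (c * B 0 \<omega>))) - expectation (\<lambda>\<omega>. iexp (t * - (c * B 0 \<omega>)))) * of_real (exp (- t\<^sup>2 / (4 * b)))"
      by (simp only: gaussian_smoothing_char[OF m1 b] gaussian_smoothing_char[OF m2 b] left_diff_distrib)
    also have "\<dots> = char ?P t - char ?Q t"
      unfolding 1 iexp_expectation_diff[OF m2] by (simp add: mult_ac)
    finally show "char ?P t + char ?P' t = char ?Q t + char ?Q' t" by (simp add: algebra_simps)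
  qed fact
  moreover have "measure ?Q A = 0"
  proof -
    have "0 \<le> V \<omega>" for \<omega>
      using T by (cases "\<omega> \<in> W") (auto simp: V_def W_def less_imp_le)
    then have "- V \<omega> \<notin> A" if "\<omega> \<in> space M" for \<omega>
      using A(2) by (metis greaterThan_iff neg_0_less_iff_less not_le subsetD)
    then have "(\<lambda>\<omega>. - V \<omega>) -` A \<inter> space M = {}" by auto
    then show ?thesis using A by (simp add: measure_distr)
  qed
  moreover have "measure ?P A = prob {\<omega> \<in> space M. X T \<omega> \<in> A \<and> (\<forall>s\<in>{0..T}. 0 < X s \<omega>)}"
  proof -
    have "0 \<notin> A" using A by auto
    then have "V -` A \<inter> space M = {\<omega> \<in> space M. X T \<omega> \<in> A \<and> (\<forall>s\<in>{0..T}. 0 < X s \<omega>)}"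
    proof (intro set_eqI)
      fix \<omega>
      have "\<omega> \<in> W \<longleftrightarrow> \<omega> \<in> space M \<and> (\<forall>s\<in>{0..T}. 0 < X s \<omega>)" by (simp add: W_def)
      then show "\<omega> \<in> V -` A \<inter> space M \<longleftrightarrow> \<omega> \<in> {\<omega> \<in> space M. X T \<omega> \<in> A \<and> (\<forall>s\<in>{0..T}. 0 < X s \<omega>)}"
        using \<open>0 \<notin> A\<close> by (cases "\<omega> \<in> W") (auto simp: V_def)
    qed
    then show ?thesis using A by (simp add: measure_distr)
  qed
  ultimately have "prob {\<omega> \<in> space M. X T \<omega> \<in> A \<and> (\<forall>s\<in>{0..T}. 0 < X s \<omega>)} = measure ?Q' A - measure ?P' A"
    by simp
  also have "\<dots> = (LINT y|lborel. indicator A y * expectation (\<lambda>\<omega>. gauss b (y - c * B 0 \<omega>))) -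
      (LINT y|lborel. indicator A y * expectation (\<lambda>\<omega>. gauss b (y - - (c * B 0 \<omega>))))"
    by (simp only: gaussian_smoothing_measure[OF m1 b A(1)] gaussian_smoothing_measure[OF m2 b A(1)])
  also have "\<dots> = (LINT y|lborel. indicator A y * expectation (\<lambda>\<omega>. gauss b (y - c * B 0 \<omega>)) -
      indicator A y * expectation (\<lambda>\<omega>. gauss b (y - - (c * B 0 \<omega>))))"
    using integrable_mult_indicator[OF _ gaussian_smoothing_integrable[OF m1 b], of A]
      integrable_mult_indicator[OF _ gaussian_smoothing_integrable[OF m2 b], of A] A
    by (intro Bochner_Integration.integral_diff[symmetric]) simp_all
  also have "\<dots> = (LINT y|lborel. indicator A y * expectation (\<lambda>\<omega>. gauss b (y - c * B 0 \<omega>) - gauss b (y + c * B 0 \<omega>)))"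
  proof (intro Bochner_Integration.integral_cong refl)
    fix y
    from gauss_diff_integrable[OF m1 b] gauss_diff_integrable[OF m2 b]
    show "indicator A y * expectation (\<lambda>\<omega>. gauss b (y - c * B 0 \<omega>)) - indicator A y * expectation (\<lambda>\<omega>. gauss b (y - - (c * B 0 \<omega>)))
      = indicator A y * expectation (\<lambda>\<omega>. gauss b (y - c * B 0 \<omega>) - gauss b (y + c * B 0 \<omega>))"
      by (simp add: right_diff_distrib)
  qed
  finally show ?thesis .
qed

section \<open>Convergence to the quasi-stationary distribution\<close>

text \<open>Partial integration by Fubini: \<open>k (Z \<omega>)\<close> is the integral of
  \<open>k'\<close> over \<open>0 < z < Z \<omega>\<close>, and \<open>k 0 = 0\<close> removes the
  boundary term. The law of \<open>Z\<close> enters only through its tail.\<close>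

lemma (in prob_space) expectation_layer_cake:
  fixes k k' :: "real \<Rightarrow> real"
  assumes [measurable]: "random_variable borel Z" and pos: "AE \<omega> in M. 0 \<le> Z \<omega>"
    and k: "\<And>x. (k has_real_derivative k' x) (at x)" "k 0 = 0" and cont: "\<And>x. isCont k' x"
    and int: "integrable lborel k'"
  shows "expectation (\<lambda>\<omega>. k (Z \<omega>)) = (LINT z|lborel. indicator {0<..} z * prob {\<omega> \<in> space M. z < Z \<omega>} * k' z)"
proof -
  interpret L: pair_sigma_finite lborel M ..
  have [measurable]: "k' \<in> borel_measurable borel" using int by simp
  let ?g = "\<lambda>z \<omega>. indicator {0<..} z * (if z < Z \<omega> then 1 else 0) * k' z :: real"
  have inner: "expectation (\<lambda>\<omega>. ?g z \<omega>) = indicator {0<..} z * prob {\<omega> \<in> space M. z < Z \<omega>} * k' z" for z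
  proof -
    have "expectation (\<lambda>\<omega>. if z < Z \<omega> then 1 else 0) = expectation (\<lambda>\<omega>. indicator {\<omega> \<in> space M. z < Z \<omega>} \<omega>)"
      by (intro Bochner_Integration.integral_cong) auto
    also have "\<dots> = prob {\<omega> \<in> space M. z < Z \<omega>}" by simp
    finally show ?thesis by simp
  qed
  have bound: "norm (?g z \<omega>) \<le> norm (k' z)" for z \<omega> by (simp add: abs_mult indicator_def)
  have intz: "integrable M (\<lambda>\<omega>. ?g z \<omega>)" for z
    by (rule integrable_const_bound[where B = "norm (k' z)"]) (use bound in auto)
  have pint: "integrable (lborel \<Otimes>\<^sub>M M) (\<lambda>(z, \<omega>). ?g z \<omega>)"
  proof (rule L.Fubini_integrable)
    show "integrable lborel (\<lambda>z. LINT \<omega>|M. norm (case (z, \<omega>) of (z, \<omega>) \<Rightarrow> ?g z \<omega>))"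
    proof (rule Bochner_Integration.integrable_bound[OF int])
      show "AE z in lborel. norm (LINT \<omega>|M. norm (case (z, \<omega>) of (z, \<omega>) \<Rightarrow> ?g z \<omega>)) \<le> norm (k' z)"
      proof (rule AE_I2)
        fix z
        have "(LINT \<omega>|M. norm (?g z \<omega>)) \<le> (LINT \<omega>|M. norm (k' z))"
          using intz[of z] bound by (intro integral_mono) auto
        then show "norm (LINT \<omega>|M. norm (case (z, \<omega>) of (z, \<omega>) \<Rightarrow> ?g z \<omega>)) \<le> norm (k' z)"
          by (simp add: prob_space integral_nonneg_AE)
      qed
    qed measurable
  qed (use intz in auto)
  have "expectation (\<lambda>\<omega>. k (Z \<omega>)) = expectation (\<lambda>\<omega>. LINT z|lborel. ?g z \<omega>)"
  proof (rule integral_cong_AE)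
    have km: "k \<in> borel_measurable borel"
      using k(1) by (intro borel_measurable_continuous_onI continuous_at_imp_continuous_on ballI DERIV_isCont)
    then show "(\<lambda>\<omega>. k (Z \<omega>)) \<in> borel_measurable M" by measurable
    show "AE \<omega> in M. k (Z \<omega>) = (LINT z|lborel. ?g z \<omega>)"
      using pos
    proof eventually_elim
      case (elim \<omega>)
      have "k (Z \<omega>) = k (Z \<omega>) - k 0" using k by simp
      also have "\<dots> = (LINT z|lborel. indicator {0..Z \<omega>} z *\<^sub>R k' z)"
        using k cont elim
        by (intro integral_FTC_Icc[symmetric] continuous_at_imp_continuous_on ballI)
           (auto simp: has_real_derivative_iff_has_vector_derivative[symmetric] intro: DERIV_subset)
      also have "\<dots> = (LINT z|lborel. ?g z \<omega>)"
      proof (rule integral_cong_AE)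
        show "AE z in lborel. indicator {0..Z \<omega>} z *\<^sub>R k' z = ?g z \<omega>"
          using AE_lborel_singleton[of 0] AE_lborel_singleton[of "Z \<omega>"]
          by eventually_elim (auto simp: indicator_def)
      qed measurable
      finally show ?case .
    qed
  qed measurable
  also have "\<dots> = (LINT z|lborel. expectation (\<lambda>\<omega>. ?g z \<omega>))"
    by (rule L.Fubini_integral[OF pint])
  finally show ?thesis by (simp only: inner)
qed

lemma no_zero_iff_constant_sign:
  fixes x :: "real \<Rightarrow> real"
  assumes cont: "continuous_on {0..t} x" and t: "0 \<le> t"
  shows "(\<forall>s\<in>{0..t}. x s \<noteq> 0) \<longleftrightarrow> (\<forall>s\<in>{0..t}. 0 < x s) \<or> (\<forall>s\<in>{0..t}. 0 < - x s)"
proof -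
  have pos: "\<forall>s\<in>{0..t}. 0 < y s" if y: "continuous_on {0..t} y" "\<forall>s\<in>{0..t}. y s \<noteq> 0" "0 < y 0" for y :: "real \<Rightarrow> real"
  proof (rule ccontr)
    assume "\<not> (\<forall>s\<in>{0..t}. 0 < y s)"
    then obtain s where s: "s \<in> {0..t}" "y s \<le> 0" by force
    have "continuous_on {0..s} y" using y(1) s by (auto intro: continuous_on_subset)
    from IVT2'[OF s(2) less_imp_le[OF y(3)] _ this] s obtain u where "0 \<le> u" "u \<le> s" "y u = 0" by auto
    then show False using y(2) s by auto
  qed
  show ?thesis
  proof
    assume nz: "\<forall>s\<in>{0..t}. x s \<noteq> 0"
    then have "x 0 \<noteq> 0" using t by simp
    then consider "0 < x 0" | "0 < - x 0" by linarith
    then show "(\<forall>s\<in>{0..t}. 0 < x s) \<or> (\<forall>s\<in>{0..t}. 0 < - x s)"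
    proof cases
      case 1 then show ?thesis using pos[OF cont nz] by blast
    next
      case 2 then show ?thesis using pos[of "\<lambda>s. - x s"] cont nz by (auto intro!: continuous_intros)
    qed
  qed force
qed

section \<open>The killed law in terms of the initial tail\<close>

context brownian_motion
begin

definition initial_tail :: "real \<Rightarrow> real" where
  "initial_tail x = prob {\<omega> \<in> space M. x < B 0 \<omega>}"

definition scaled_tail :: "real \<Rightarrow> real \<Rightarrow> real" where
  "scaled_tail r z = indicator {0<..} z * initial_tail (r * z)"

lemma initial_tail_bounds: "0 \<le> initial_tail x" "initial_tail x \<le> 1"
  by (simp_all add: initial_tail_def)

lemma B0_measurable[measurable]: "B 0 \<in> borel_measurable M"
  using random_variable_B[of 0] by simp

lemma initial_tail_antimono: "antimono initial_tail"
  unfolding initial_tail_def by (intro antimonoI finite_measure_mono) auto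

text \<open>Before normalisation the trivial bound of probabilities by \<open>1\<close> suffices,
  with exponent \<open>0\<close>. The singular envelope enters only after division by
  \<open>initial_tail r\<close>, where uniformity in \<open>r\<close> is at stake.\<close>

lemma scaled_tail_weight: "gaussian_weight (scaled_tail r) 1 0"
proof
  have "initial_tail \<in> borel_measurable borel"
    using borel_measurable_mono[of "\<lambda>x. - initial_tail x"] initial_tail_antimono
    by (auto simp: mono_def antimono_def)
  then show "scaled_tail r \<in> borel_measurable borel" unfolding scaled_tail_def[abs_def] by measurable
  show "\<bar>scaled_tail r z\<bar> \<le> 1 * powr_weight 0 z" for z
    using initial_tail_bounds[of "r * z"] by (auto simp: scaled_tail_def powr_weight_def indicator_def)
qed auto

text \<open>The expectation also carries the sign: its integrand is non-negative because
  \<open>y\<close> is at least as close to a non-negative point as to its mirror image. In the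
  convolution this is invisible, since \<open>reflected_gauss_deriv\<close> takes both
  signs.\<close>

lemma killed_density_eq:
  assumes b: "0 < b" and c: "0 < c" and pos: "AE \<omega> in M. 0 \<le> B 0 \<omega>"
  shows "expectation (\<lambda>\<omega>. gauss b (y - c * B 0 \<omega>) - gauss b (y + c * B 0 \<omega>)) = reflected_convolution (scaled_tail (1 / c)) b y"
    and "0 \<le> y \<Longrightarrow> 0 \<le> reflected_convolution (scaled_tail (1 / c)) b y"
proof -
  have "integrable lborel (reflected_gauss_deriv b y)"
  proof (rule Bochner_Integration.integrable_bound)
    show "integrable lborel (\<lambda>z. 2 * gauss_const b * exp (b / 2 * y\<^sup>2) * exp (- (b / 4) * z\<^sup>2))"
      using b by (intro integrable_mult_right integrable_exp_minus_square) auto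
    show "AE z in lborel. norm (reflected_gauss_deriv b y z) \<le> norm (2 * gauss_const b * exp (b / 2 * y\<^sup>2) * exp (- (b / 4) * z\<^sup>2))"
      using reflected_gauss_deriv_bound[OF b order_refl, of y] b by (intro AE_I2) (simp add: order_trans[OF _ abs_ge_self])
  qed auto
  moreover have "isCont (reflected_gauss_deriv b y) z" for z
    unfolding reflected_gauss_deriv_def gauss_def by (intro continuous_intros)
  moreover have "AE \<omega> in M. 0 \<le> c * B 0 \<omega>" using pos by eventually_elim (use c in simp)
  ultimately have "expectation (\<lambda>\<omega>. gauss b (y - c * B 0 \<omega>) - gauss b (y + c * B 0 \<omega>)) =
      (LINT z|lborel. indicator {0<..} z * prob {\<omega> \<in> space M. z < c * B 0 \<omega>} * reflected_gauss_deriv b y z)"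
    by (intro expectation_layer_cake[where k = "\<lambda>z. gauss b (y - z) - gauss b (y + z)"] reflected_gauss_has_real_derivative) auto
  moreover have "{\<omega> \<in> space M. z < c * B 0 \<omega>} = {\<omega> \<in> space M. 1 / c * z < B 0 \<omega>}" for z
    using c by (auto simp: field_simps)
  ultimately show eq: "expectation (\<lambda>\<omega>. gauss b (y - c * B 0 \<omega>) - gauss b (y + c * B 0 \<omega>)) = reflected_convolution (scaled_tail (1 / c)) b y"
    by (simp add: reflected_convolution_def scaled_tail_def initial_tail_def)
  assume y: "0 \<le> y"
  show "0 \<le> reflected_convolution (scaled_tail (1 / c)) b y"
    unfolding eq[symmetric]
  proof (rule integral_nonneg_AE)
    show "AE \<omega> in M. 0 \<le> gauss b (y - c * B 0 \<omega>) - gauss b (y + c * B 0 \<omega>)"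
      using pos
    proof eventually_elim
      case (elim \<omega>)
      have "0 \<le> y * (c * B 0 \<omega>)" using elim y c by simp
      then have "(y - c * B 0 \<omega>)\<^sup>2 \<le> (y + c * B 0 \<omega>)\<^sup>2" by (simp add: power2_eq_square algebra_simps)
      then show ?case using b by (simp add: gauss_def mult_left_mono)
    qed
  qed
qed

lemma killed_process_law:
  assumes a: "0 < a" and T: "0 < T" and ou: "ornstein_uhlenbeck M a B X"
    and pos: "AE \<omega> in M. 0 \<le> B 0 \<omega>" and A: "A \<in> sets borel"
  shows "prob {\<omega> \<in> space M. X T \<omega> \<in> A \<and> ereal T < hitting_time_zero X \<omega>} =
    (LINT y|lborel. indicator A y * (indicator {0..} y * reflected_convolution (scaled_tail (exp (a * T))) (a / (1 - (exp (- a * T))\<^sup>2)) y))"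
proof -
  have X_meas: "\<And>t. 0 \<le> t \<Longrightarrow> X t \<in> borel_measurable M" using ou by (simp add: ornstein_uhlenbeck_def)
  have X_cont: "\<And>\<omega>. \<omega> \<in> space M \<Longrightarrow> continuous_on {0..} (\<lambda>t. X t \<omega>)" using ou by (simp add: ornstein_uhlenbeck_def)
  have X_contT: "continuous_on {0..T} (\<lambda>t. X t \<omega>)" if "\<omega> \<in> space M" for \<omega>
    using X_cont[OF that] by (rule continuous_on_subset) auto
  have [measurable]: "X T \<in> borel_measurable M" using X_meas T by simp
  have [measurable]: "A \<in> sets borel" by fact
  define W where "W = {\<omega> \<in> space M. \<forall>s\<in>{0..T}. 0 < X s \<omega>}"
  \<comment> \<open>The survival event is \<open>W \<union> W'\<close>, which shows that it is
    measurable. Almost surely \<open>B 0 \<omega> \<ge> 0\<close>, so \<open>W'\<close> is a null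
    set.\<close>
  define W' where "W' = {\<omega> \<in> space M. \<forall>s\<in>{0..T}. 0 < - X s \<omega>}"
  have [measurable]: "W \<in> sets M"
    unfolding W_def using X_meas X_cont T by (intro positive_on_interval_measurable) auto
  have [measurable]: "W' \<in> sets M"
    unfolding W'_def using X_meas X_cont T
    by (intro positive_on_interval_measurable[where Y = "\<lambda>s \<omega>. - X s \<omega>"]) (auto intro!: continuous_intros)
  have hit: "ereal T < hitting_time_zero X \<omega> \<longleftrightarrow> \<omega> \<in> W \<union> W'" if "\<omega> \<in> space M" for \<omega>
    using ereal_less_hitting_time_zero_iff[where X = X and t = T, OF X_cont[OF that]]
      no_zero_iff_constant_sign[OF X_contT[OF that]] T that by (simp add: W_def W'_def)
  have "0 < a * T" using a T by simp
  then have "(exp (- a * T))\<^sup>2 < 1" by (simp add: power_less_one_iff)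
  then have b: "0 < a / (1 - (exp (- a * T))\<^sup>2)" using a by simp
  let ?A = "A \<inter> {0<..}"
  let ?E = "{\<omega> \<in> space M. X T \<omega> \<in> ?A \<and> (\<forall>s\<in>{0..T}. 0 < X s \<omega>)}"
  let ?q = "reflected_convolution (scaled_tail (exp (a * T))) (a / (1 - (exp (- a * T))\<^sup>2))"
  have "prob {\<omega> \<in> space M. X T \<omega> \<in> A \<and> ereal T < hitting_time_zero X \<omega>} = prob ?E"
  proof (rule measure_eq_AE)
    have "{\<omega> \<in> space M. X T \<omega> \<in> A \<and> ereal T < hitting_time_zero X \<omega>} = {\<omega> \<in> space M. X T \<omega> \<in> A} \<inter> (W \<union> W')"
      using hit by auto
    then show "{\<omega> \<in> space M. X T \<omega> \<in> A \<and> ereal T < hitting_time_zero X \<omega>} \<in> sets M" by simp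
    have "?E = {\<omega> \<in> space M. X T \<omega> \<in> ?A} \<inter> W" by (auto simp: W_def)
    then show "?E \<in> sets M" by simp
    show "AE \<omega> in M. \<omega> \<in> {\<omega> \<in> space M. X T \<omega> \<in> A \<and> ereal T < hitting_time_zero X \<omega>} \<longleftrightarrow> \<omega> \<in> ?E"
      using pos AE_space
    proof eventually_elim
      case (elim \<omega>)
      have "X 0 \<omega> = B 0 \<omega>" using ou elim by (simp add: ornstein_uhlenbeck_def)
      then have "\<omega> \<notin> W'" using elim T by (auto simp: W'_def intro!: bexI[of _ 0])
      then show ?case using hit[OF elim(2)] elim(2) T by (auto simp: W_def)
    qed
  qed
  also have "\<dots> = (LINT y|lborel. indicator ?A y * expectation (\<lambda>\<omega>. gauss (a / (1 - (exp (- a * T))\<^sup>2)) (y - exp (- a * T) * B 0 \<omega>)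
       - gauss (a / (1 - (exp (- a * T))\<^sup>2)) (y + exp (- a * T) * B 0 \<omega>)))"
    by (rule killed_law[OF a T ou pos]) auto
  also have "\<dots> = (LINT y|lborel. indicator ?A y * ?q y)"
  proof -
    have "1 / exp (- a * T) = exp (a * T)" by (simp add: exp_minus divide_inverse)
    then show ?thesis using killed_density_eq(1)[OF b _ pos, of "exp (- a * T)"] by simp
  qed
  also have "\<dots> = (LINT y|lborel. indicator A y * (indicator {0..} y * ?q y))"
  proof (rule integral_cong_AE)
    interpret gaussian_weight "scaled_tail (exp (a * T))" 1 0 by (rule scaled_tail_weight)
    note [measurable] = reflected_convolution_measurable[OF b]
    show "(\<lambda>y. indicator ?A y * ?q y) \<in> borel_measurable lborel"
      "(\<lambda>y. indicator A y * (indicator {0..} y * ?q y)) \<in> borel_measurable lborel" by measurable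
    show "AE y in lborel. indicator ?A y * ?q y = indicator A y * (indicator {0..} y * ?q y)"
      using AE_lborel_singleton[of 0] by eventually_elim (auto simp: indicator_def)
  qed
  finally show ?thesis .
qed

end

text \<open>The eigenfunction is the convolution divided by \<open>2 * a * \<eta>\<close> times its
  total mass, so its integral is \<open>1 / (2 * a * \<eta>)\<close> and the normalised density is
  the convolution over its own mass.\<close>

lemma measure_quasi_stationary_distribution:
  assumes a: "0 < a" and \<eta>: "0 < \<eta>" "\<eta> < 1"
    and nonneg: "\<And>y. 0 \<le> y \<Longrightarrow> 0 \<le> reflected_convolution (power_tail \<eta>) a y"
    and A: "A \<in> sets (restrict_space borel {0..})"
  shows "measure (quasi_stationary_distribution a (a * \<eta>)) A =
    (LINT y|lborel. indicator A y * (indicator {0..} y * reflected_convolution (power_tail \<eta>) a y))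
      / symmetric_convolution (power_tail \<eta>) a 0"
proof -
  interpret gaussian_weight "power_tail \<eta>" 1 \<eta>
    using \<eta> by (intro gaussian_weight_power_tail) auto
  let ?q = "reflected_convolution (power_tail \<eta>) a" and ?U = "symmetric_convolution (power_tail \<eta>) a 0"
  note [measurable] = reflected_convolution_measurable[OF a]
  note U = eigenfunction_eq(2)[OF a \<eta>] and eig = eigenfunction_eq(1)[OF a \<eta>]
  have A': "A \<in> sets borel" "A \<subseteq> {0..}" using A by (auto simp: sets_restrict_space)
  have nn: "(\<integral>\<^sup>+y. ennreal (indicator {0..} y * ?q y) \<partial>lborel) = ennreal ?U"
  proof -
    have "(\<integral>\<^sup>+y. ennreal (indicator {0..} y * ?q y) \<partial>lborel) = (\<integral>\<^sup>+y. ennreal (?q y) * indicator {0..} y \<partial>lborel)"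
      by (intro nn_integral_cong) (auto simp: indicator_def)
    also have "\<dots> = ennreal ?U"
      by (rule nn_integral_reflected_convolution[OF a power_tail_tendsto_0[OF \<eta>(1)]]) (rule nonneg)
    finally show ?thesis .
  qed
  have tot: "(LINT y|lborel. indicator {0..} y * ?q y) = ?U"
    using nn nonneg U by (subst integral_eq_nn_integral) (auto simp: indicator_def)
  have int: "integrable lborel (\<lambda>y. indicator {0..} y * ?q y)"
    using nn nonneg by (intro integrableI_nonneg) (auto simp: indicator_def)
  have "(LINT y:{0..}|lborel. eigenfunction a (a * \<eta>) y) = (LINT y|lborel. (indicator {0..} y * ?q y) / (2 * a * \<eta> * ?U))"
    unfolding set_lebesgue_integral_def eig by simp
  also have "\<dots> = 1 / (2 * a * \<eta>)" using tot U a \<eta> by simp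
  finally have norm: "eigenfunction a (a * \<eta>) y / (LINT y:{0..}|lborel. eigenfunction a (a * \<eta>) y) = ?q y / ?U" for y
    using a \<eta> U by (simp add: eig)
  have "emeasure (quasi_stationary_distribution a (a * \<eta>)) A =
      (\<integral>\<^sup>+y. ennreal (?q y / ?U) * indicator A y \<partial>restrict_space lborel {0..})"
    unfolding quasi_stationary_distribution_def norm
    using A by (subst emeasure_density) (auto intro!: measurable_restrict_space1 simp: sets_restrict_space)
  also have "\<dots> = (\<integral>\<^sup>+y. ennreal (?q y / ?U) * indicator A y * indicator {0..} y \<partial>lborel)"
    by (rule nn_integral_restrict_space) auto
  also have "\<dots> = (\<integral>\<^sup>+y. ennreal (indicator A y * (indicator {0..} y * ?q y) / ?U) \<partial>lborel)"
    by (intro nn_integral_cong) (auto simp: indicator_def)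
  also have "\<dots> = ennreal (LINT y|lborel. indicator A y * (indicator {0..} y * ?q y) / ?U)"
  proof (rule nn_integral_eq_integral)
    show "integrable lborel (\<lambda>y. indicator A y * (indicator {0..} y * ?q y) / ?U)"
      using integrable_mult_indicator[OF _ int, of A] A' by simp
    show "AE y in lborel. 0 \<le> indicator A y * (indicator {0..} y * ?q y) / ?U"
      using nonneg U by (intro AE_I2) (auto simp: indicator_def)
  qed
  finally have "emeasure (quasi_stationary_distribution a (a * \<eta>)) A =
      ennreal (LINT y|lborel. indicator A y * (indicator {0..} y * ?q y) / ?U)" .
  moreover have "0 \<le> (LINT y|lborel. indicator A y * (indicator {0..} y * ?q y) / ?U)"
    using nonneg U by (intro integral_nonneg_AE AE_I2) (auto simp: indicator_def)
  ultimately show ?thesis by (simp add: measure_def)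
qed

text \<open>Convergence of the masses upgrades pointwise convergence to convergence in
  \<open>L1\<close>, so no majorant in \<open>y\<close> uniform in \<open>n\<close> has to be
  found.\<close>

lemma set_integral_tendsto_if_total_mass_tendsto:
  fixes F :: "nat \<Rightarrow> real \<Rightarrow> real"
  assumes F: "\<And>n. integrable lborel (F n)" "\<And>n y. 0 \<le> F n y" and f: "integrable lborel f" "\<And>y. 0 \<le> f y"
    and lim: "\<And>y. (\<lambda>n. F n y) \<longlonglongrightarrow> f y" and mass: "(\<lambda>n. LINT y|lborel. F n y) \<longlonglongrightarrow> (LINT y|lborel. f y)"
    and A: "A \<in> sets borel"
  shows "(\<lambda>n. LINT y|lborel. indicator A y * F n y) \<longlonglongrightarrow> (LINT y|lborel. indicator A y * f y)"
proof -
  have nn: "(\<integral>\<^sup>+y. norm (F n y) \<partial>lborel) = ennreal (LINT y|lborel. F n y)"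
    "(\<integral>\<^sup>+y. norm (f y) \<partial>lborel) = ennreal (LINT y|lborel. f y)" for n
    using F f by (simp_all add: nn_integral_eq_integral)
  have "limsup (\<lambda>n. \<integral>\<^sup>+y. norm (F n y) \<partial>lborel) = (\<integral>\<^sup>+y. norm (f y) \<partial>lborel)"
    unfolding nn by (intro lim_imp_Limsup tendsto_ennrealI mass) simp
  then have 0: "(\<lambda>n. \<integral>\<^sup>+y. norm (F n y - f y) \<partial>lborel) \<longlonglongrightarrow> 0"
    using F f lim by (intro Scheffe_lemma1) auto
  show ?thesis
  proof (rule tendsto_L1_int)
    show "integrable lborel (\<lambda>y. indicator A y * F n y)" for n
      using integrable_mult_indicator[OF _ F(1)[of n], of A] A by simp
    show "integrable lborel (\<lambda>y. indicator A y * f y)"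
      using integrable_mult_indicator[OF _ f(1), of A] A by simp
    show "(\<lambda>n. \<integral>\<^sup>+y. norm (indicator A y * F n y - indicator A y * f y) \<partial>lborel) \<longlonglongrightarrow> 0"
    proof (rule tendsto_sandwich[OF _ _ tendsto_const 0])
      show "\<forall>\<^sub>F n in sequentially. (\<integral>\<^sup>+y. norm (indicator A y * F n y - indicator A y * f y) \<partial>lborel) \<le> (\<integral>\<^sup>+y. norm (F n y - f y) \<partial>lborel)"
        by (intro always_eventually allI nn_integral_mono) (auto simp: indicator_def)
    qed simp
  qed
qed

theorem mainTheorem1:
  fixes a \<eta> :: real and f :: "real \<Rightarrow> real"
    and M :: "'a measure" and B X :: "real \<Rightarrow> 'a \<Rightarrow> real" and A :: "real set"
  assumes "0 < a" and "0 < \<eta>" and "\<eta> < 1"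
    and "density_function f"
    and "regularly_varying f (- (1 + \<eta>))"
    and "brownian_motion M B (halfline_distribution f)"
    and "ornstein_uhlenbeck M a B X"
    and "A \<in> sets (restrict_space borel {0..})"
  shows "((\<lambda>t. cond_prob M (\<lambda>\<omega>. X t \<omega> \<in> A) (\<lambda>\<omega>. ereal t < hitting_time_zero X \<omega>))
            \<longlongrightarrow> measure (quasi_stationary_distribution a (a * \<eta>)) A) at_top"
proof -
  interpret brownian_motion M B "halfline_distribution f" by fact
  note a = assms(1) and \<eta> = assms(2,3) and ou = assms(7)
  have A: "A \<in> sets borel" using assms(8) by (auto simp: sets_restrict_space)
  \<comment> \<open>Values of \<open>f\<close> at negative arguments are arbitrary; \<open>g\<close>
    replaces them by \<open>0\<close> so that integrals over the whole line apply.\<close>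
  define g where "g x = indicator {0..} x * f x" for x
  have g_meas [measurable]: "g \<in> borel_measurable borel"
    using assms(4) unfolding density_function_def g_def[abs_def]
    by (simp add: borel_measurable_restrict_space_iff)
  have g0: "0 \<le> g x" for x using assms(4) by (simp add: g_def density_function_def indicator_def)
  have g1: "(\<integral>\<^sup>+x. ennreal (g x) \<partial>lborel) = 1"
  proof -
    have "(\<integral>\<^sup>+x. ennreal (g x) \<partial>lborel) = (\<integral>\<^sup>+x\<in>{0..}. ennreal (f x) \<partial>lborel)"
      by (intro nn_integral_cong) (auto simp: g_def indicator_def)
    then show ?thesis using assms(4) by (simp add: density_function_def)
  qed
  have g_int: "integrable lborel g" using g0 g1 by (intro integrableI_nonneg) auto
  have law: "distr M borel (B 0) = density lborel g"
  proof -
    have "halfline_distribution f = density lborel g"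
      unfolding halfline_distribution_def
      by (intro arg_cong[where f = "density lborel"] ext) (auto simp: g_def indicator_def)
    then show ?thesis using initial_distribution by simp
  qed
  have pos: "AE \<omega> in M. 0 \<le> B 0 \<omega>"
  proof (rule AE_distrD[OF B0_measurable])
    show "AE x in distr M borel (B 0). 0 \<le> x"
    proof -
      have "AE x in lborel. 0 < ennreal (g x) \<longrightarrow> 0 \<le> x"
        by (intro AE_I2) (auto simp: g_def indicator_def)
      then show ?thesis unfolding law by (simp add: AE_density)
    qed
  qed
  have tail: "initial_tail x = (LINT u|lborel. g u * indicator {x<..} u)" for x
  proof -
    interpret D: prob_space "distr M borel (B 0)" by (rule prob_space_distr) simp
    have "initial_tail x = measure (distr M borel (B 0)) {x<..}"
      unfolding initial_tail_def by (subst measure_distr) (auto intro!: arg_cong[where f = prob])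
    also have "\<dots> = (LINT u|distr M borel (B 0). indicator {x<..} u)" by (simp add: D.emeasure_eq_measure)
    also have "\<dots> = (LINT u|lborel. g u * indicator {x<..} u)"
      unfolding law using g0 by (subst integral_density) auto
    finally show ?thesis .
  qed
  have rv: "((\<lambda>u. g (c * u) / g u) \<longlongrightarrow> c powr (- (1 + \<eta>))) at_top" if c: "0 < c" for c
  proof (rule Lim_transform_eventually)
    show "((\<lambda>u. f (c * u) / f u) \<longlongrightarrow> c powr (- (1 + \<eta>))) at_top"
      using assms(5) c by (simp add: regularly_varying_def)
    show "\<forall>\<^sub>F u in at_top. f (c * u) / f u = g (c * u) / g u"
      using eventually_ge_at_top[of 0] by eventually_elim (use c in \<open>simp add: g_def\<close>)
  qed
  have S_lim: "((\<lambda>x. initial_tail (c * x) / initial_tail x) \<longlongrightarrow> c powr (- \<eta>)) at_top" if c: "0 < c" for c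
    using regularly_varying_tail_integral(1)[OF g_int g0 rv[OF c] c] by (simp add: tail)
  have S_pos: "0 < initial_tail x" for x
    using regularly_varying_tail_integral(2)[OF g_int g0 rv[of 1], of x] by (simp add: tail)
  have S_0: "(initial_tail \<longlongrightarrow> 0) at_top"
  proof -
    have "((\<lambda>x. LINT u|lborel. g u * indicator {x<..} u) \<longlongrightarrow> (LINT u|(lborel :: real measure). 0)) at_top"
    proof (rule integral_dominated_convergence_at_top[where w = g])
      show "AE u in lborel. ((\<lambda>x. g u * indicator {x<..} u) \<longlongrightarrow> 0) at_top"
      proof (intro AE_I2 tendsto_eventually)
        fix u :: real show "\<forall>\<^sub>F x in at_top. g u * indicator {x<..} u = 0"
          using eventually_ge_at_top[of u] by eventually_elim simp
      qed
      show "\<forall>\<^sub>F x in at_top. AE u in lborel. norm (g u * indicator {x<..} u) \<le> g u"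
        using g0 by (intro always_eventually allI AE_I2) (simp add: indicator_def)
    qed (use g_int in auto)
    then show ?thesis unfolding tail[abs_def] by simp
  qed
  \<comment> \<open>The midpoint of \<open>\<eta>\<close> and \<open>1\<close>: above
    \<open>\<eta>\<close> for the doubling bound, below \<open>1\<close> for integrability at
    \<open>0\<close>.\<close>
  define \<kappa> where "\<kappa> = (1 + \<eta>) / 2"
  have \<kappa>: "\<eta> < \<kappa>" "0 \<le> \<kappa>" "\<kappa> < 1" using \<eta> by (auto simp: \<kappa>_def)
  obtain C0 r0 where C0: "0 < C0" "0 < r0" "\<And>r z. r0 \<le> r \<Longrightarrow> 0 < z \<Longrightarrow>
      initial_tail (r * z) / initial_tail r \<le> C0 * (1 + z powr (- \<kappa>))"
    using potter_bound[OF initial_tail_antimono S_pos initial_tail_bounds(2) _ \<kappa>(1,2)] S_lim[of "1 / 2"] by auto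
  define C where "C = max 1 C0"
  let ?v = "power_tail \<eta>" and ?q = "reflected_convolution (power_tail \<eta>) a" and ?U = "symmetric_convolution (power_tail \<eta>) a 0"
  have v: "gaussian_weight ?v C \<kappa>"
    using \<eta> \<kappa> by (intro gaussian_weight_power_tail) (auto simp: C_def)
  then interpret v: gaussian_weight ?v C \<kappa> .
  have U: "0 < ?U" by (rule eigenfunction_eq(2)[OF a \<eta>])
  show ?thesis
  \<comment> \<open>The limit lemmas for convolutions and for set integrals concern sequences, so
    time runs through an arbitrary sequence tending to infinity.\<close>
  proof (rule tendsto_at_topI_sequentially)
    fix t :: "nat \<Rightarrow> real" assume t: "filterlim t at_top sequentially"
    have ct0: "((\<lambda>t. (exp (- a * t))\<^sup>2) \<longlongrightarrow> 0) at_top"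
    proof -
      have "filterlim (\<lambda>t. - a * t) at_bot at_top"
        using a by (intro filterlim_tendsto_neg_mult_at_bot[OF tendsto_const _ filterlim_ident]) auto
      then have "((\<lambda>t. (exp (- a * t))\<^sup>2) \<longlongrightarrow> 0\<^sup>2) at_top"
        by (intro tendsto_power filterlim_compose[OF exp_at_bot])
      then show ?thesis by simp
    qed
    have r_top: "filterlim (\<lambda>t. exp (a * t)) at_top at_top"
      using a by (intro filterlim_compose[OF exp_at_top] filterlim_tendsto_pos_mult_at_top[OF tendsto_const _ filterlim_ident]) auto
    \<comment> \<open>Three requirements on the time: it is positive,
      \<open>r0 \<le> exp (a * s)\<close> makes the doubling bound available, and the bound
      \<open>1 / 2\<close> gives \<open>b n \<le> 2 * a\<close>.\<close>
    have "\<forall>\<^sub>F s in at_top. 0 < s \<and> r0 \<le> exp (a * s) \<and> (exp (- a * s))\<^sup>2 < 1 / 2"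
      using r_top order_tendstoD(2)[OF ct0, of "1 / 2"]
      by (intro eventually_conj eventually_gt_at_top) (auto simp: filterlim_at_top)
    from eventually_compose_filterlim[OF this t]
    obtain N where N: "\<And>n. n \<ge> N \<Longrightarrow> 0 < t n \<and> r0 \<le> exp (a * t n) \<and> (exp (- a * t n))\<^sup>2 < 1 / 2"
      by (auto simp: eventually_sequentially)
    define T where "T n = t (n + N)" for n
    have T: "0 < T n" "r0 \<le> exp (a * T n)" "(exp (- a * T n))\<^sup>2 < 1 / 2" for n using N[of "n + N"] by (auto simp: T_def)
    have T_top: "filterlim T at_top sequentially"
      unfolding T_def[abs_def] by (rule filterlim_compose[OF t filterlim_add_const_nat_at_top])
    define r where "r n = exp (a * T n)" for n
    define b where "b n = a / (1 - (exp (- a * T n))\<^sup>2)" for n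
    \<comment> \<open>Dividing by \<open>initial_tail (r n)\<close> makes the weights converge; the
      same factor cancels between numerator and denominator of the conditional probability.\<close>
    define w where "w n z = scaled_tail (r n) z / initial_tail (r n)" for n z
    have r: "0 < r n" for n by (simp add: r_def)
    have b: "a \<le> b n" "b n \<le> 2 * a" for n
      using T(3)[of n] a by (auto simp: b_def field_simps)
    then have b_pos: "0 < b n" for n using a less_le_trans by blast
    have b_lim: "b \<longlonglongrightarrow> a"
    proof -
      have "(\<lambda>n. a / (1 - (exp (- a * T n))\<^sup>2)) \<longlonglongrightarrow> a / (1 - 0)"
        by (intro tendsto_intros filterlim_compose[OF ct0 T_top]) auto
      then show ?thesis by (simp add: b_def[abs_def])
    qed
    have r_lim: "filterlim r at_top sequentially"
      unfolding r_def[abs_def] by (rule filterlim_compose[OF r_top T_top])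
    have w: "gaussian_weight (w n) C \<kappa>" for n
    proof
      interpret s: gaussian_weight "scaled_tail (r n)" 1 0 by (rule scaled_tail_weight)
      show "w n \<in> borel_measurable borel" unfolding w_def[abs_def] by measurable
      show "\<bar>w n z\<bar> \<le> C * powr_weight \<kappa> z" for z
      proof (cases "0 < z")
        case True
        have "\<bar>w n z\<bar> = initial_tail (r n * z) / initial_tail (r n)"
          using True S_pos by (simp add: w_def scaled_tail_def abs_of_pos)
        also have "\<dots> \<le> C0 * (1 + z powr (- \<kappa>))"
          using T(2)[of n] True by (intro C0(3)) (simp_all add: r_def)
        also have "\<dots> \<le> C * (1 + z powr (- \<kappa>))"
          by (intro mult_right_mono) (auto simp: C_def)
        finally show ?thesis using True by (simp add: powr_weight_def)
      qed (simp add: w_def scaled_tail_def powr_weight_def)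
    qed (use \<kappa> in auto)
    have w_lim: "(\<lambda>n. w n z) \<longlonglongrightarrow> ?v z" for z
    proof (cases "0 < z")
      case True
      from filterlim_compose[OF S_lim[OF True] r_lim] True show ?thesis
        by (simp add: w_def scaled_tail_def power_tail_def mult.commute)
    qed (simp add: w_def scaled_tail_def power_tail_def)
    note limits = convolution_limits[OF w v w_lim a b b_lim]
    have w_conv: "reflected_convolution (w n) (b n) y = reflected_convolution (scaled_tail (r n)) (b n) y / initial_tail (r n)" for n y
      unfolding reflected_convolution_def w_def by simp
    define F where "F n y = indicator {0..} y * reflected_convolution (w n) (b n) y" for n y
    define h where "h y = indicator {0..} y * ?q y" for y
    have F0: "0 \<le> reflected_convolution (w n) (b n) y" if "0 \<le> y" for n y
    proof -
      have "1 / exp (- a * T n) = r n" by (simp add: r_def exp_minus divide_inverse)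
      then have "0 \<le> reflected_convolution (scaled_tail (r n)) (b n) y"
        using killed_density_eq(2)[OF b_pos _ pos that, of "exp (- a * T n)" n] by simp
      then show ?thesis using S_pos[of "r n"] by (simp add: w_conv)
    qed
    \<comment> \<open>Non-negativity of the limit density, and with it that of the eigenfunction, is
      inherited from the killed densities.\<close>
    have q0: "0 \<le> ?q y" if "0 \<le> y" for y
      by (rule LIMSEQ_le_const[OF limits(1)]) (use F0[OF that] in auto)
    have int: "integrable lborel (\<lambda>y. indicator {0..} y * reflected_convolution u c y)"
        "(LINT y|lborel. indicator {0..} y * reflected_convolution u c y) = symmetric_convolution u c 0"
      if u: "gaussian_weight u C \<kappa>" and c: "0 < c" and lim: "(u \<longlongrightarrow> 0) at_top"
        and nonneg: "\<And>y. 0 \<le> y \<Longrightarrow> 0 \<le> reflected_convolution u c y" and total: "0 \<le> symmetric_convolution u c 0" for u c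
    proof -
      interpret u: gaussian_weight u C \<kappa> by (rule u)
      note [measurable] = u.reflected_convolution_measurable[OF c]
      have nn: "(\<integral>\<^sup>+y. ennreal (indicator {0..} y * reflected_convolution u c y) \<partial>lborel) = ennreal (symmetric_convolution u c 0)"
      proof -
        have "(\<integral>\<^sup>+y. ennreal (indicator {0..} y * reflected_convolution u c y) \<partial>lborel) =
            (\<integral>\<^sup>+y. ennreal (reflected_convolution u c y) * indicator {0..} y \<partial>lborel)"
          by (intro nn_integral_cong) (auto simp: indicator_def)
        also have "\<dots> = ennreal (symmetric_convolution u c 0)"
          by (rule u.nn_integral_reflected_convolution[OF c lim]) (rule nonneg)
        finally show ?thesis .
      qed
      show i: "integrable lborel (\<lambda>y. indicator {0..} y * reflected_convolution u c y)"
        using nn nonneg by (intro integrableI_nonneg) (auto simp: indicator_def)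
      show "(LINT y|lborel. indicator {0..} y * reflected_convolution u c y) = symmetric_convolution u c 0"
        using nn nonneg total by (subst integral_eq_nn_integral) (auto simp: indicator_def)
    qed
    have w_0: "(w n \<longlongrightarrow> 0) at_top" for n
    proof -
      have "((\<lambda>z. initial_tail (r n * z) / initial_tail (r n)) \<longlongrightarrow> 0 / initial_tail (r n)) at_top"
        using r[of n] S_pos[of "r n"]
        by (intro tendsto_divide tendsto_const filterlim_compose[OF S_0]
            filterlim_tendsto_pos_mult_at_top[OF tendsto_const _ filterlim_ident]) auto
      moreover have "\<forall>\<^sub>F z in at_top. initial_tail (r n * z) / initial_tail (r n) = w n z"
        using eventually_gt_at_top[of 0] by eventually_elim (simp add: w_def scaled_tail_def)
      ultimately show ?thesis by (simp add: Lim_transform_eventually)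
    qed
    have "0 \<le> symmetric_convolution (w n) (b n) 0" for n
      using S_pos b_pos by (auto simp: symmetric_convolution_def w_def scaled_tail_def less_imp_le gauss_nonneg intro!: add_nonneg_nonneg integral_nonneg_AE)
    then have F_int: "integrable lborel (F n)" "(LINT y|lborel. F n y) = symmetric_convolution (w n) (b n) 0" for n
      unfolding F_def using int[OF w b_pos w_0 F0] by auto
    have h_int: "integrable lborel h" "(LINT y|lborel. h y) = ?U"
      unfolding h_def using int[OF v a power_tail_tendsto_0[OF \<eta>(1)] q0] U by auto
    have J: "(\<lambda>n. LINT y|lborel. indicator A' y * F n y) \<longlonglongrightarrow> (LINT y|lborel. indicator A' y * h y)"
      if "A' \<in> sets borel" for A'
    proof (rule set_integral_tendsto_if_total_mass_tendsto)
      show "integrable lborel (F n)" for n by (rule F_int)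
      show "integrable lborel h" by (rule h_int)
      show "0 \<le> F n y" "0 \<le> h y" for n y using F0 q0 by (auto simp: F_def h_def indicator_def)
      show "(\<lambda>n. F n y) \<longlonglongrightarrow> h y" for y unfolding F_def h_def by (intro tendsto_mult tendsto_const limits)
      show "(\<lambda>n. LINT y|lborel. F n y) \<longlonglongrightarrow> (LINT y|lborel. h y)"
        unfolding F_int h_int by (rule limits)
    qed fact
    have P: "prob {\<omega> \<in> space M. X (T n) \<omega> \<in> A' \<and> ereal (T n) < hitting_time_zero X \<omega>} =
        initial_tail (r n) * (LINT y|lborel. indicator A' y * F n y)" if "A' \<in> sets borel" for A' n
      unfolding killed_process_law[OF a T(1) ou pos that, folded r_def b_def] F_def w_conv
      using S_pos[of "r n"] by simp
    \<comment> \<open>The survival probability is the case \<open>A' = UNIV\<close> of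
      \<open>P\<close>, so the conditional probability is a ratio of integrals of the same
      \<open>F n\<close>.\<close>
    have cond: "cond_prob M (\<lambda>\<omega>. X (T n) \<omega> \<in> A) (\<lambda>\<omega>. ereal (T n) < hitting_time_zero X \<omega>) =
        (LINT y|lborel. indicator A y * F n y) / (LINT y|lborel. indicator UNIV y * F n y)" for n
      using P[OF A, of n] P[of UNIV n] S_pos[of "r n"] by (simp add: cond_prob_def)
    have mass: "(LINT y|lborel. indicator UNIV y * h y) = ?U" using h_int(2) by simp
    have "(\<lambda>n. (LINT y|lborel. indicator A y * F n y) / (LINT y|lborel. indicator UNIV y * F n y)) \<longlonglongrightarrow>
        (LINT y|lborel. indicator A y * h y) / ?U"
      using tendsto_divide[OF J[OF A] J[of UNIV]] U mass by simp
    also have "(LINT y|lborel. indicator A y * h y) / ?U = measure (quasi_stationary_distribution a (a * \<eta>)) A"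
      unfolding h_def by (rule measure_quasi_stationary_distribution[OF a \<eta> q0 assms(8), symmetric])
    finally have "(\<lambda>n. cond_prob M (\<lambda>\<omega>. X (t (n + N)) \<omega> \<in> A) (\<lambda>\<omega>. ereal (t (n + N)) < hitting_time_zero X \<omega>)) \<longlonglongrightarrow>
        measure (quasi_stationary_distribution a (a * \<eta>)) A"
      unfolding cond[symmetric] T_def .
    then show "(\<lambda>n. cond_prob M (\<lambda>\<omega>. X (t n) \<omega> \<in> A) (\<lambda>\<omega>. ereal (t n) < hitting_time_zero X \<omega>)) \<longlonglongrightarrow>
        measure (quasi_stationary_distribution a (a * \<eta>)) A"
      by (rule LIMSEQ_offset)
  qed
qed

end
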